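(* Let $\mathcal{X}$ be a finite set, $\mathcal{B}$ a finite-dimensional Hilbert space, and $x\mapsto\rho_x$ a classical-quantum channel with density matrices $\rho_x$ on $\mathcal{B}$. Let $p_X$ be a distribution on $\mathcal{X}$ and $\rho^{XB}=\sum_xp_X(x)|x\rangle\langle x|\otimes\rho_x$. For every rate $R<I(X:B)_\rho$ and every $\eta>0$ there exist $\delta\in(0,1/64)$ and a positive integer $n$ such that the following coding scheme over $n$ independent uses of the channel, with $M=\lfloor 2^{nR}\rfloor$ messages, has expected (over the random codebook) average decoding error probability at most $\eta$. Encoding: for each message $m\in\{1,\ldots,M\}$ choose a codeword $x^n(m)\in\mathcal{X}^n$ independently according to the i.i.d. distribution $p_X^{\otimes n}$; sending $m$ produces the state $\rho_{x^n(m)}$. Decoding: for $x^n\in T^{X^n}_\delta$ let $\Pi_{x^n}:=\Pi^{\rho_{x^n}}_\delta$ and for $x^n\notin T^{X^n}_\delta$ let $\Pi_{x^n}:=0$. On receiving a state, for $m=1,2,\ldots,M$ in turn, perform the two-outcome projective measurement $\{\Pi_{x^n(m)},I-\Pi_{x^n(m)}\}$ on the current (post-measurement) state; if the outcome is $\Pi_{x^n(m)}$, stop and output $m$, otherwise proceed to $m+1$; if all $M$ measurements fail, abort (counted as an error).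
   Context: Logarithms are base 2; $I(X:B)_\rho$ is the quantum mutual information of $\rho^{XB}$. $\rho_{x^n}:=\rho_{x_1}\otimes\cdots\otimes\rho_{x_n}$. Typical set: $T^{X^n}_\delta:=\{x^n:\forall x,\ |N(x|x^n)/n-p_X(x)|\le\delta p_X(x)\}$ with $N(x|x^n)$ the number of occurrences of $x$ in $x^n$. For a density matrix $\sigma=\sum_sq(s)|s\rangle\langle s|$ in a fixed eigenbasis, the typical projector $\Pi^{\sigma^n}_\delta$ projects onto the span of basis vectors $|s_1\cdots s_N\rangle$ with $|N(s|s^N)/N-q(s)|\le\delta q(s)$ for all $s$. The conditionally typical projector is $\Pi^{\rho_{x^n}}_\delta:=\bigotimes_{x\in\mathcal{X}}\Pi^{\rho_x^{\otimes N(x|x^n)}}_\delta$, where the factor for $x$ acts on the positions $i$ with $x_i=x$. The average error probability of a codebook is $M^{-1}\sum_m\Pr[\text{decoder output}\ne m\mid m\text{ sent}]$. *)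

theory Defs
  imports "HOL-Analysis.Analysis" "HOL-Computational_Algebra.Polynomial"
    "Jordan_Normal_Form.Char_Poly" "Jordan_Normal_Form.Schur_Decomposition"
begin

definition mtrace :: "complex mat \<Rightarrow> complex" where
  "mtrace A = (\<Sum>i<dim_row A. A $$ (i, i))"

definition outer :: "complex vec \<Rightarrow> complex mat" where
  "outer v = mat (dim_vec v) (dim_vec v) (\<lambda>(i, j). v $ i * cnj (v $ j))"

definition sum_matrix :: "nat \<Rightarrow> ('b \<Rightarrow> complex mat) \<Rightarrow> 'b set \<Rightarrow> complex mat" where
  "sum_matrix D f S = mat D D (\<lambda>ij. \<Sum>x\<in>S. f x $$ ij)"

definition tensor_vec :: "complex vec \<Rightarrow> complex vec \<Rightarrow> complex vec" where
  "tensor_vec u v = vec (dim_vec u * dim_vec v)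
     (\<lambda>i. u $ (i div dim_vec v) * v $ (i mod dim_vec v))"

definition tensor_mat :: "complex mat \<Rightarrow> complex mat \<Rightarrow> complex mat" where
  "tensor_mat A B = mat (dim_row A * dim_row B) (dim_col A * dim_col B)
     (\<lambda>(i, j). A $$ (i div dim_row B, j div dim_col B) * B $$ (i mod dim_row B, j mod dim_col B))"

definition tensor_vec_list :: "complex vec list \<Rightarrow> complex vec" where
  "tensor_vec_list vs = foldr tensor_vec vs (vec 1 (\<lambda>_. 1))"

definition tensor_mat_list :: "complex mat list \<Rightarrow> complex mat" where
  "tensor_mat_list As = foldr tensor_mat As (1\<^sub>m 1)"

definition ptrace_B :: "nat \<Rightarrow> nat \<Rightarrow> complex mat \<Rightarrow> complex mat" where
  "ptrace_B dA dB A = mat dA dA (\<lambda>(a, a'). \<Sum>b<dB. A $$ (a * dB + b, a' * dB + b))"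

definition ptrace_A :: "nat \<Rightarrow> nat \<Rightarrow> complex mat \<Rightarrow> complex mat" where
  "ptrace_A dA dB A = mat dB dB (\<lambda>(b, b'). \<Sum>a<dA. A $$ (a * dB + b, a * dB + b'))"

text \<open>von Neumann entropy (base 2): \<open>-\<Sum> \<lambda> log \<lambda>\<close> over the eigenvalues with multiplicity
  (roots of the characteristic polynomial); note \<open>0 * log 2 0 = 0\<close> in Isabelle.\<close>
definition vn_entropy :: "complex mat \<Rightarrow> real" where
  "vn_entropy A = - sum_mset (image_mset (\<lambda>z. Re z * log 2 (Re z)) (proots (char_poly A)))"

definition mutual_info :: "nat \<Rightarrow> nat \<Rightarrow> complex mat \<Rightarrow> real" where
  "mutual_info dA dB A = vn_entropy (ptrace_B dA dB A) + vn_entropy (ptrace_A dA dB A) - vn_entropy A"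

definition ket :: "nat \<Rightarrow> nat \<Rightarrow> complex vec" where
  "ket k x = vec k (\<lambda>i. if i = x then 1 else 0)"

definition cq_state :: "nat \<Rightarrow> nat \<Rightarrow> (nat \<Rightarrow> real) \<Rightarrow> (nat \<Rightarrow> complex mat) \<Rightarrow> complex mat" where
  "cq_state k d p \<rho> = sum_matrix (k * d) (\<lambda>x. complex_of_real (p x) \<cdot>\<^sub>m tensor_mat (outer (ket k x)) (\<rho> x)) {0..<k}"

definition seqs :: "nat \<Rightarrow> 'a set \<Rightarrow> 'a list set" where
  "seqs n A = {xs. length xs = n \<and> set xs \<subseteq> A}"

definition typical_set :: "nat \<Rightarrow> (nat \<Rightarrow> real) \<Rightarrow> real \<Rightarrow> nat \<Rightarrow> nat list set" where
  "typical_set k p \<delta> n = {xs \<in> seqs n {0..<k}.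
     \<forall>x<k. \<bar>real (count_list xs x) / real n - p x\<bar> \<le> \<delta> * p x}"

text \<open>Conditional typicality of the eigen-index sequence \<open>ss\<close> given \<open>xs\<close>: for every letter \<open>x\<close>,
  the subsequence of \<open>ss\<close> at the positions \<open>i\<close> with \<open>xs!i = x\<close> (of length \<open>N(x|xs)\<close>) is
  \<open>\<delta>\<close>-typical for the eigenvalue distribution \<open>q x\<close>; written with counts multiplied out
  (for \<open>N(x|xs) = 0\<close> the factor is the identity on the trivial space).\<close>
definition cond_typical :: "nat \<Rightarrow> nat \<Rightarrow> (nat \<Rightarrow> nat \<Rightarrow> real) \<Rightarrow> real \<Rightarrow> nat list \<Rightarrow> nat list \<Rightarrow> bool" where
  "cond_typical k d q \<delta> xs ss = (\<forall>x<k. \<forall>s<d.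
     \<bar>real (count_list (zip xs ss) (x, s)) - q x s * real (count_list xs x)\<bar>
       \<le> \<delta> * q x s * real (count_list xs x))"

text \<open>Conditionally typical projector \<open>\<Pi>^{\<rho>_{x^n}}_\<delta>\<close> in the fixed eigenbases \<open>e x s\<close> of \<open>\<rho>_x\<close>.\<close>
definition cond_typ_proj :: "nat \<Rightarrow> nat \<Rightarrow> (nat \<Rightarrow> nat \<Rightarrow> complex vec) \<Rightarrow> (nat \<Rightarrow> nat \<Rightarrow> real)
    \<Rightarrow> real \<Rightarrow> nat list \<Rightarrow> complex mat" where
  "cond_typ_proj k d e q \<delta> xs = sum_matrix (d ^ length xs)
     (\<lambda>ss. outer (tensor_vec_list (map2 e xs ss)))
     {ss \<in> seqs (length xs) {0..<d}. cond_typical k d q \<delta> xs ss}"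

definition dec_proj :: "nat \<Rightarrow> nat \<Rightarrow> (nat \<Rightarrow> real) \<Rightarrow> (nat \<Rightarrow> nat \<Rightarrow> complex vec) \<Rightarrow> (nat \<Rightarrow> nat \<Rightarrow> real)
    \<Rightarrow> real \<Rightarrow> nat list \<Rightarrow> complex mat" where
  "dec_proj k d p e q \<delta> xs =
     (if xs \<in> typical_set k p \<delta> (length xs) then cond_typ_proj k d e q \<delta> xs
      else 0\<^sub>m (d ^ length xs) (d ^ length xs))"

definition fail_op :: "nat \<Rightarrow> complex mat list \<Rightarrow> nat \<Rightarrow> complex mat" where
  "fail_op D Ps j = foldl (\<lambda>K P. (1\<^sub>m D - P) * K) (1\<^sub>m D) (take j Ps)"

definition seq_output_prob :: "nat \<Rightarrow> complex mat list \<Rightarrow> complex mat \<Rightarrow> nat \<Rightarrow> real" where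
  "seq_output_prob D Ps \<sigma> j =
     Re (mtrace (Ps ! j * fail_op D Ps j * \<sigma> * mat_adjoint (fail_op D Ps j) * mat_adjoint (Ps ! j)))"

definition avg_error :: "nat \<Rightarrow> nat \<Rightarrow> (nat \<Rightarrow> real) \<Rightarrow> (nat \<Rightarrow> complex mat) \<Rightarrow> (nat \<Rightarrow> nat \<Rightarrow> complex vec)
    \<Rightarrow> (nat \<Rightarrow> nat \<Rightarrow> real) \<Rightarrow> real \<Rightarrow> nat \<Rightarrow> nat list list \<Rightarrow> real" where
  "avg_error k d p \<rho> e q \<delta> n cb =
     (let M = length cb; Ps = map (dec_proj k d p e q \<delta>) cb in
      (\<Sum>m<M. 1 - seq_output_prob (d ^ n) Ps (tensor_mat_list (map \<rho> (cb ! m))) m) / real M)"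

definition expected_error :: "nat \<Rightarrow> nat \<Rightarrow> (nat \<Rightarrow> real) \<Rightarrow> (nat \<Rightarrow> complex mat) \<Rightarrow> (nat \<Rightarrow> nat \<Rightarrow> complex vec)
    \<Rightarrow> (nat \<Rightarrow> nat \<Rightarrow> real) \<Rightarrow> real \<Rightarrow> nat \<Rightarrow> nat \<Rightarrow> real" where
  "expected_error k d p \<rho> e q \<delta> n M =
     (\<Sum>cb \<in> seqs M (seqs n {0..<k}).
        (\<Prod>c\<leftarrow>cb. \<Prod>x\<leftarrow>c. p x) * avg_error k d p \<rho> e q \<delta> n cb)"

end

theory Submission
  imports Defs
begin

text \<open>
  Write the channel output for the word \<open>xs\<close> as a mixture of product eigenvectors \<open>v\<close>. For projections,
  the loss of squared norm along a sequence of measurements is at most four times the sum of the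
  losses caused by each projection separately (a non-commutative union bound, with no square root).
  It is applied not to \<open>v\<close> but to \<open>w = \<Pi> v\<close>, where \<open>\<Pi>\<close> is the typical projector of the average
  state; \<open>\<Pi>\<close> belongs to the analysis only, not to the decoder. Every term of the resulting bound is
  quadratic in \<open>v\<close>, so expectations over the random codebook pass through. The two terms \<open>|v - w|\<^sup>2\<close> and
  \<open>|v - \<Pi>\<^bsub>xs\<^esub> v|\<^sup>2\<close> average to probabilities of atypical sequences, which Chebyshev's inequality
  bounds by \<open>O(1/n)\<close>. A wrong codeword contributes the rank of its projector, at most \<open>2\<close> to the power
  \<open>n (1 + \<delta>)\<^sup>2 H(B|X)\<close>, times the largest typical eigenvalue of the average state, at most \<open>2\<close> to the
  power \<open>- n (1 - \<delta>) H(B)\<close>; with \<open>M\<close> at most \<open>2\<close> to the power \<open>n R\<close> codewords this vanishes because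
  \<open>R < H(B) - H(B|X)\<close>.
\<close>

section \<open>Independent sequences and typicality\<close>

text \<open>The typical projector is needed because a random output vector averages to the full
  tensor power of the average state. Rank times largest eigenvalue is a useful bound only on the
  typical subspace: atypical eigenvalues can be exponentially larger. The decoder never measures
  this projector, and it need not commute with the tests, so it enters by exchanging the input
  vector \<open>v\<close> for \<open>w\<close>. A direct comparison would cost the first power of |v
  - w|, hence a square root; weighted AM-GM replaces it by a constant c plus (1 + 1/c) times the
  squared distance, with c = \<eta>/2 fixed before n grows. The channel noise is treated
  classically: a letter of an enlarged alphabet is an input letter together with an eigenvalue
  index. A sent word and the eigenvector that it emits then form one i.i.d. sequence of pairs, and
  codewords are in turn the letters of an i.i.d. codebook. All tolerances are relative to the
  probabilities, so letters and eigenvalues of probability 0 never occur in typical sequences; this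
  keeps the entropy exponents valid when logarithms of 0 appear.\<close>

lemma seqs_0: "seqs 0 A = {[]}"
  by (auto simp: seqs_def)

lemma seqs_Suc: "seqs (Suc n) A = (\<lambda>(x, xs). x # xs) ` (A \<times> seqs n A)"
  by (force simp: seqs_def length_Suc_conv)

lemma finite_seqs: "finite A \<Longrightarrow> finite (seqs n A)"
  by (induction n) (auto simp: seqs_0 seqs_Suc)

lemma sum_seqs_Suc:
  assumes "finite A"
  shows "(\<Sum>zs\<in>seqs (Suc n) A. F zs) = (\<Sum>z\<in>A. \<Sum>zs\<in>seqs n A. F (z # zs))"
proof -
  have "inj_on (\<lambda>(x, xs). x # xs) (A \<times> seqs n A)" by (auto simp: inj_on_def)
  then show ?thesis
    by (simp add: seqs_Suc sum.reindex sum.cartesian_product case_prod_unfold comp_def)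
qed

text \<open>Unzipping is a bijection, which separates a sequence of (letter, eigenvalue index) pairs
  into a codeword and an index sequence of the same length.\<close>

lemma sum_seqs_zip:
  "(\<Sum>zs\<in>seqs n (A \<times> B). F zs) = (\<Sum>xs\<in>seqs n A. \<Sum>ys\<in>seqs n B. F (zip xs ys))"
proof -
  have "(\<Sum>zs\<in>seqs n (A \<times> B). F zs) = (\<Sum>(xs, ys)\<in>seqs n A \<times> seqs n B. F (zip xs ys))"
  proof (rule sum.reindex_bij_witness[where i = "\<lambda>(xs, ys). zip xs ys"
          and j = "\<lambda>zs. (map fst zs, map snd zs)"])
    fix zs assume "zs \<in> seqs n (A \<times> B)"
    then show "(map fst zs, map snd zs) \<in> seqs n A \<times> seqs n B" by (fastforce simp: seqs_def)
  qed (auto simp: seqs_def zip_map_fst_snd dest: set_zip_leftD set_zip_rightD)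
  then show ?thesis by (simp add: sum.cartesian_product)
qed

lemma zip_mem_seqs:
  assumes "xs \<in> seqs n A" "ss \<in> seqs n B"
  shows "zip xs ss \<in> seqs n (A \<times> B)"
  using assms by (auto simp: seqs_def dest: set_zip_leftD set_zip_rightD)

text \<open>Expectation under a product law. The letter type is left open because three kinds of
  letters occur: channel inputs or eigenvalue indices, pairs of both, and entire codewords, for
  which the sequence is the codebook.\<close>

definition iid :: "nat \<Rightarrow> 'a set \<Rightarrow> ('a \<Rightarrow> real) \<Rightarrow> ('a list \<Rightarrow> real) \<Rightarrow> real" where
  "iid n A P F = (\<Sum>zs\<in>seqs n A. prod_list (map P zs) * F zs)"

lemma iid_0: "iid 0 A P F = F []"
  by (simp add: iid_def seqs_0)

lemma iid_Suc:
  assumes "finite A"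
  shows "iid (Suc n) A P F = (\<Sum>z\<in>A. P z * iid n A P (\<lambda>zs. F (z # zs)))"
  by (simp add: iid_def sum_seqs_Suc[OF assms] sum_distrib_left mult.assoc)

lemma iid_add: "iid n A P (\<lambda>zs. F zs + G zs) = iid n A P F + iid n A P G"
  by (simp add: iid_def algebra_simps sum.distrib)

lemma iid_cmult: "iid n A P (\<lambda>zs. c * F zs) = c * iid n A P F"
  by (simp add: iid_def sum_distrib_left mult_ac)

lemma iid_sum: "iid n A P (\<lambda>zs. \<Sum>i\<in>I. F i zs) = (\<Sum>i\<in>I. iid n A P (F i))"
  by (simp add: iid_def sum_distrib_left) (rule sum.swap)

lemma iid_cong: "(\<And>zs. zs \<in> seqs n A \<Longrightarrow> F zs = G zs) \<Longrightarrow> iid n A P F = iid n A P G"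
  by (simp add: iid_def)

lemma prod_list_seqs_nonneg:
  assumes "\<And>z. z \<in> A \<Longrightarrow> 0 \<le> (P z :: real)" "zs \<in> seqs n A"
  shows "0 \<le> prod_list (map P zs)"
  using assms by (fastforce simp: seqs_def intro!: prod_list_nonneg)

lemma iid_mono:
  assumes "\<And>z. z \<in> A \<Longrightarrow> 0 \<le> P z" "\<And>zs. zs \<in> seqs n A \<Longrightarrow> F zs \<le> G zs"
  shows "iid n A P F \<le> iid n A P G"
  unfolding iid_def
  by (intro sum_mono mult_left_mono) (use assms prod_list_seqs_nonneg in blast)+

lemma iid_const:
  assumes "finite A" "sum P A = 1"
  shows "iid n A P (\<lambda>_. c) = c"
  by (induction n) (simp_all add: iid_0 iid_Suc[OF assms(1)] flip: sum_distrib_right, simp add: assms)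

text \<open>Marginalisation: all other positions sum to 1. For codebooks this is the law of the
  transmitted codeword.\<close>

lemma iid_nth:
  assumes "finite A" "sum P A = 1" "m < n"
  shows "iid n A P (\<lambda>zs. F (zs ! m)) = (\<Sum>z\<in>A. P z * F z)"
  using assms(3)
proof (induction n arbitrary: m)
  case (Suc n)
  show ?case
  proof (cases m)
    case 0
    then show ?thesis by (simp add: iid_Suc assms(1) iid_const assms(2))
  next
    case (Suc m')
    with Suc.prems have "m' < n" by simp
    then show ?thesis using Suc Suc.IH[of m']
      by (simp add: iid_Suc assms(1) flip: sum_distrib_right, simp add: assms(2))
  qed
qed simp

text \<open>Independence of two positions. The order \<open>i < m\<close> fits the decoder: before
  the test for message m only the codewords of earlier messages have been tested.\<close>

lemma iid_nth2:
  assumes "finite A" "sum P A = 1" "i < m" "m < n"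
  shows "iid n A P (\<lambda>zs. F (zs ! i) (zs ! m)) = (\<Sum>z\<in>A. P z * (\<Sum>w\<in>A. P w * F z w))"
  using assms(3,4)
proof (induction n arbitrary: i m)
  case (Suc n)
  obtain m' where m': "m = Suc m'" "m' < n" using Suc.prems by (cases m) auto
  show ?case
  proof (cases i)
    case 0
    then show ?thesis by (simp add: iid_Suc assms(1) m' iid_nth assms(2))
  next
    case (Suc i')
    with Suc.prems m' have "i' < m'" by simp
    then show ?thesis using Suc Suc.IH[of i' m'] m'
      by (simp add: iid_Suc assms(1) flip: sum_distrib_right, simp add: assms(2))
  qed
qed simp

text \<open>A count is a sum of independent indicators. Mean and variance go through one induction
  because expanding the square leaves a cross term proportional to the centred mean of the shorter
  sequence, which is 0; the variances of the indicators then add.\<close>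

lemma iid_count_moments:
  assumes "finite A" "sum P A = 1" "a \<in> A"
  shows "iid n A P (\<lambda>zs. real (count_list zs a) - P a * real n) = 0"
    and "iid n A P (\<lambda>zs. (real (count_list zs a) - P a * real n)\<^sup>2) = real n * (P a * (1 - P a))"
proof (induction n)
  case 0
  { case 1 then show ?case by (simp add: iid_0) }
  { case 2 then show ?case by (simp add: iid_0) }
next
  case (Suc n)
  define I where "I z = (if z = a then 1 else 0 :: real)" for z
  have I1: "(\<Sum>z\<in>A. P z * (I z - P a)) = 0"
  proof -
    have "(\<Sum>z\<in>A. P z * (I z - P a)) = (\<Sum>z\<in>A. if z = a then P z else 0) - P a * sum P A"
      unfolding sum_distrib_left sum_subtractf[symmetric]
      by (intro sum.cong) (auto simp: I_def algebra_simps)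
    then show ?thesis using assms by simp
  qed
  have I2: "(\<Sum>z\<in>A. P z * (I z - P a)\<^sup>2) = P a * (1 - P a)"
  proof -
    have "(\<Sum>z\<in>A. P z * (I z - P a)\<^sup>2) = (\<Sum>z\<in>A. if z = a then P a * (1 - 2 * P a) else 0) + (P a)\<^sup>2 * sum P A"
      unfolding sum_distrib_left sum.distrib[symmetric]
      by (intro sum.cong) (auto simp: I_def power2_eq_square algebra_simps)
    also have "\<dots> = P a * (1 - 2 * P a) + (P a)\<^sup>2"
      using assms by simp
    finally show ?thesis by (simp add: power2_eq_square algebra_simps)
  qed
  define D where "D zs = real (count_list zs a) - P a * real n" for zs
  have step: "real (count_list (z # zs) a) - P a * real (Suc n) = D zs + (I z - P a)" for z zs
    by (simp add: D_def I_def algebra_simps)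
  have D1: "iid n A P D = 0" and D2: "iid n A P (\<lambda>zs. (D zs)\<^sup>2) = real n * (P a * (1 - P a))"
    using Suc by (simp_all add: D_def[abs_def])
  { case 1
    show ?case
      by (simp only: iid_Suc[OF assms(1)] step iid_add D1 iid_const[OF assms(1,2)]) (simp add: I1) }
  { case 2
    have sq: "(D zs + (I z - P a))\<^sup>2 = (D zs)\<^sup>2 + (2 * (I z - P a)) * D zs + (I z - P a)\<^sup>2" for z zs
      by (simp add: power2_eq_square algebra_simps)
    show ?case
      by (simp only: iid_Suc[OF assms(1)] step sq iid_add iid_cmult D1 D2 iid_const[OF assms(1,2)])
         (simp add: distrib_left sum.distrib I2 flip: sum_distrib_right, simp add: assms algebra_simps) }
qed

text \<open>The relative-deviation condition of \<open>typical_set\<close> with the length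
  multiplied out. A letter of probability 0 must not occur at all.\<close>

definition rel_typical :: "'a set \<Rightarrow> ('a \<Rightarrow> real) \<Rightarrow> real \<Rightarrow> 'a list \<Rightarrow> bool" where
  "rel_typical A P \<delta> zs \<longleftrightarrow>
     (\<forall>a\<in>A. \<bar>real (count_list zs a) - P a * real (length zs)\<bar> \<le> \<delta> * P a * real (length zs))"

text \<open>Chebyshev's inequality with threshold \<delta> n P(a) and variance at most n
  P(a).\<close>

lemma letter_atypical_prob:
  assumes A: "finite A" "sum P A = 1" "\<And>z. z \<in> A \<Longrightarrow> 0 \<le> P z"
    and "a \<in> A" "0 < \<delta>" "0 < n"
  shows "iid n A P (\<lambda>zs. if \<bar>real (count_list zs a) - P a * real n\<bar> \<le> \<delta> * P a * real n then 0 else 1)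
    \<le> 1 / (\<delta>\<^sup>2 * P a) / real n"
proof (cases "P a = 0")
  case True
  \<comment> \<open>Chebyshev is empty here, since the threshold is 0. The letter is atypical as
    soon as it occurs, so the indicator is at most the count, whose mean is 0.\<close>
  have "iid n A P (\<lambda>zs. if \<bar>real (count_list zs a) - P a * real n\<bar> \<le> \<delta> * P a * real n then 0 else 1)
    \<le> iid n A P (\<lambda>zs. real (count_list zs a) - P a * real n)"
    by (rule iid_mono[OF A(3)]) (auto simp: True)
  then show ?thesis using iid_count_moments(1)[OF A(1,2) \<open>a \<in> A\<close>, of n] True by simp
next
  case False
  then have pos: "P a > 0" using A(3)[OF \<open>a \<in> A\<close>] by simp
  define t where "t = \<delta> * P a * real n"
  have t: "t > 0" using pos assms by (simp add: t_def)
  have "iid n A P (\<lambda>zs. if \<bar>real (count_list zs a) - P a * real n\<bar> \<le> \<delta> * P a * real n then 0 else 1)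
    \<le> iid n A P (\<lambda>zs. (1 / t\<^sup>2) * (real (count_list zs a) - P a * real n)\<^sup>2)"
  proof (rule iid_mono[OF A(3)])
    fix zs :: "'a list"
    let ?D = "real (count_list zs a) - P a * real n"
    show "(if \<bar>?D\<bar> \<le> \<delta> * P a * real n then 0 else 1) \<le> (1 / t\<^sup>2) * ?D\<^sup>2"
    proof (cases "\<bar>?D\<bar> \<le> t")
      case False
      then have "t\<^sup>2 \<le> ?D\<^sup>2" using t by (metis abs_le_square_iff abs_of_pos linorder_not_le less_imp_le)
      then show ?thesis using False t unfolding t_def[symmetric] by simp
    qed (simp add: t_def)
  qed
  also have "\<dots> = (1 / t\<^sup>2) * (real n * (P a * (1 - P a)))"
    by (simp only: iid_cmult iid_count_moments(2)[OF A(1,2) \<open>a \<in> A\<close>])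
  also have "\<dots> \<le> (1 / t\<^sup>2) * (real n * (P a * 1))"
    using pos t by (intro mult_left_mono) auto
  also have "\<dots> = 1 / (\<delta>\<^sup>2 * P a) / real n"
    using pos assms by (simp add: t_def power2_eq_square field_simps)
  finally show ?thesis .
qed

text \<open>Letters of probability \<open>0\<close> do not contribute to the sum, since \<open>1 / 0 = 0\<close>.\<close>
lemma atypical_prob:
  assumes A: "finite A" "sum P A = 1" "\<And>z. z \<in> A \<Longrightarrow> 0 \<le> P z" and "0 < \<delta>" "0 < n"
  shows "iid n A P (\<lambda>zs. if rel_typical A P \<delta> zs then 0 else 1) \<le> (\<Sum>a\<in>A. 1 / (\<delta>\<^sup>2 * P a)) / real n"
proof -
  let ?I = "\<lambda>a zs. if \<bar>real (count_list zs a) - P a * real n\<bar> \<le> \<delta> * P a * real n then 0 else 1 :: real"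
  have "iid n A P (\<lambda>zs. if rel_typical A P \<delta> zs then 0 else 1) \<le> iid n A P (\<lambda>zs. \<Sum>a\<in>A. ?I a zs)"
  proof (rule iid_mono[OF A(3)])
    fix zs assume zs: "zs \<in> seqs n A"
    show "(if rel_typical A P \<delta> zs then 0 else 1) \<le> (\<Sum>a\<in>A. ?I a zs)"
    proof (cases "rel_typical A P \<delta> zs")
      case True then show ?thesis by (auto intro!: sum_nonneg)
    next
      case False
      then obtain a where a: "a \<in> A" "?I a zs = 1" using zs by (auto simp: rel_typical_def seqs_def)
      then show ?thesis using member_le_sum[of a A "\<lambda>a. ?I a zs"] A(1) False by simp
    qed
  qed
  also have "\<dots> \<le> (\<Sum>a\<in>A. 1 / (\<delta>\<^sup>2 * P a) / real n)"
    unfolding iid_sum by (intro sum_mono letter_atypical_prob assms) auto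
  finally show ?thesis by (simp add: sum_divide_distrib)
qed

section \<open>Probabilities of sequences with prescribed letter counts\<close>

lemma prod_list_seqs_eq_prod_count:
  fixes g :: "'a \<Rightarrow> real"
  assumes "finite A" "zs \<in> seqs n A"
  shows "prod_list (map g zs) = (\<Prod>a\<in>A. g a ^ count_list zs a)"
proof -
  have "prod_list (map g zs) = (\<Prod>a\<in>A. g a ^ count_list zs a)" if "set zs \<subseteq> A" for zs
    using that
  proof (induction zs)
    case (Cons z zs)
    have "(\<Prod>a\<in>A. g a ^ count_list (z # zs) a)
      = (\<Prod>a\<in>A. (if z = a then g a else 1) * g a ^ count_list zs a)"
      by (intro prod.cong) auto
    also have "\<dots> = g z * (\<Prod>a\<in>A. g a ^ count_list zs a)"
      using Cons.prems assms(1) by (simp add: prod.distrib prod.delta)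
    finally show ?case using Cons by simp
  qed simp
  then show ?thesis using assms by (auto simp: seqs_def)
qed

text \<open>Logarithms of numbers in (0, 1] are nonpositive, so lower bounds on the counts bound the
  product from above.\<close>

lemma prod_list_le_powr:
  assumes A: "finite A" "zs \<in> seqs n A" "\<And>a. a \<in> A \<Longrightarrow> 0 \<le> g a \<and> g a \<le> 1"
    and l: "\<And>a. a \<in> A \<Longrightarrow> l a \<le> real (count_list zs a)"
  shows "prod_list (map g zs) \<le> 2 powr (\<Sum>a\<in>A. l a * log 2 (g a))"
proof -
  have "g a ^ count_list zs a \<le> 2 powr (l a * log 2 (g a))" if a: "a \<in> A" for a
  proof (cases "g a = 0")
    case True
    \<comment> \<open>Here \<open>log 2 0 = 0\<close> makes the right-hand side 1, and a power of 0
      is at most 1.\<close>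
    then show ?thesis by (simp add: power_0_left log_def)
  next
    case False
    then have pos: "g a > 0" using A(3) a by (simp add: less_le)
    then have "g a ^ count_list zs a = 2 powr (real (count_list zs a) * log 2 (g a))"
      by (simp add: powr_powr[symmetric] powr_realpow mult.commute[of "real _"])
    also have "\<dots> \<le> 2 powr (l a * log 2 (g a))"
      using pos A(3)[OF a] l[OF a] by (intro powr_mono mult_right_mono_neg) auto
    finally show ?thesis .
  qed
  then have "(\<Prod>a\<in>A. g a ^ count_list zs a) \<le> (\<Prod>a\<in>A. 2 powr (l a * log 2 (g a)))"
    by (intro prod_mono) (use A(3) in auto)
  then show ?thesis by (simp add: prod_list_seqs_eq_prod_count[OF A(1,2)] powr_sum A(1))
qed

text \<open>The reverse estimate from upper bounds on the counts. A factor with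
  \<open>g a = 0\<close> contributes 1 on the left, as \<open>log 2 0 = 0\<close>, so on the right
  it has to be \<open>0 ^ 0\<close>; \<open>u0\<close> provides this.\<close>

lemma prod_list_ge_powr:
  assumes A: "finite A" "zs \<in> seqs n A" "\<And>a. a \<in> A \<Longrightarrow> 0 \<le> g a \<and> g a \<le> 1"
    and u: "\<And>a. a \<in> A \<Longrightarrow> real (count_list zs a) \<le> u a"
    and u0: "\<And>a. a \<in> A \<Longrightarrow> g a = 0 \<Longrightarrow> count_list zs a = 0"
  shows "2 powr (\<Sum>a\<in>A. u a * log 2 (g a)) \<le> prod_list (map g zs)"
proof -
  have "2 powr (u a * log 2 (g a)) \<le> g a ^ count_list zs a" if a: "a \<in> A" for a
  proof (cases "g a = 0")
    case True
    then show ?thesis using u0[OF a] by (simp add: log_def)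
  next
    case False
    then have pos: "g a > 0" using A(3) a by (simp add: less_le)
    have "2 powr (u a * log 2 (g a)) \<le> 2 powr (real (count_list zs a) * log 2 (g a))"
      using pos A(3)[OF a] u[OF a] by (intro powr_mono mult_right_mono_neg) auto
    also have "\<dots> = g a ^ count_list zs a"
      using pos by (simp add: powr_powr[symmetric] powr_realpow mult.commute[of "real _"])
    finally show ?thesis .
  qed
  then have "(\<Prod>a\<in>A. 2 powr (u a * log 2 (g a))) \<le> (\<Prod>a\<in>A. g a ^ count_list zs a)"
    by (intro prod_mono) auto
  then show ?thesis by (simp add: prod_list_seqs_eq_prod_count[OF A(1,2)] powr_sum A(1))
qed

section \<open>Projections and the union bound\<close>

definition nrm2 :: "complex vec \<Rightarrow> real" where
  "nrm2 v = Re (v \<bullet>c v)"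

lemma cprod_sum:
  assumes "u \<in> carrier_vec D" "v \<in> carrier_vec D"
  shows "u \<bullet>c v = (\<Sum>i<D. u $ i * cnj (v $ i))"
  using assms by (simp add: scalar_prod_def atLeast0LessThan)

lemma cprod_cnj:
  assumes "u \<in> carrier_vec D" "v \<in> carrier_vec D"
  shows "cnj (u \<bullet>c v) = v \<bullet>c u"
  using assms by (simp add: cprod_sum[of _ D] mult.commute)

lemma cprod_self: "v \<bullet>c v = complex_of_real (nrm2 v)"
  by (auto simp: nrm2_def complex_eq_iff scalar_prod_def)

lemma nrm2_sum: "v \<in> carrier_vec D \<Longrightarrow> nrm2 v = (\<Sum>i<D. (cmod (v $ i))\<^sup>2)"
  by (simp add: nrm2_def cprod_sum[of _ D] complex_mult_cnj cmod_power2)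

lemma nrm2_nonneg: "0 \<le> nrm2 v"
  using nrm2_sum[of v "dim_vec v"] by (simp add: sum_nonneg)

lemma cmod_minus_power2: "(cmod (a - b))\<^sup>2 = (cmod a)\<^sup>2 + (cmod b)\<^sup>2 - 2 * Re (a * cnj b)"
  unfolding cmod_power2 by (simp add: power2_eq_square algebra_simps)

lemma nrm2_minus:
  assumes "u \<in> carrier_vec D" "v \<in> carrier_vec D"
  shows "nrm2 (u - v) = nrm2 u + nrm2 v - 2 * Re (u \<bullet>c v)"
proof -
  have "nrm2 (u - v) = (\<Sum>i<D. (cmod (u $ i))\<^sup>2 + (cmod (v $ i))\<^sup>2 - 2 * Re (u $ i * cnj (v $ i)))"
    using assms
    by (subst nrm2_sum[of _ D]) (auto simp: cmod_minus_power2)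
  then show ?thesis
    using assms by (simp add: nrm2_sum[of _ D] cprod_sum[of _ D] sum.distrib sum_subtractf flip: sum_distrib_left)
qed

text \<open>Coordinatewise AM-GM, from the square of c x - y divided by c. The free weight c is what
  the later estimates tune: 2 in the telescoping step, 1 in the union bound, arbitrary in the
  perturbation bound.\<close>

lemma Re_cprod_le:
  assumes "u \<in> carrier_vec D" "v \<in> carrier_vec D" "0 < c"
  shows "2 * Re (u \<bullet>c v) \<le> c * nrm2 u + nrm2 v / c"
proof -
  have "2 * Re (x * cnj y) \<le> c * (cmod x)\<^sup>2 + (cmod y)\<^sup>2 / c" for x y
  proof -
    have "0 \<le> (c * Re x - Re y)\<^sup>2 / c + (c * Im x - Im y)\<^sup>2 / c" using assms(3) by simp
    also have "\<dots> = c * (cmod x)\<^sup>2 + (cmod y)\<^sup>2 / c - 2 * Re (x * cnj y)"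
      unfolding cmod_power2 using assms(3) by (simp add: power2_eq_square field_simps)
    finally show ?thesis by simp
  qed
  then have "(\<Sum>i<D. 2 * Re (u $ i * cnj (v $ i))) \<le> (\<Sum>i<D. c * (cmod (u $ i))\<^sup>2 + (cmod (v $ i))\<^sup>2 / c)"
    by (intro sum_mono)
  then show ?thesis using assms
    by (simp add: nrm2_sum[of _ D] cprod_sum[of _ D] sum.distrib sum_distrib_left sum_divide_distrib)
qed

text \<open>A triangle inequality for squared norms. The leading factor can be brought arbitrarily
  close to 1 while the error stays proportional to the squared distance, so it can be averaged
  without a square root.\<close>

lemma nrm2_le_perturb:
  assumes "u \<in> carrier_vec D" "v \<in> carrier_vec D" "0 < c"
  shows "nrm2 u \<le> (1 + c) * nrm2 v + (1 + 1 / c) * nrm2 (v - u)"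
proof -
  have "nrm2 u = nrm2 (v - (v - u))" using assms by (intro arg_cong[of _ _ nrm2]) auto
  also have "\<dots> = nrm2 v + nrm2 (v - u) - 2 * Re (v \<bullet>c (v - u))"
    using assms by (intro nrm2_minus[of _ D]) auto
  finally have "nrm2 u = nrm2 v + nrm2 (v - u) - 2 * Re (v \<bullet>c (v - u))" .
  moreover have "- (2 * Re (v \<bullet>c (v - u))) \<le> c * nrm2 v + nrm2 (v - u) / c"
  proof -
    have "v \<bullet>c (u - v) = - (v \<bullet>c (v - u))"
      using assms by (subst (1 2) cprod_sum[of _ D]) (auto simp: algebra_simps simp flip: sum_negf)
    moreover have "nrm2 (u - v) = nrm2 (v - u)"
      using assms by (simp add: nrm2_sum[of _ D] norm_minus_commute)
    ultimately show ?thesis using Re_cprod_le[of v D "u - v" c] assms by simp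
  qed
  ultimately show ?thesis by (simp add: distrib_right)
qed

lemma cprod_minus_left:
  fixes u v w :: "complex vec"
  assumes "u \<in> carrier_vec D" "v \<in> carrier_vec D" "w \<in> carrier_vec D"
  shows "(u - v) \<bullet>c w = u \<bullet>c w - v \<bullet>c w"
  using assms by (simp add: minus_scalar_prod_distrib[of _ D])

lemma cprod_minus_right:
  fixes u v w :: "complex vec"
  assumes "u \<in> carrier_vec D" "v \<in> carrier_vec D" "w \<in> carrier_vec D"
  shows "w \<bullet>c (u - v) = w \<bullet>c u - w \<bullet>c v"
  using assms unfolding cprod_sum[of w D u, OF assms(3,1)] cprod_sum[of w D v, OF assms(3,2)]
  by (subst cprod_sum[of _ D]) (auto simp: algebra_simps simp flip: sum_subtractf)

text \<open>Orthogonal projections, that is, Hermitian idempotent matrices: the two identities say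
  that P and its adjoint both equal the product of the adjoint with P. Inner products are the only
  form in which this is used later, so adjoint matrices stay out of the vector estimates.\<close>

definition projection :: "nat \<Rightarrow> complex mat \<Rightarrow> bool" where
  "projection D P \<longleftrightarrow> P \<in> carrier_mat D D \<and>
     (\<forall>v\<in>carrier_vec D. \<forall>w\<in>carrier_vec D.
        (P *\<^sub>v v) \<bullet>c w = (P *\<^sub>v v) \<bullet>c (P *\<^sub>v w) \<and> v \<bullet>c (P *\<^sub>v w) = (P *\<^sub>v v) \<bullet>c (P *\<^sub>v w))"

lemma projectionD:
  assumes "projection D P" "v \<in> carrier_vec D" "w \<in> carrier_vec D"
  shows "(P *\<^sub>v v) \<bullet>c w = (P *\<^sub>v v) \<bullet>c (P *\<^sub>v w)" "v \<bullet>c (P *\<^sub>v w) = (P *\<^sub>v v) \<bullet>c (P *\<^sub>v w)"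
  using assms unfolding projection_def by blast+

lemma projection_carrier: "projection D P \<Longrightarrow> P \<in> carrier_mat D D"
  unfolding projection_def by blast

lemma projection_vec_carrier: "projection D P \<Longrightarrow> v \<in> carrier_vec D \<Longrightarrow> P *\<^sub>v v \<in> carrier_vec D"
  by (auto dest!: projection_carrier)

lemma mult_one_minus_vec:
  fixes P :: "complex mat"
  assumes "P \<in> carrier_mat D D" "v \<in> carrier_vec D"
  shows "(1\<^sub>m D - P) *\<^sub>v v = v - P *\<^sub>v v"
  using assms by (simp add: minus_mult_distrib_mat_vec[of _ D D])

lemma projection_compl:
  assumes "projection D P"
  shows "projection D (1\<^sub>m D - P)"
  unfolding projection_def
proof (intro conjI ballI)
  note P = projection_carrier[OF assms]
  show "1\<^sub>m D - P \<in> carrier_mat D D" using P by (rule minus_carrier_mat)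
  fix v w :: "complex vec" assume v: "v \<in> carrier_vec D" and w: "w \<in> carrier_vec D"
  note c = projection_vec_carrier[OF assms v] projection_vec_carrier[OF assms w]
  note d = projectionD[OF assms v w]
  show "((1\<^sub>m D - P) *\<^sub>v v) \<bullet>c w = ((1\<^sub>m D - P) *\<^sub>v v) \<bullet>c ((1\<^sub>m D - P) *\<^sub>v w)"
    using P v w c d
    by (simp add: mult_one_minus_vec cprod_minus_left[of _ D] cprod_minus_right[of _ D] del: minus_mult_distrib_mat_vec)
  show "v \<bullet>c ((1\<^sub>m D - P) *\<^sub>v w) = ((1\<^sub>m D - P) *\<^sub>v v) \<bullet>c ((1\<^sub>m D - P) *\<^sub>v w)"
    using P v w c d
    by (simp add: mult_one_minus_vec cprod_minus_left[of _ D] cprod_minus_right[of _ D] del: minus_mult_distrib_mat_vec)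
qed

lemma nrm2_projection:
  assumes "projection D P" "v \<in> carrier_vec D"
  shows "nrm2 (P *\<^sub>v v) = Re ((P *\<^sub>v v) \<bullet>c v)"
  using projectionD(1)[OF assms(1,2,2)] by (simp add: nrm2_def)

lemma nrm2_compl:
  assumes "projection D P" "v \<in> carrier_vec D"
  shows "nrm2 (v - P *\<^sub>v v) = nrm2 v - nrm2 (P *\<^sub>v v)"
  using assms projection_vec_carrier[OF assms] projectionD(2)[OF assms(1,2,2)]
  by (subst nrm2_minus[of _ D]) (auto simp: nrm2_def)

lemma nrm2_projection_le:
  assumes "projection D P" "v \<in> carrier_vec D"
  shows "nrm2 (P *\<^sub>v v) \<le> nrm2 v"
  using nrm2_compl[OF assms] nrm2_nonneg[of "v - P *\<^sub>v v"] by simp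

lemma zero_mat_mult_vec: "v \<in> carrier_vec D \<Longrightarrow> 0\<^sub>m D D *\<^sub>v v = 0\<^sub>v D" for v :: "complex vec"
  by (intro eq_vecI) (auto simp: scalar_prod_def)

lemma projection_zero: "projection D (0\<^sub>m D D)"
  by (auto simp: projection_def zero_mat_mult_vec)

text \<open>The head of the list acts first. The vector is not renormalised in between, so for a
  unit vector and a list of projections the final squared norm is the probability that all these
  outcomes occur in order.\<close>

fun seq_apply :: "complex mat list \<Rightarrow> complex vec \<Rightarrow> complex vec" where
  "seq_apply [] v = v"
| "seq_apply (P # Ps) v = seq_apply Ps (P *\<^sub>v v)"

lemma seq_apply_append: "seq_apply (Ps @ Qs) v = seq_apply Qs (seq_apply Ps v)"
  by (induction Ps arbitrary: v) auto

lemma seq_apply_carrier: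
  assumes "\<forall>P\<in>set Ps. projection D P" "v \<in> carrier_vec D"
  shows "seq_apply Ps v \<in> carrier_vec D"
  using assms by (induction Ps arbitrary: v) (auto intro: projection_vec_carrier)

lemma nrm2_seq_apply_le:
  assumes "\<forall>P\<in>set Ps. projection D P" "v \<in> carrier_vec D"
  shows "nrm2 (seq_apply Ps v) \<le> nrm2 v"
  using assms
proof (induction Ps arbitrary: v)
  case (Cons P Ps)
  then have "projection D P" "P *\<^sub>v v \<in> carrier_vec D" by (auto intro: projection_vec_carrier)
  then have "nrm2 (seq_apply Ps (P *\<^sub>v v)) \<le> nrm2 (P *\<^sub>v v)" "nrm2 (P *\<^sub>v v) \<le> nrm2 v"
    using Cons.IH[of "P *\<^sub>v v"] Cons.prems nrm2_projection_le[of D P v] by auto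
  then show ?case by simp
qed simp

lemma seq_apply_minus:
  assumes "\<forall>P\<in>set Ps. projection D P" "v \<in> carrier_vec D" "w \<in> carrier_vec D"
  shows "seq_apply Ps (v - w) = seq_apply Ps v - seq_apply Ps w"
  using assms
proof (induction Ps arbitrary: v w)
  case (Cons P Ps)
  then show ?case
    using Cons.IH[of "P *\<^sub>v v" "P *\<^sub>v w"]
    by (simp add: projection_vec_carrier mult_minus_distrib_mat_vec[OF projection_carrier, of D])
qed simp

text \<open>
  The two inner products telescope to the sum over the steps of \<open>Re \<langle>Q u, Q v\<rangle>\<close>, where \<open>Q\<close> is the
  complement of the step's projection and \<open>v\<close> the current vector; AM-GM splits each of them as
  \<open>|Q u|\<^sup>2 + |Q v|\<^sup>2 / 4\<close>, and the second parts sum to the total loss of squared norm.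
\<close>
lemma seq_apply_telescope:
  assumes "\<forall>P\<in>set Ps. projection D P" "u \<in> carrier_vec D" "v \<in> carrier_vec D"
  shows "Re (u \<bullet>c v) - Re (u \<bullet>c seq_apply Ps v)
    \<le> (\<Sum>P\<leftarrow>Ps. nrm2 (u - P *\<^sub>v u)) + (nrm2 v - nrm2 (seq_apply Ps v)) / 4"
  using assms
proof (induction Ps arbitrary: v)
  case (Cons P Ps)
  have P: "projection D P" using Cons.prems by simp
  note Pv = projection_vec_carrier[OF P Cons.prems(3)] and Pu = projection_vec_carrier[OF P Cons.prems(2)]
  note Q = projection_compl[OF P]
  \<comment> \<open>Inserting the complementary projection on both sides turns the increment into an
    inner product of two small vectors, to which AM-GM with weight 2 applies.\<close>
  have eq: "u \<bullet>c (v - P *\<^sub>v v) = (u - P *\<^sub>v u) \<bullet>c (v - P *\<^sub>v v)"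
    using projectionD(2)[OF Q Cons.prems(2,3)] projection_carrier[OF P] Cons.prems
    by (simp add: mult_one_minus_vec)
  have "Re (u \<bullet>c v) - Re (u \<bullet>c (P *\<^sub>v v)) = Re (u \<bullet>c (v - P *\<^sub>v v))"
    using Cons.prems Pv by (simp add: cprod_minus_right[of _ D])
  also have "\<dots> \<le> nrm2 (u - P *\<^sub>v u) + nrm2 (v - P *\<^sub>v v) / 4"
    using Re_cprod_le[of "u - P *\<^sub>v u" D "v - P *\<^sub>v v" 2] Cons.prems Pu Pv by (simp add: eq)
  also have "nrm2 (v - P *\<^sub>v v) = nrm2 v - nrm2 (P *\<^sub>v v)"
    using nrm2_compl[OF P Cons.prems(3)] .
  finally have "Re (u \<bullet>c v) - Re (u \<bullet>c (P *\<^sub>v v)) \<le> nrm2 (u - P *\<^sub>v u) + (nrm2 v - nrm2 (P *\<^sub>v v)) / 4" .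
  moreover have "Re (u \<bullet>c (P *\<^sub>v v)) - Re (u \<bullet>c seq_apply Ps (P *\<^sub>v v))
    \<le> (\<Sum>P\<leftarrow>Ps. nrm2 (u - P *\<^sub>v u)) + (nrm2 (P *\<^sub>v v) - nrm2 (seq_apply Ps (P *\<^sub>v v))) / 4"
    using Cons.IH[of "P *\<^sub>v v"] Cons.prems Pv by simp
  ultimately show ?case by (simp add: field_simps)
qed simp

text \<open>Telescoping with \<open>u = v\<close> bounds |v|^2 minus the overlap of v with its final
  vector by the sum plus a quarter of the loss. AM-GM bounds that difference from below by half the
  loss. Absorbing the quarter leaves a quarter of the loss, whence the factor 4.\<close>

lemma projection_union_bound:
  assumes "\<forall>P\<in>set Ps. projection D P" "v \<in> carrier_vec D"
  shows "nrm2 v - nrm2 (seq_apply Ps v) \<le> 4 * (\<Sum>P\<leftarrow>Ps. nrm2 (v - P *\<^sub>v v))"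
proof -
  have "Re (v \<bullet>c v) = nrm2 v" by (simp add: nrm2_def)
  moreover have "2 * Re (v \<bullet>c seq_apply Ps v) \<le> nrm2 v + nrm2 (seq_apply Ps v)"
    using Re_cprod_le[OF assms(2) seq_apply_carrier[OF assms], of 1] by simp
  ultimately show ?thesis using seq_apply_telescope[OF assms assms(2)] by argo
qed

section \<open>Sums of rank-one matrices and projectors onto spans\<close>

lemma smult_outer_index:
  "v \<in> carrier_vec D \<Longrightarrow> i < D \<Longrightarrow> j < D \<Longrightarrow> (c \<cdot>\<^sub>m outer v) $$ (i, j) = c * (v $ i * cnj (v $ j))"
  by (simp add: outer_def)

text \<open>The sesquilinear form of a mixture of rank-one matrices. The vectors may overlap:
  besides spectral decompositions this covers the average state, where eigenvectors of different
  letters are mixed.\<close>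

lemma sum_matrix_outer_cprod:
  assumes "finite S" "\<And>s. s \<in> S \<Longrightarrow> u s \<in> carrier_vec D" "v \<in> carrier_vec D" "w \<in> carrier_vec D"
  shows "(sum_matrix D (\<lambda>s. complex_of_real (c s) \<cdot>\<^sub>m outer (u s)) S *\<^sub>v v) \<bullet>c w
    = (\<Sum>s\<in>S. complex_of_real (c s) * (v \<bullet>c u s) * (u s \<bullet>c w))"
proof -
  let ?A = "sum_matrix D (\<lambda>s. complex_of_real (c s) \<cdot>\<^sub>m outer (u s)) S"
  have "?A *\<^sub>v v \<in> carrier_vec D" by (simp add: sum_matrix_def carrier_vecI)
  moreover have "(?A *\<^sub>v v) $ i = (\<Sum>s\<in>S. complex_of_real (c s) * (v \<bullet>c u s) * u s $ i)" if "i < D" for i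
  proof -
    have "(?A *\<^sub>v v) $ i = (\<Sum>j<D. (\<Sum>s\<in>S. complex_of_real (c s) * (u s $ i * cnj (u s $ j))) * v $ j)"
      using that assms(2,3)
      by (auto simp: sum_matrix_def scalar_prod_def smult_outer_index[of _ D] atLeast0LessThan intro!: sum.cong)
    also have "\<dots> = (\<Sum>s\<in>S. \<Sum>j<D. complex_of_real (c s) * (u s $ i * cnj (u s $ j)) * v $ j)"
      by (subst sum.swap) (simp add: sum_distrib_right)
    also have "\<dots> = (\<Sum>s\<in>S. complex_of_real (c s) * (v \<bullet>c u s) * u s $ i)"
      using assms by (intro sum.cong) (auto simp: cprod_sum[of _ D] sum_distrib_left sum_distrib_right mult_ac)
    finally show ?thesis .
  qed
  ultimately have "(?A *\<^sub>v v) \<bullet>c w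
      = (\<Sum>i<D. (\<Sum>s\<in>S. complex_of_real (c s) * (v \<bullet>c u s) * u s $ i) * cnj (w $ i))"
    using assms(4) by (simp add: cprod_sum[of _ D])
  also have "\<dots> = (\<Sum>s\<in>S. \<Sum>i<D. complex_of_real (c s) * (v \<bullet>c u s) * u s $ i * cnj (w $ i))"
    by (subst sum.swap) (simp add: sum_distrib_right)
  also have "\<dots> = (\<Sum>s\<in>S. complex_of_real (c s) * (v \<bullet>c u s) * (u s \<bullet>c w))"
    using assms by (intro sum.cong refl) (subst cprod_sum[of "u _" D w], auto simp: sum_distrib_left mult_ac)
  finally show ?thesis .
qed

definition orthonormal_on :: "nat \<Rightarrow> ('a \<Rightarrow> complex vec) \<Rightarrow> 'a set \<Rightarrow> bool" where
  "orthonormal_on D u S \<longleftrightarrow> (\<forall>s\<in>S. u s \<in> carrier_vec D) \<and>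
     (\<forall>s\<in>S. \<forall>t\<in>S. u s \<bullet>c u t = (if s = t then 1 else 0))"

definition span_proj :: "nat \<Rightarrow> ('a \<Rightarrow> complex vec) \<Rightarrow> 'a set \<Rightarrow> complex mat" where
  "span_proj D u S = sum_matrix D (\<lambda>s. outer (u s)) S"

lemma span_proj_carrier: "span_proj D u S \<in> carrier_mat D D"
  by (simp add: span_proj_def sum_matrix_def)

lemma span_proj_cprod:
  assumes "finite S" "orthonormal_on D u S" "v \<in> carrier_vec D" "w \<in> carrier_vec D"
  shows "(span_proj D u S *\<^sub>v v) \<bullet>c w = (\<Sum>s\<in>S. (v \<bullet>c u s) * (u s \<bullet>c w))"
proof -
  have "1 \<cdot>\<^sub>m A = A" for A :: "complex mat" by (rule eq_matI) auto
  then show ?thesis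
    using sum_matrix_outer_cprod[of S u D v w "\<lambda>_. 1"] assms
    by (simp add: span_proj_def orthonormal_on_def)
qed

lemma span_proj_cprod_basis:
  assumes "finite S" "orthonormal_on D u S" "s \<in> S" "v \<in> carrier_vec D"
  shows "(span_proj D u S *\<^sub>v v) \<bullet>c u s = v \<bullet>c u s"
proof -
  have "u s \<in> carrier_vec D" using assms by (auto simp: orthonormal_on_def)
  then have "(span_proj D u S *\<^sub>v v) \<bullet>c u s = (\<Sum>t\<in>S. (v \<bullet>c u t) * (u t \<bullet>c u s))"
    by (rule span_proj_cprod[OF assms(1,2,4)])
  also have "\<dots> = (\<Sum>t\<in>S. if t = s then v \<bullet>c u s else 0)"
    using assms(2,3) by (intro sum.cong) (auto simp: orthonormal_on_def)
  finally show ?thesis using assms by simp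
qed

lemma span_proj_projection:
  assumes "finite S" "orthonormal_on D u S"
  shows "projection D (span_proj D u S)"
  unfolding projection_def
proof (intro conjI ballI)
  show C: "span_proj D u S \<in> carrier_mat D D" by (rule span_proj_carrier)
  let ?P = "span_proj D u S"
  have u: "u s \<in> carrier_vec D" if "s \<in> S" for s using that assms by (auto simp: orthonormal_on_def)
  fix v w :: "complex vec" assume v: "v \<in> carrier_vec D" and w: "w \<in> carrier_vec D"
  have cv: "?P *\<^sub>v v \<in> carrier_vec D" and cw: "?P *\<^sub>v w \<in> carrier_vec D" using C v w by auto
  have fix_u': "u s \<bullet>c (?P *\<^sub>v x) = u s \<bullet>c x" if "s \<in> S" "x \<in> carrier_vec D" for s x
    using span_proj_cprod_basis[OF assms that] C u[OF that(1)] that(2)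
    by (metis cprod_cnj mult_mat_vec_carrier)
  have e1: "(?P *\<^sub>v v) \<bullet>c w = (\<Sum>s\<in>S. (v \<bullet>c u s) * (u s \<bullet>c w))"
    by (rule span_proj_cprod[OF assms v w])
  have e2: "(?P *\<^sub>v v) \<bullet>c (?P *\<^sub>v w) = (\<Sum>s\<in>S. (v \<bullet>c u s) * (u s \<bullet>c w))"
    unfolding span_proj_cprod[OF assms v cw] using fix_u' w by simp
  have "v \<bullet>c (?P *\<^sub>v w) = cnj ((?P *\<^sub>v w) \<bullet>c v)" using cprod_cnj[OF cw v] by simp
  also have "\<dots> = (\<Sum>s\<in>S. (v \<bullet>c u s) * (u s \<bullet>c w))"
    unfolding span_proj_cprod[OF assms w v] cnj_sum complex_cnj_mult
    by (intro sum.cong refl) (simp add: cprod_cnj[OF w u] cprod_cnj[OF u v] mult.commute)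
  finally show "v \<bullet>c (?P *\<^sub>v w) = (?P *\<^sub>v v) \<bullet>c (?P *\<^sub>v w)" using e2 by simp
  show "(?P *\<^sub>v v) \<bullet>c w = (?P *\<^sub>v v) \<bullet>c (?P *\<^sub>v w)" using e1 e2 by simp
qed

lemma nrm2_span_proj:
  assumes "finite S" "orthonormal_on D u S" "v \<in> carrier_vec D"
  shows "nrm2 (span_proj D u S *\<^sub>v v) = (\<Sum>s\<in>S. (cmod (v \<bullet>c u s))\<^sup>2)"
proof -
  have "(v \<bullet>c u s) * (u s \<bullet>c v) = complex_of_real ((cmod (v \<bullet>c u s))\<^sup>2)" if "s \<in> S" for s
  proof -
    have "u s \<in> carrier_vec D" using that assms(2) by (auto simp: orthonormal_on_def)
    then have "u s \<bullet>c v = cnj (v \<bullet>c u s)" using assms(3) by (simp add: cprod_cnj[of _ D])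
    then show ?thesis by (simp only: complex_norm_square)
  qed
  then show ?thesis
    unfolding nrm2_projection[OF span_proj_projection[OF assms(1,2)] assms(3)]
      span_proj_cprod[OF assms assms(3)] by simp
qed

lemma bessel:
  assumes "finite S" "orthonormal_on D u S" "v \<in> carrier_vec D"
  shows "(\<Sum>s\<in>S. (cmod (v \<bullet>c u s))\<^sup>2) \<le> nrm2 v"
  using nrm2_span_proj[OF assms] nrm2_projection_le[OF span_proj_projection[OF assms(1,2)] assms(3)] by simp

section \<open>Tensor powers and sequential measurements\<close>

lemma sum_div_mod:
  "(\<Sum>i<a * b. f (i div b) (i mod b)) = (\<Sum>i<a. \<Sum>j<b. f i j)" for a b :: nat
proof -
  have "(\<Sum>i<a. \<Sum>j<b. f i j) = (\<Sum>(i, j)\<in>{..<a} \<times> {..<b}. f i j)"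
    by (simp add: sum.cartesian_product)
  also have "\<dots> = (\<Sum>i<a * b. f (i div b) (i mod b))"
  proof (rule sum.reindex_bij_witness[where i = "\<lambda>i. (i div b, i mod b)" and j = "\<lambda>(i, j). i * b + j"])
    fix x assume x: "x \<in> {..<a} \<times> {..<b}"
    then obtain i j where ij: "x = (i, j)" "i < a" "j < b" by auto
    have "i * b + j < (i + 1) * b" using ij by simp
    also have "\<dots> \<le> a * b" using ij by (intro mult_right_mono) auto
    finally show "(case x of (i, j) \<Rightarrow> i * b + j) \<in> {..<a * b}" using ij by simp
  next
    fix i assume i: "i \<in> {..<a * b}"
    then have "b > 0" by (cases b) auto
    then show "(i div b, i mod b) \<in> {..<a} \<times> {..<b}"
      using i by (auto simp: less_mult_imp_div_less)
  qed auto
  finally show ?thesis by simp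
qed

section \<open>Product vectors and product bases\<close>

lemma tensor_vec_carrier:
  "u \<in> carrier_vec a \<Longrightarrow> v \<in> carrier_vec b \<Longrightarrow> tensor_vec u v \<in> carrier_vec (a * b)"
  by (auto simp: tensor_vec_def)

lemma tensor_vec_cprod:
  assumes "u \<in> carrier_vec a" "u' \<in> carrier_vec a" "v \<in> carrier_vec b" "v' \<in> carrier_vec b"
  shows "tensor_vec u v \<bullet>c tensor_vec u' v' = (u \<bullet>c u') * (v \<bullet>c v')"
proof -
  have "tensor_vec u v \<bullet>c tensor_vec u' v'
      = (\<Sum>i<a * b. (u $ (i div b) * cnj (u' $ (i div b))) * (v $ (i mod b) * cnj (v' $ (i mod b))))"
    using assms by (simp add: cprod_sum[OF tensor_vec_carrier tensor_vec_carrier]) (simp add: tensor_vec_def mult_ac)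
  also have "\<dots> = (\<Sum>i<a. \<Sum>j<b. (u $ i * cnj (u' $ i)) * (v $ j * cnj (v' $ j)))"
    by (rule sum_div_mod)
  finally show ?thesis using assms by (simp add: cprod_sum[of _ a] cprod_sum[of _ b] sum_product)
qed

lemma tensor_vec_list_Nil: "tensor_vec_list [] = vec 1 (\<lambda>_. 1)"
  by (simp add: tensor_vec_list_def)

lemma tensor_vec_list_Cons: "tensor_vec_list (v # vs) = tensor_vec v (tensor_vec_list vs)"
  by (simp add: tensor_vec_list_def)

lemma tensor_vec_list_carrier:
  "(\<And>v. v \<in> set vs \<Longrightarrow> v \<in> carrier_vec d) \<Longrightarrow> tensor_vec_list vs \<in> carrier_vec (d ^ length vs)"
  by (induction vs) (auto simp: tensor_vec_list_Nil tensor_vec_list_Cons intro!: tensor_vec_carrier)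

lemma tensor_vec_list_cprod:
  assumes "length us = length vs" "\<And>v. v \<in> set us \<union> set vs \<Longrightarrow> v \<in> carrier_vec d"
  shows "tensor_vec_list us \<bullet>c tensor_vec_list vs = prod_list (map2 (\<lambda>u v. u \<bullet>c v) us vs)"
  using assms
proof (induction us vs rule: list_induct2)
  case Nil
  then show ?case by (simp add: tensor_vec_list_Nil scalar_prod_def)
next
  case (Cons u us v vs)
  have "tensor_vec_list us \<in> carrier_vec (d ^ length us)" "tensor_vec_list vs \<in> carrier_vec (d ^ length us)"
    using Cons tensor_vec_list_carrier[of us d] tensor_vec_list_carrier[of vs d] by auto
  then show ?case using Cons by (simp add: tensor_vec_list_Cons tensor_vec_cprod[of u d])
qed

text \<open>Inner products of product vectors factor over the positions. The basis may change from
  position to position, as it does for the eigenbases along a codeword.\<close>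

lemma orthonormal_on_tensor:
  assumes "\<And>x. x \<in> set xs \<Longrightarrow> orthonormal_on d (e x) S"
  shows "orthonormal_on (d ^ length xs) (\<lambda>ss. tensor_vec_list (map2 e xs ss)) (seqs (length xs) S)"
proof -
  have car: "v \<in> carrier_vec d" if "ss \<in> seqs (length xs) S" "v \<in> set (map2 e xs ss)" for v ss
    using that assms by (fastforce simp: seqs_def orthonormal_on_def dest: set_zip_leftD set_zip_rightD)
  have delta: "prod_list (map2 (\<lambda>u v. u \<bullet>c v) (map2 e xs ss) (map2 e xs tt)) = (if ss = tt then 1 else 0)"
    if "ss \<in> seqs (length xs) S" "tt \<in> seqs (length xs) S" for ss tt
    using assms that
  proof (induction xs arbitrary: ss tt)
    case (Cons x xs)
    then obtain s ss' t tt' where "ss = s # ss'" "tt = t # tt'" by (auto simp: seqs_def length_Suc_conv)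
    with Cons show ?case by (auto simp: seqs_def orthonormal_on_def)
  qed (simp add: seqs_def)
  show ?thesis
    unfolding orthonormal_on_def
  proof (intro conjI ballI)
    fix ss assume ss: "ss \<in> seqs (length xs) S"
    then have len: "length (map2 e xs ss) = length xs" by (simp add: seqs_def)
    then show "tensor_vec_list (map2 e xs ss) \<in> carrier_vec (d ^ length xs)"
      using tensor_vec_list_carrier[of "map2 e xs ss" d] car[OF ss] by metis
    fix tt assume tt: "tt \<in> seqs (length xs) S"
    have "tensor_vec_list (map2 e xs ss) \<bullet>c tensor_vec_list (map2 e xs tt)
        = prod_list (map2 (\<lambda>u v. u \<bullet>c v) (map2 e xs ss) (map2 e xs tt))"
      using car[OF ss] car[OF tt] ss tt by (intro tensor_vec_list_cprod[of _ _ d]) (auto simp: seqs_def)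
    then show "tensor_vec_list (map2 e xs ss) \<bullet>c tensor_vec_list (map2 e xs tt) = (if ss = tt then 1 else 0)"
      using delta[OF ss tt] by simp
  qed
qed

lemma orthonormal_on_tensor_power:
  assumes "orthonormal_on d f S"
  shows "orthonormal_on (d ^ n) (\<lambda>ts. tensor_vec_list (map f ts)) (seqs n S)"
proof -
  have eq: "map2 (\<lambda>_. f) (replicate n ()) ts = map f ts" if "ts \<in> seqs n S" for ts
    using that by (intro nth_equalityI) (auto simp: seqs_def)
  show ?thesis
    using orthonormal_on_tensor[of "replicate n ()" d "\<lambda>_. f" S] assms
    by (simp add: orthonormal_on_def eq)
qed

lemma sum_seqs_prod2:
  fixes G :: "'t \<Rightarrow> 't \<Rightarrow> 'z \<Rightarrow> complex"
  assumes "finite Z" "length ts = n" "length ts' = n"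
  shows "(\<Sum>zs\<in>seqs n Z. \<Prod>(z, t, t')\<leftarrow>zip zs (zip ts ts'). G t t' z)
    = (\<Prod>(t, t')\<leftarrow>zip ts ts'. \<Sum>z\<in>Z. G t t' z)"
  using assms(2,3)
proof (induction n arbitrary: ts ts')
  case (Suc n)
  then obtain t us t' us' where ts: "ts = t # us" "ts' = t' # us'" "length us = n" "length us' = n"
    by (auto simp: length_Suc_conv)
  then show ?case
    using Suc.IH[of us us'] by (simp add: sum_seqs_Suc[OF assms(1)] sum_distrib_right flip: sum_distrib_left)
qed (simp add: seqs_0)

text \<open>If the one-letter mixture of the \<open>g z\<close> is diagonal in the
  \<open>f t\<close> with eigenvalues \<open>r t\<close>, then its n-th tensor power is diagonal in
  the product vectors with product eigenvalues. The left-hand side is a matrix entry of that power,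
  and the sum over sequences factors over positions; the tensor power itself is never
  formed.\<close>

lemma tensor_second_moment:
  fixes P :: "'z \<Rightarrow> real"
  assumes Z: "finite Z" "\<And>z. z \<in> Z \<Longrightarrow> g z \<in> carrier_vec d"
    and f: "\<And>t. t \<in> S \<Longrightarrow> f t \<in> carrier_vec d"
    and diag: "\<And>t t'. t \<in> S \<Longrightarrow> t' \<in> S \<Longrightarrow>
      (\<Sum>z\<in>Z. complex_of_real (P z) * (g z \<bullet>c f t) * (f t' \<bullet>c g z)) = (if t = t' then complex_of_real (r t) else 0)"
    and ts: "ts \<in> seqs n S" "ts' \<in> seqs n S"
  shows "(\<Sum>zs\<in>seqs n Z. complex_of_real (prod_list (map P zs))
      * (tensor_vec_list (map g zs) \<bullet>c tensor_vec_list (map f ts))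
      * (tensor_vec_list (map f ts') \<bullet>c tensor_vec_list (map g zs)))
    = (if ts = ts' then complex_of_real (prod_list (map r ts)) else 0)" (is "?L = ?R")
proof -
  let ?G = "\<lambda>t t' z. complex_of_real (P z) * (g z \<bullet>c f t) * (f t' \<bullet>c g z)"
  have "complex_of_real (prod_list (map P zs))
      * (tensor_vec_list (map g zs) \<bullet>c tensor_vec_list (map f ts))
      * (tensor_vec_list (map f ts') \<bullet>c tensor_vec_list (map g zs))
    = (\<Prod>(z, t, t')\<leftarrow>zip zs (zip ts ts'). ?G t t' z)" if zs: "zs \<in> seqs n Z" for zs
  proof -
    have "tensor_vec_list (map g zs) \<bullet>c tensor_vec_list (map f ts)
        = prod_list (map2 (\<lambda>u v. u \<bullet>c v) (map g zs) (map f ts))"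
      using zs ts Z(2) f by (intro tensor_vec_list_cprod[of _ _ d]) (auto simp: seqs_def)
    moreover have "tensor_vec_list (map f ts') \<bullet>c tensor_vec_list (map g zs)
        = prod_list (map2 (\<lambda>u v. u \<bullet>c v) (map f ts') (map g zs))"
      using zs ts Z(2) f by (intro tensor_vec_list_cprod[of _ _ d]) (auto simp: seqs_def)
    moreover have "length zs = length ts" "length ts = length ts'" using zs ts by (auto simp: seqs_def)
    then have "complex_of_real (prod_list (map P zs))
        * prod_list (map2 (\<lambda>u v. u \<bullet>c v) (map g zs) (map f ts))
        * prod_list (map2 (\<lambda>u v. u \<bullet>c v) (map f ts') (map g zs))
      = (\<Prod>(z, t, t')\<leftarrow>zip zs (zip ts ts'). ?G t t' z)"
      by (induction zs ts ts' rule: list_induct3) (auto simp: mult_ac)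
    ultimately show ?thesis by simp
  qed
  then have "?L = (\<Sum>zs\<in>seqs n Z. \<Prod>(z, t, t')\<leftarrow>zip zs (zip ts ts'). ?G t t' z)" by simp
  also have "\<dots> = (\<Prod>(t, t')\<leftarrow>zip ts ts'. \<Sum>z\<in>Z. ?G t t' z)"
    using ts by (intro sum_seqs_prod2 Z) (auto simp: seqs_def)
  also have "\<dots> = ?R"
  proof -
    have "length ts = length ts'" "set ts \<subseteq> S" "set ts' \<subseteq> S" using ts by (auto simp: seqs_def)
    then show ?thesis by (induction ts ts' rule: list_induct2) (auto simp: diag)
  qed
  finally show ?thesis .
qed

section \<open>Product states as mixtures of product eigenvectors\<close>

lemma tensor_mat_list_Cons: "tensor_mat_list (A # As) = tensor_mat A (tensor_mat_list As)"
  by (simp add: tensor_mat_list_def)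

lemma outer_tensor_vec_index:
  assumes "u \<in> carrier_vec a" "v \<in> carrier_vec b" "i < a * b" "j < a * b"
  shows "outer (tensor_vec u v) $$ (i, j) = outer u $$ (i div b, j div b) * outer v $$ (i mod b, j mod b)"
proof -
  have "b > 0" using assms(3) by (cases b) auto
  then have "i div b < a" "j div b < a" "i mod b < b" "j mod b < b"
    using assms by (auto simp: less_mult_imp_div_less)
  then show ?thesis using assms by (simp add: outer_def tensor_vec_def mult_ac)
qed

text \<open>Distributivity of the tensor product over the spectral sums. This reduces density
  matrices to vectors: the output for a word is a mixture of product eigenvectors with product
  weights.\<close>

lemma tensor_mat_list_spectral:
  assumes e: "\<And>x s. x \<in> set xs \<Longrightarrow> s \<in> S \<Longrightarrow> e x s \<in> carrier_vec d" and S: "finite S"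
    and \<rho>: "\<And>x. x \<in> set xs \<Longrightarrow> \<rho> x = sum_matrix d (\<lambda>s. complex_of_real (q x s) \<cdot>\<^sub>m outer (e x s)) S"
  shows "tensor_mat_list (map \<rho> xs) = sum_matrix (d ^ length xs)
    (\<lambda>ss. complex_of_real (prod_list (map2 q xs ss)) \<cdot>\<^sub>m outer (tensor_vec_list (map2 e xs ss))) (seqs (length xs) S)"
  using e \<rho>
proof (induction xs)
  case Nil
  show ?case by (rule eq_matI) (auto simp: tensor_mat_list_def sum_matrix_def seqs_0 outer_def tensor_vec_list_Nil)
next
  case (Cons x xs)
  let ?N = "d ^ length xs"
  let ?F = "\<lambda>xs ss. complex_of_real (prod_list (map2 q xs ss)) \<cdot>\<^sub>m outer (tensor_vec_list (map2 e xs ss))"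
  have IH: "tensor_mat_list (map \<rho> xs) = sum_matrix ?N (?F xs) (seqs (length xs) S)"
    using Cons by simp
  have \<rho>x: "\<rho> x = sum_matrix d (\<lambda>s. complex_of_real (q x s) \<cdot>\<^sub>m outer (e x s)) S" using Cons by simp
  show ?case
  proof (rule eq_matI)
    fix i j
    assume "i < dim_row (sum_matrix (d ^ length (x # xs)) (?F (x # xs)) (seqs (length (x # xs)) S))"
      and "j < dim_col (sum_matrix (d ^ length (x # xs)) (?F (x # xs)) (seqs (length (x # xs)) S))"
    then have ij: "i < d * ?N" "j < d * ?N" by (auto simp: sum_matrix_def)
    then have "?N > 0" by (cases "?N") auto
    then have ij': "i div ?N < d" "j div ?N < d" "i mod ?N < ?N" "j mod ?N < ?N"
      using ij by (auto simp: less_mult_imp_div_less)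
    have "tensor_mat_list (map \<rho> (x # xs)) $$ (i, j)
        = \<rho> x $$ (i div ?N, j div ?N) * tensor_mat_list (map \<rho> xs) $$ (i mod ?N, j mod ?N)"
      using ij by (simp add: tensor_mat_list_Cons tensor_mat_def IH \<rho>x) (simp add: sum_matrix_def)
    also have "\<dots> = (\<Sum>s\<in>S. (complex_of_real (q x s) \<cdot>\<^sub>m outer (e x s)) $$ (i div ?N, j div ?N))
        * (\<Sum>ss\<in>seqs (length xs) S. ?F xs ss $$ (i mod ?N, j mod ?N))"
      unfolding IH \<rho>x using ij' by (simp add: sum_matrix_def)
    also have "\<dots> = (\<Sum>s\<in>S. \<Sum>ss\<in>seqs (length xs) S.
        (complex_of_real (q x s) \<cdot>\<^sub>m outer (e x s)) $$ (i div ?N, j div ?N) * ?F xs ss $$ (i mod ?N, j mod ?N))"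
      by (rule sum_product)
    also have "\<dots> = (\<Sum>s\<in>S. \<Sum>ss\<in>seqs (length xs) S. ?F (x # xs) (s # ss) $$ (i, j))"
    proof (intro sum.cong refl)
      fix s ss assume s: "s \<in> S" and ss: "ss \<in> seqs (length xs) S"
      have u: "e x s \<in> carrier_vec d" using Cons s by simp
      have len: "length (map2 e xs ss) = length xs" using ss by (simp add: seqs_def)
      have "w \<in> carrier_vec d" if "w \<in> set (map2 e xs ss)" for w
        using that Cons.prems(1) ss by (fastforce simp: seqs_def dest: set_zip_leftD set_zip_rightD)
      then have v: "tensor_vec_list (map2 e xs ss) \<in> carrier_vec ?N"
        using tensor_vec_list_carrier[of "map2 e xs ss" d] len by metis
      have d: "dim_row (outer w) = dim_vec w" "dim_col (outer w) = dim_vec w" for w by (auto simp: outer_def)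
      show "(complex_of_real (q x s) \<cdot>\<^sub>m outer (e x s)) $$ (i div ?N, j div ?N) * ?F xs ss $$ (i mod ?N, j mod ?N)
          = ?F (x # xs) (s # ss) $$ (i, j)"
        using u v ij ij' tensor_vec_carrier[OF u v]
        by (simp add: tensor_vec_list_Cons outer_tensor_vec_index[OF u v] d)
    qed
    also have "\<dots> = (\<Sum>ss\<in>seqs (length (x # xs)) S. ?F (x # xs) ss $$ (i, j))"
      by (simp add: sum_seqs_Suc[OF S])
    also have "\<dots> = sum_matrix (d ^ length (x # xs)) (?F (x # xs)) (seqs (length (x # xs)) S) $$ (i, j)"
      using ij by (simp add: sum_matrix_def)
    finally show "tensor_mat_list (map \<rho> (x # xs)) $$ (i, j)
      = sum_matrix (d ^ length (x # xs)) (?F (x # xs)) (seqs (length (x # xs)) S) $$ (i, j)" .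
  qed (simp_all add: tensor_mat_list_Cons tensor_mat_def IH \<rho>x, simp_all add: sum_matrix_def)
qed

section \<open>Measurement probabilities as squared norms\<close>

lemma mat_adjoint_index:
  "i < dim_col A \<Longrightarrow> j < dim_row A \<Longrightarrow> mat_adjoint A $$ (i, j) = cnj (A $$ (j, i))" for A :: "complex mat"
  by (simp add: mat_adjoint_def mat_of_rows_def)

lemma mat_adjoint_dim: "dim_row (mat_adjoint A) = dim_col A" "dim_col (mat_adjoint A) = dim_row A"
  by (simp_all add: mat_adjoint_def)

lemma mat_adjoint_mult:
  fixes A B :: "complex mat"
  assumes "A \<in> carrier_mat D D" "B \<in> carrier_mat D D"
  shows "mat_adjoint (A * B) = mat_adjoint B * mat_adjoint A"
proof (rule eq_matI)
  fix i j assume "i < dim_row (mat_adjoint B * mat_adjoint A)" "j < dim_col (mat_adjoint B * mat_adjoint A)"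
  then have ij: "i < D" "j < D" using assms by (auto simp: mat_adjoint_dim)
  then show "mat_adjoint (A * B) $$ (i, j) = (mat_adjoint B * mat_adjoint A) $$ (i, j)"
    using assms by (auto simp: mat_adjoint_index mat_adjoint_dim scalar_prod_def mult.commute intro!: sum.cong)
qed (use assms in \<open>auto simp: mat_adjoint_dim\<close>)

text \<open>For one vector, the trace of L u u^* L^* is the squared norm of L u; the mixture follows
  by linearity.\<close>

lemma mtrace_conj_spectral:
  assumes L: "L \<in> carrier_mat D D" and S: "finite S" "\<And>s. s \<in> S \<Longrightarrow> u s \<in> carrier_vec D"
  shows "Re (mtrace (L * sum_matrix D (\<lambda>s. complex_of_real (c s) \<cdot>\<^sub>m outer (u s)) S * mat_adjoint L))
    = (\<Sum>s\<in>S. c s * nrm2 (L *\<^sub>v u s))"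
proof -
  let ?\<sigma> = "sum_matrix D (\<lambda>s. complex_of_real (c s) \<cdot>\<^sub>m outer (u s)) S"
  have \<sigma>: "?\<sigma> \<in> carrier_mat D D" by (simp add: sum_matrix_def)
  have Lu: "(L *\<^sub>v u s) $ i = (\<Sum>l<D. L $$ (i, l) * u s $ l)" if "s \<in> S" "i < D" for s i
    using that L S(2)[of s] by (auto simp: scalar_prod_def atLeast0LessThan)
  have entry: "(L * ?\<sigma>) $$ (i, j) = (\<Sum>s\<in>S. complex_of_real (c s) * (L *\<^sub>v u s) $ i * cnj (u s $ j))"
    if ij: "i < D" "j < D" for i j
  proof -
    have "(L * ?\<sigma>) $$ (i, j) = (\<Sum>l<D. L $$ (i, l) * (\<Sum>s\<in>S. complex_of_real (c s) * (u s $ l * cnj (u s $ j))))"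
      using ij L S(2)
      by (auto simp: sum_matrix_def scalar_prod_def atLeast0LessThan smult_outer_index[of _ D] intro!: sum.cong)
    also have "\<dots> = (\<Sum>s\<in>S. \<Sum>l<D. L $$ (i, l) * (complex_of_real (c s) * (u s $ l * cnj (u s $ j))))"
      by (subst sum.swap) (simp add: sum_distrib_left)
    also have "\<dots> = (\<Sum>s\<in>S. complex_of_real (c s) * (L *\<^sub>v u s) $ i * cnj (u s $ j))"
      using ij by (intro sum.cong refl) (simp add: Lu sum_distrib_left sum_distrib_right mult_ac)
    finally show ?thesis .
  qed
  have "mtrace (L * ?\<sigma> * mat_adjoint L) = (\<Sum>i<D. \<Sum>j<D. (L * ?\<sigma>) $$ (i, j) * cnj (L $$ (i, j)))"
    using L \<sigma> by (auto simp: mtrace_def mat_adjoint_dim mat_adjoint_index scalar_prod_def atLeast0LessThan intro!: sum.cong)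
  also have "\<dots> = (\<Sum>i<D. \<Sum>s\<in>S. complex_of_real (c s) * ((L *\<^sub>v u s) $ i * cnj ((L *\<^sub>v u s) $ i)))"
  proof (rule sum.cong)
    fix i assume i: "i \<in> {..<D}"
    have "(\<Sum>j<D. (L * ?\<sigma>) $$ (i, j) * cnj (L $$ (i, j)))
        = (\<Sum>s\<in>S. \<Sum>j<D. complex_of_real (c s) * (L *\<^sub>v u s) $ i * cnj (u s $ j) * cnj (L $$ (i, j)))"
      using i by (subst sum.swap) (simp add: entry sum_distrib_right)
    also have "\<dots> = (\<Sum>s\<in>S. complex_of_real (c s) * ((L *\<^sub>v u s) $ i * cnj ((L *\<^sub>v u s) $ i)))"
    proof (rule sum.cong)
      fix s assume "s \<in> S"
      then have "cnj ((L *\<^sub>v u s) $ i) = (\<Sum>j<D. cnj (u s $ j) * cnj (L $$ (i, j)))"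
        using i by (simp add: Lu mult.commute)
      then show "(\<Sum>j<D. complex_of_real (c s) * (L *\<^sub>v u s) $ i * cnj (u s $ j) * cnj (L $$ (i, j)))
        = complex_of_real (c s) * ((L *\<^sub>v u s) $ i * cnj ((L *\<^sub>v u s) $ i))"
        by (simp only: sum_distrib_left mult.assoc)
    qed simp
    finally show "(\<Sum>j<D. (L * ?\<sigma>) $$ (i, j) * cnj (L $$ (i, j)))
      = (\<Sum>s\<in>S. complex_of_real (c s) * ((L *\<^sub>v u s) $ i * cnj ((L *\<^sub>v u s) $ i)))" .
  qed simp
  also have "\<dots> = (\<Sum>s\<in>S. complex_of_real (c s) * ((L *\<^sub>v u s) \<bullet>c (L *\<^sub>v u s)))"
    using L S by (subst sum.swap) (auto simp: cprod_sum[of _ D] sum_distrib_left intro!: sum.cong)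
  finally show ?thesis by (simp add: cprod_self)
qed

text \<open>New factors of \<open>fail_op\<close> are multiplied from the left, so the earliest test
  acts on the vector first, in agreement with \<open>seq_apply\<close>. The induction runs over an
  arbitrary starting matrix K, as the accumulator of the fold requires.\<close>

lemma fail_op_apply:
  assumes "\<forall>P\<in>set Ps. projection D P" "v \<in> carrier_vec D"
  shows "fail_op D Ps j \<in> carrier_mat D D"
    and "fail_op D Ps j *\<^sub>v v = seq_apply (map (\<lambda>P. 1\<^sub>m D - P) (take j Ps)) v"
proof -
  have "foldl (\<lambda>K P. (1\<^sub>m D - P) * K) K Qs \<in> carrier_mat D D \<and>
      foldl (\<lambda>K P. (1\<^sub>m D - P) * K) K Qs *\<^sub>v v = seq_apply (map (\<lambda>P. 1\<^sub>m D - P) Qs) (K *\<^sub>v v)"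
    if "\<forall>P\<in>set Qs. projection D P" "K \<in> carrier_mat D D" for Qs K
    using that
  proof (induction Qs arbitrary: K)
    case (Cons Q Qs)
    have Q: "1\<^sub>m D - Q \<in> carrier_mat D D" using Cons.prems projection_carrier by (auto intro: minus_carrier_mat)
    then have "(1\<^sub>m D - Q) * K \<in> carrier_mat D D" using Cons.prems by auto
    moreover have "((1\<^sub>m D - Q) * K) *\<^sub>v v = (1\<^sub>m D - Q) *\<^sub>v (K *\<^sub>v v)"
      using Q Cons.prems assms(2) by (intro assoc_mult_mat_vec) auto
    ultimately show ?case using Cons.IH[of "(1\<^sub>m D - Q) * K"] Cons.prems by simp
  qed simp
  from this[of "take j Ps" "1\<^sub>m D"] assms
  show "fail_op D Ps j \<in> carrier_mat D D"
    and "fail_op D Ps j *\<^sub>v v = seq_apply (map (\<lambda>P. 1\<^sub>m D - P) (take j Ps)) v"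
    by (auto simp: fail_op_def dest: in_set_takeD)
qed

text \<open>Messages are counted from 0: output m means that the m tests before it failed and its
  own test succeeded, which is the list of projections on the right.\<close>

lemma seq_output_prob_spectral:
  assumes Ps: "\<forall>P\<in>set Ps. projection D P" "m < length Ps"
    and S: "finite S" "\<And>s. s \<in> S \<Longrightarrow> u s \<in> carrier_vec D"
  shows "seq_output_prob D Ps (sum_matrix D (\<lambda>s. complex_of_real (c s) \<cdot>\<^sub>m outer (u s)) S) m
    = (\<Sum>s\<in>S. c s * nrm2 (seq_apply (map (\<lambda>P. 1\<^sub>m D - P) (take m Ps) @ [Ps ! m]) (u s)))"
proof -
  let ?\<sigma> = "sum_matrix D (\<lambda>s. complex_of_real (c s) \<cdot>\<^sub>m outer (u s)) S" and ?K = "fail_op D Ps m" and ?P = "Ps ! m"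
  have P: "?P \<in> carrier_mat D D" using Ps by (auto intro: projection_carrier)
  have K: "?K \<in> carrier_mat D D" using fail_op_apply(1)[OF Ps(1), of "0\<^sub>v D" m] by simp
  have \<sigma>: "?\<sigma> \<in> carrier_mat D D" by (simp add: sum_matrix_def)
  have adj: "mat_adjoint A \<in> carrier_mat D D" if "A \<in> carrier_mat D D" for A :: "complex mat"
    using that by (auto intro!: carrier_matI simp: mat_adjoint_dim)
  have "?P * ?K * ?\<sigma> * mat_adjoint ?K * mat_adjoint ?P = (?P * ?K) * ?\<sigma> * mat_adjoint (?P * ?K)"
    unfolding mat_adjoint_mult[OF P K] using P K \<sigma> adj[OF P] adj[OF K]
    by (intro assoc_mult_mat[of _ D D _ D _ D]) auto
  then have "seq_output_prob D Ps ?\<sigma> m = (\<Sum>s\<in>S. c s * nrm2 ((?P * ?K) *\<^sub>v u s))"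
    unfolding seq_output_prob_def using mtrace_conj_spectral[of "?P * ?K" D S u c] P K S by simp
  also have "\<dots> = (\<Sum>s\<in>S. c s * nrm2 (seq_apply (map (\<lambda>P. 1\<^sub>m D - P) (take m Ps) @ [?P]) (u s)))"
    using P K S(2) fail_op_apply(2)[OF Ps(1) S(2)]
    by (intro sum.cong refl) (simp add: seq_apply_append assoc_mult_mat_vec[of _ D D _ D])
  finally show ?thesis .
qed

section \<open>Hermitian eigenbases and entropy\<close>

lemma ket_carrier: "ket D i \<in> carrier_vec D"
  by (simp add: ket_def)

lemma cprod_ket:
  assumes "i < D" "u \<in> carrier_vec D"
  shows "u \<bullet>c ket D i = u $ i" "ket D i \<bullet>c u = cnj (u $ i)"
proof -
  have eq: "ket D i $ j = (if j = i then 1 else 0)" if "j < D" for j using that by (simp add: ket_def)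
  have "u \<bullet>c ket D i = (\<Sum>j<D. if j = i then u $ j else 0)"
    unfolding cprod_sum[OF assms(2) ket_carrier] by (intro sum.cong) (auto simp: eq)
  then show "u \<bullet>c ket D i = u $ i" using assms by simp
  then show "ket D i \<bullet>c u = cnj (u $ i)" using cprod_cnj[OF assms(2) ket_carrier[of D i]] by simp
qed

lemma orthonormal_on_ket: "orthonormal_on D (ket D) {0..<D}"
  by (auto simp: orthonormal_on_def ket_carrier cprod_ket) (auto simp: ket_def)

text \<open>The left-hand side is the trace of the complementary projector, computed in the standard
  basis. This identity serves as the dimension argument: fewer than D orthonormal vectors leave a
  nonzero complement, and D of them leave none.\<close>

lemma sum_nrm2_ket_compl:
  assumes "finite S" "orthonormal_on D u S"
  shows "(\<Sum>i<D. nrm2 (ket D i - span_proj D u S *\<^sub>v ket D i)) = real D - real (card S)"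
proof -
  have "(\<Sum>i<D. nrm2 (ket D i - span_proj D u S *\<^sub>v ket D i))
      = (\<Sum>i<D. 1 - (\<Sum>s\<in>S. (cmod (u s $ i))\<^sup>2))"
  proof (rule sum.cong)
    fix i assume i: "i \<in> {..<D}"
    have "nrm2 (ket D i) = 1"
      using i by (simp add: nrm2_def cprod_ket ket_carrier) (simp add: ket_def)
    moreover have "(\<Sum>s\<in>S. (cmod (ket D i \<bullet>c u s))\<^sup>2) = (\<Sum>s\<in>S. (cmod (u s $ i))\<^sup>2)"
      using i assms(2) by (intro sum.cong) (auto simp: cprod_ket orthonormal_on_def)
    ultimately show "nrm2 (ket D i - span_proj D u S *\<^sub>v ket D i) = 1 - (\<Sum>s\<in>S. (cmod (u s $ i))\<^sup>2)"
      using nrm2_compl[OF span_proj_projection[OF assms] ket_carrier]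
        nrm2_span_proj[OF assms ket_carrier] by simp
  qed simp
  also have "\<dots> = real D - (\<Sum>s\<in>S. \<Sum>i<D. (cmod (u s $ i))\<^sup>2)"
    by (simp add: sum_subtractf sum.swap[of _ S])
  also have "(\<Sum>s\<in>S. \<Sum>i<D. (cmod (u s $ i))\<^sup>2) = (\<Sum>s\<in>S. 1)"
  proof (rule sum.cong)
    fix s assume "s \<in> S"
    then have "u s \<in> carrier_vec D" "u s \<bullet>c u s = 1" using assms(2) by (auto simp: orthonormal_on_def)
    then show "(\<Sum>i<D. (cmod (u s $ i))\<^sup>2) = 1" by (simp add: nrm2_sum[symmetric] nrm2_def)
  qed simp
  finally show ?thesis by simp
qed

lemma nrm2_eq_0_iff: "v \<in> carrier_vec D \<Longrightarrow> nrm2 v = 0 \<longleftrightarrow> v = 0\<^sub>v D"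
  by (auto simp: nrm2_sum[of _ D] sum_nonneg_eq_0_iff)

lemma exists_orthogonal_vec:
  assumes "finite S" "orthonormal_on D u S" "card S < D"
  shows "\<exists>v\<in>carrier_vec D. v \<noteq> 0\<^sub>v D \<and> (\<forall>s\<in>S. v \<bullet>c u s = 0)"
proof -
  let ?w = "\<lambda>i. ket D i - span_proj D u S *\<^sub>v ket D i"
  have c: "span_proj D u S *\<^sub>v ket D i \<in> carrier_vec D" for i
    by (rule projection_vec_carrier[OF span_proj_projection[OF assms(1,2)] ket_carrier])
  have "\<exists>i<D. nrm2 (?w i) \<noteq> 0"
  proof (rule ccontr)
    assume "\<not> ?thesis"
    then have "(\<Sum>i<D. nrm2 (?w i)) = 0" by simp
    then show False using sum_nrm2_ket_compl[OF assms(1,2)] assms(3) by simp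
  qed
  then obtain i where i: "nrm2 (?w i) \<noteq> 0" by blast
  have "?w i \<in> carrier_vec D" using c ket_carrier by auto
  moreover have "?w i \<noteq> 0\<^sub>v D" using i nrm2_eq_0_iff[OF \<open>?w i \<in> carrier_vec D\<close>] by blast
  moreover have "?w i \<bullet>c u s = 0" if s: "s \<in> S" for s
  proof -
    have "u s \<in> carrier_vec D" using s assms(2) by (auto simp: orthonormal_on_def)
    then show ?thesis
      using span_proj_cprod_basis[OF assms(1,2) s ket_carrier]
      by (simp add: cprod_minus_left[OF ket_carrier c])
  qed
  ultimately show ?thesis by blast
qed

text \<open>The complementary projector has trace 0, so every standard basis vector is fixed by the
  projector. Self-adjointness moves the projector onto these vectors, so every v is fixed as
  well.\<close>

lemma parseval:
  assumes "finite S" "orthonormal_on D u S" "card S = D" "v \<in> carrier_vec D"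
  shows "(\<Sum>s\<in>S. (cmod (v \<bullet>c u s))\<^sup>2) = nrm2 v"
proof -
  let ?P = "span_proj D u S"
  note P = span_proj_projection[OF assms(1,2)]
  have "(\<Sum>i<D. nrm2 (ket D i - ?P *\<^sub>v ket D i)) = 0"
    using sum_nrm2_ket_compl[OF assms(1,2)] assms(3) by simp
  then have z: "nrm2 (ket D i - ?P *\<^sub>v ket D i) = 0" if "i < D" for i
    using that by (subst (asm) sum_nonneg_eq_0_iff) (auto simp: nrm2_nonneg)
  have fixp: "?P *\<^sub>v ket D i = ket D i" if i: "i < D" for i
  proof -
    have c: "?P *\<^sub>v ket D i \<in> carrier_vec D" by (rule projection_vec_carrier[OF P ket_carrier])
    then have "ket D i - ?P *\<^sub>v ket D i = 0\<^sub>v D"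
      using z[OF i] nrm2_eq_0_iff[of "ket D i - ?P *\<^sub>v ket D i" D] ket_carrier by auto
    then have "ket D i $ j - (?P *\<^sub>v ket D i) $ j = 0" if "j < D" for j
      using that c ket_carrier[of D i] by (metis carrier_vecD index_minus_vec(1) index_zero_vec(1))
    then show ?thesis using c ket_carrier[of D i] span_proj_carrier[of D u S] by (intro eq_vecI) auto
  qed
  have "?P *\<^sub>v v = v"
  proof (rule eq_vecI)
    fix i assume "i < dim_vec v"
    then have i: "i < D" using assms(4) by simp
    have c: "?P *\<^sub>v v \<in> carrier_vec D" by (rule projection_vec_carrier[OF P assms(4)])
    have "(?P *\<^sub>v v) $ i = (?P *\<^sub>v v) \<bullet>c (?P *\<^sub>v ket D i)"
      by (simp add: cprod_ket[OF i c] fixp[OF i])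
    also have "\<dots> = v \<bullet>c (?P *\<^sub>v ket D i)"
      using projectionD(2)[OF P assms(4) ket_carrier] by simp
    also have "\<dots> = v $ i" by (simp add: fixp[OF i] cprod_ket[OF i assms(4)])
    finally show "(?P *\<^sub>v v) $ i = v $ i" .
  qed (use assms(4) span_proj_carrier[of D u S] in auto)
  then show ?thesis using nrm2_span_proj[OF assms(1,2,4)] by simp
qed

text \<open>
  In Schur coordinates, subtracting the diagonal entry \<open>B $$ (j, j)\<close> kills the last nonzero coordinate
  of a vector; the vector just before the iteration reaches \<open>0\<close> is an eigenvector that never left \<open>W\<close>.
\<close>
lemma invariant_eigenvector:
  fixes A :: "complex mat"
  assumes A: "A \<in> carrier_mat D D" and W: "W \<subseteq> carrier_vec D"
    and inv: "\<And>v l. v \<in> W \<Longrightarrow> A *\<^sub>v v - l \<cdot>\<^sub>v v \<in> W"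
    and v: "v \<in> W" "v \<noteq> 0\<^sub>v D"
  shows "\<exists>w\<in>W. \<exists>l. w \<noteq> 0\<^sub>v D \<and> A *\<^sub>v w = l \<cdot>\<^sub>v w"
proof -
  obtain es where "char_poly A = (\<Prod>a\<leftarrow>es. [:- a, 1:])" using char_poly_factorized[OF A] by blast
  from schur_decomposition_exists[OF A this] obtain B where B: "B \<in> carrier_mat D D"
    and ut: "upper_triangular B" and "similar_mat A B" by blast
  then obtain P Q where PQ: "P \<in> carrier_mat D D" "Q \<in> carrier_mat D D" "P * Q = 1\<^sub>m D" "Q * P = 1\<^sub>m D"
    and AB: "A = P * B * Q"
    using A unfolding similar_mat_def similar_mat_wit_def Let_def by auto
  have AP: "A *\<^sub>v (P *\<^sub>v x) = P *\<^sub>v (B *\<^sub>v x)" if x: "x \<in> carrier_vec D" for x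
  proof -
    have "A *\<^sub>v (P *\<^sub>v x) = (A * P) *\<^sub>v x" using A PQ x by simp
    also have "A * P = P * B * (Q * P)"
      unfolding AB using PQ B by (intro assoc_mult_mat[of _ D D _ D _ D]) auto
    also have "\<dots> = P * B" unfolding PQ(4) using PQ B by (intro right_mult_one_mat[of _ D]) auto
    finally show ?thesis using PQ B x by simp
  qed
  have QP: "Q *\<^sub>v (P *\<^sub>v x) = x" if "x \<in> carrier_vec D" for x
    using that PQ assoc_mult_mat_vec[of Q D D P D x] by simp
  have P0: "P *\<^sub>v x \<noteq> 0\<^sub>v D" if x: "x \<in> carrier_vec D" "x \<noteq> 0\<^sub>v D" for x
  proof
    assume "P *\<^sub>v x = 0\<^sub>v D"
    then have "x = Q *\<^sub>v 0\<^sub>v D" using QP[OF x(1)] by simp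
    also have "\<dots> = 0\<^sub>v D" using PQ(2) by (intro eq_vecI) (auto simp: scalar_prod_def)
    finally show False using x(2) by simp
  qed
  have "\<exists>w\<in>W. \<exists>l. w \<noteq> 0\<^sub>v D \<and> A *\<^sub>v w = l \<cdot>\<^sub>v w"
    if "j \<le> D" "x \<in> carrier_vec D" "x \<noteq> 0\<^sub>v D" "P *\<^sub>v x \<in> W" "\<And>i. j \<le> i \<Longrightarrow> i < D \<Longrightarrow> x $ i = 0" for j x
    using that
  proof (induction j arbitrary: x)
    case 0
    then have "x = 0\<^sub>v D" by (intro eq_vecI) auto
    with 0 show ?case by simp
  next
    case (Suc j)
    define l where "l = B $$ (j, j)"
    define y where "y = B *\<^sub>v x - l \<cdot>\<^sub>v x"
    have y: "y \<in> carrier_vec D" using B Suc.prems by (simp add: y_def)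
    have Py: "P *\<^sub>v y = A *\<^sub>v (P *\<^sub>v x) - l \<cdot>\<^sub>v (P *\<^sub>v x)"
      using PQ B Suc.prems
      by (simp add: y_def AP mult_minus_distrib_mat_vec[of P D D] mult_mat_vec[of P D D])
    show ?case
    proof (cases "y = 0\<^sub>v D")
      case True
      have "P *\<^sub>v (0\<^sub>v D) = 0\<^sub>v D" using PQ(1) by (intro eq_vecI) (auto simp: scalar_prod_def)
      then have z: "A *\<^sub>v (P *\<^sub>v x) - l \<cdot>\<^sub>v (P *\<^sub>v x) = 0\<^sub>v D" using Py True by simp
      have c: "A *\<^sub>v (P *\<^sub>v x) \<in> carrier_vec D" "l \<cdot>\<^sub>v (P *\<^sub>v x) \<in> carrier_vec D"
        using A PQ Suc.prems by auto
      have "A *\<^sub>v (P *\<^sub>v x) = l \<cdot>\<^sub>v (P *\<^sub>v x)"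
      proof (rule eq_vecI)
        fix i assume "i < dim_vec (l \<cdot>\<^sub>v (P *\<^sub>v x))"
        then have i: "i < D" using c PQ(1) by simp
        have "(A *\<^sub>v (P *\<^sub>v x) - l \<cdot>\<^sub>v (P *\<^sub>v x)) $ i = 0" using z i by simp
        then show "(A *\<^sub>v (P *\<^sub>v x)) $ i = (l \<cdot>\<^sub>v (P *\<^sub>v x)) $ i"
          using i c by (metis carrier_vecD index_minus_vec(1) right_minus_eq)
      qed (use A PQ(1) in auto)
      then show ?thesis using Suc.prems P0 by blast
    next
      case False
      have "y $ i = 0" if i: "j \<le> i" "i < D" for i
      proof -
        have "(B *\<^sub>v x) $ i = (\<Sum>m<D. B $$ (i, m) * x $ m)"
          using i B Suc.prems by (auto simp: scalar_prod_def atLeast0LessThan)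
        \<comment> \<open>Triangularity removes the columns before i and the support of x those
          after j. For i = j the remaining diagonal entry is l by choice; for i > j both sides
          vanish.\<close>
        also have "\<dots> = (\<Sum>m<D. if m = i then l * x $ m else 0)"
        proof (rule sum.cong)
          fix m assume m: "m \<in> {..<D}"
          have "m < i \<Longrightarrow> B $$ (i, m) = 0" using ut i B unfolding upper_triangular_def by auto
          moreover have "j < m \<Longrightarrow> x $ m = 0" using Suc.prems m by simp
          ultimately show "B $$ (i, m) * x $ m = (if m = i then l * x $ m else 0)"
            using i by (cases "m < i"; cases "m = i"; cases "i = j") (auto simp: l_def)
        qed simp
        finally show ?thesis using i B Suc.prems by (simp add: y_def)
      qed
      moreover have "P *\<^sub>v y \<in> W" unfolding Py using Suc.prems inv by blast
      ultimately show ?thesis using Suc.IH[of y] Suc.prems(1) y False by simp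
    qed
  qed
  \<comment> \<open>The descent starts at j = D, where the vanishing condition on the coordinates is
    empty.\<close>
  from this[of D "Q *\<^sub>v v"]
  have "Q *\<^sub>v v \<noteq> 0\<^sub>v D \<Longrightarrow> P *\<^sub>v (Q *\<^sub>v v) = v \<Longrightarrow> ?thesis"
    using PQ v W by auto
  moreover have PQv: "P *\<^sub>v (Q *\<^sub>v v) = v"
    using assoc_mult_mat_vec[of P D D Q D v] PQ v W by auto
  moreover have "Q *\<^sub>v v \<noteq> 0\<^sub>v D"
  proof
    assume "Q *\<^sub>v v = 0\<^sub>v D"
    then have "v = P *\<^sub>v 0\<^sub>v D" using PQv by simp
    also have "\<dots> = 0\<^sub>v D" using PQ(1) by (intro eq_vecI) (auto simp: scalar_prod_def)
    finally show False using v by simp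
  qed
  ultimately show ?thesis by blast
qed

section \<open>Spectral theorem and entropy from an eigenbasis\<close>

lemma cprod_smult:
  fixes u v :: "complex vec"
  assumes "u \<in> carrier_vec D" "v \<in> carrier_vec D"
  shows "(c \<cdot>\<^sub>v u) \<bullet>c v = c * (u \<bullet>c v)" "u \<bullet>c (c \<cdot>\<^sub>v v) = cnj c * (u \<bullet>c v)"
  using assms by (auto simp: cprod_sum[of _ D] sum_distrib_left mult_ac)

text \<open>Eigenvectors are added one at a time. By self-adjointness the orthogonal complement W of
  those found so far is invariant under A - l for every l, so W contains another eigenvector;
  self-adjointness also makes its eigenvalue real, and it is normalised before being added.\<close>

theorem hermitian_eigenbasis:
  fixes A :: "complex mat"
  assumes A: "A \<in> carrier_mat D D"
    and herm: "\<And>v w. v \<in> carrier_vec D \<Longrightarrow> w \<in> carrier_vec D \<Longrightarrow> (A *\<^sub>v v) \<bullet>c w = v \<bullet>c (A *\<^sub>v w)"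
  shows "\<exists>f r. orthonormal_on D f {0..<D} \<and> (\<forall>t<D. A *\<^sub>v f t = complex_of_real (r t) \<cdot>\<^sub>v f t)"
proof -
  have "\<exists>f r. orthonormal_on D f {0..<m} \<and> (\<forall>t<m. A *\<^sub>v f t = complex_of_real (r t) \<cdot>\<^sub>v f t)"
    if "m \<le> D" for m
    using that
  proof (induction m)
    case 0
    then show ?case by (auto simp: orthonormal_on_def)
  next
    case (Suc m)
    then obtain f and r :: "nat \<Rightarrow> real" where on: "orthonormal_on D f {0..<m}"
      and eig: "\<And>t. t < m \<Longrightarrow> A *\<^sub>v f t = complex_of_real (r t) \<cdot>\<^sub>v f t" by auto
    have f: "f t \<in> carrier_vec D" if "t < m" for t using on that by (auto simp: orthonormal_on_def)
    define W where "W = {v \<in> carrier_vec D. \<forall>t<m. v \<bullet>c f t = 0}"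
    have "\<exists>v\<in>carrier_vec D. v \<noteq> 0\<^sub>v D \<and> (\<forall>s\<in>{0..<m}. v \<bullet>c f s = 0)"
      using Suc.prems by (intro exists_orthogonal_vec[OF _ on]) auto
    then obtain v where v: "v \<in> W" "v \<noteq> 0\<^sub>v D" by (fastforce simp: W_def)
    have inv: "A *\<^sub>v w - l \<cdot>\<^sub>v w \<in> W" if w: "w \<in> W" for w l
    proof -
      have wc: "w \<in> carrier_vec D" using w by (simp add: W_def)
      then have Aw: "A *\<^sub>v w \<in> carrier_vec D" "l \<cdot>\<^sub>v w \<in> carrier_vec D" using A by auto
      have "(A *\<^sub>v w - l \<cdot>\<^sub>v w) \<bullet>c f t = 0" if t: "t < m" for t
      proof -
        have "w \<bullet>c f t = 0" using w t by (simp add: W_def)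
        then show ?thesis
          using herm[OF wc f[OF t]] eig[OF t]
          by (simp add: cprod_minus_left[OF Aw f[OF t]] cprod_smult[OF wc f[OF t]])
      qed
      then show ?thesis using Aw by (simp add: W_def)
    qed
    obtain w l where w: "w \<in> W" "w \<noteq> 0\<^sub>v D" and Aw: "A *\<^sub>v w = l \<cdot>\<^sub>v w"
      using invariant_eigenvector[OF A _ inv v] by (auto simp: W_def)
    have wc: "w \<in> carrier_vec D" using w by (simp add: W_def)
    have pos: "nrm2 w > 0" using nrm2_nonneg[of w] nrm2_eq_0_iff[OF wc] w by simp
    have "l * (w \<bullet>c w) = cnj l * (w \<bullet>c w)"
      using herm[OF wc wc] by (simp add: Aw cprod_smult[OF wc wc])
    then have "l = cnj l" using pos by (simp add: cprod_self)
    then have l: "l = complex_of_real (Re l)" by (simp add: complex_eq_iff)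
    define c where "c = complex_of_real (1 / sqrt (nrm2 w))"
    define g where "g = c \<cdot>\<^sub>v w"
    have gc: "g \<in> carrier_vec D" using wc by (simp add: g_def)
    have "g \<bullet>c g = c * (cnj c * complex_of_real (nrm2 w))"
      unfolding cprod_self[symmetric] using wc by (simp add: g_def cprod_smult[of _ D])
    also have "\<dots> = complex_of_real (1 / sqrt (nrm2 w) * (1 / sqrt (nrm2 w)) * nrm2 w)"
      by (simp only: c_def complex_cnj_complex_of_real of_real_mult mult.assoc)
    also have "1 / sqrt (nrm2 w) * (1 / sqrt (nrm2 w)) * nrm2 w = 1" using pos by (simp add: field_simps)
    finally have g1: "g \<bullet>c g = 1" by simp
    have g0: "g \<bullet>c f t = 0" "f t \<bullet>c g = 0" if t: "t < m" for t
    proof -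
      show "g \<bullet>c f t = 0" using w t by (simp add: g_def cprod_smult[OF wc f[OF t]] W_def)
      then show "f t \<bullet>c g = 0" using cprod_cnj[OF gc f[OF t]] by simp
    qed
    have gA: "A *\<^sub>v g = complex_of_real (Re l) \<cdot>\<^sub>v g"
      unfolding g_def using A wc by (simp add: mult_mat_vec[of A D D] Aw smult_smult_assoc mult.commute flip: l)
    have "orthonormal_on D (f(m := g)) {0..<Suc m}"
      using on gc g1 g0 by (auto simp: orthonormal_on_def less_Suc_eq)
    moreover have "\<forall>t<Suc m. A *\<^sub>v (f(m := g)) t = complex_of_real ((r(m := Re l)) t) \<cdot>\<^sub>v (f(m := g)) t"
      using eig gA by (auto simp: less_Suc_eq)
    ultimately show ?case by blast
  qed
  then show ?thesis by blast
qed

text \<open>The entropy is defined by the roots of the characteristic polynomial. The matrix U with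
  columns \<open>f t\<close> and inverse its adjoint V conjugates A to a diagonal matrix, so these
  roots are the \<open>r t\<close> with multiplicity.\<close>

lemma vn_entropy_eigenbasis:
  assumes A: "A \<in> carrier_mat D D" and on: "orthonormal_on D f {0..<D}"
    and eig: "\<And>t. t < D \<Longrightarrow> A *\<^sub>v f t = complex_of_real (r t) \<cdot>\<^sub>v f t"
  shows "vn_entropy A = - (\<Sum>t<D. r t * log 2 (r t))"
proof -
  define U where "U = mat D D (\<lambda>(i, j). f j $ i)"
  define V where "V = mat D D (\<lambda>(i, j). cnj (f i $ j))"
  define B where "B = mat D D (\<lambda>(i, j). if i = j then complex_of_real (r i) else 0)"
  have UV: "U \<in> carrier_mat D D" "V \<in> carrier_mat D D" "B \<in> carrier_mat D D"
    by (auto simp: U_def V_def B_def)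
  have f: "f t \<in> carrier_vec D" if "t < D" for t using on that by (auto simp: orthonormal_on_def)
  have VU: "V * U = 1\<^sub>m D"
  proof (rule eq_matI)
    fix i j assume "i < dim_row (1\<^sub>m D :: complex mat)" "j < dim_col (1\<^sub>m D :: complex mat)"
    then have ij: "i < D" "j < D" by auto
    have "(V * U) $$ (i, j) = (\<Sum>m<D. f j $ m * cnj (f i $ m))"
      using ij by (auto simp: U_def V_def scalar_prod_def atLeast0LessThan mult.commute intro!: sum.cong)
    also have "\<dots> = f j \<bullet>c f i" using cprod_sum[OF f[OF ij(2)] f[OF ij(1)]] by simp
    finally show "(V * U) $$ (i, j) = 1\<^sub>m D $$ (i, j)" using on ij by (auto simp: orthonormal_on_def)
  qed (use UV in auto)
  have UVi: "U * V = 1\<^sub>m D" by (rule mat_mult_left_right_inverse[OF UV(2,1) VU])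
  have AU: "A * U = U * B"
  proof (rule eq_matI)
    fix i j assume "i < dim_row (U * B)" "j < dim_col (U * B)"
    then have ij: "i < D" "j < D" using UV by auto
    have "col U j = f j" using ij carrier_vecD[OF f[OF ij(2)]] by (intro eq_vecI) (auto simp: U_def)
    then have "(A * U) $$ (i, j) = (A *\<^sub>v f j) $ i" using ij A UV by simp
    also have "\<dots> = complex_of_real (r j) * f j $ i" using ij eig carrier_vecD[OF f[OF ij(2)]] by simp
    also have "\<dots> = (\<Sum>m<D. if m = j then f m $ i * complex_of_real (r m) else 0)"
      using ij by (simp add: mult.commute)
    also have "\<dots> = (\<Sum>m<D. f m $ i * (if m = j then complex_of_real (r m) else 0))"
      by (intro sum.cong) auto
    also have "\<dots> = (U * B) $$ (i, j)"
      using ij by (auto simp: U_def B_def scalar_prod_def atLeast0LessThan intro!: sum.cong)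
    finally show "(A * U) $$ (i, j) = (U * B) $$ (i, j)" .
  qed (use UV A in auto)
  have "A = A * (U * V)" using A UVi by simp
  also have "\<dots> = U * B * V" using A UV AU by (simp flip: assoc_mult_mat)
  finally have "similar_mat A B"
    using A UV UVi VU by (intro similar_matI[of A B U V D]) auto
  then have "char_poly A = char_poly B" by (rule char_poly_similar)
  also have "\<dots> = (\<Prod>a\<leftarrow>diag_mat B. [:- a, 1:])"
    using UV by (intro char_poly_upper_triangular) (auto simp: upper_triangular_def B_def)
  also have "diag_mat B = map (\<lambda>t. complex_of_real (r t)) [0..<D]"
    by (auto simp: diag_mat_def B_def)
  finally have cp: "char_poly A = (\<Prod>a\<leftarrow>map (\<lambda>t. complex_of_real (r t)) [0..<D]. [:- a, 1:])" .
  have "proots (\<Prod>a\<leftarrow>as. [:- a, 1:]) = mset as" for as :: "complex list"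
  proof (induction as)
    case (Cons a as)
    have "(\<Prod>a\<leftarrow>as. [:- a, 1:]) \<noteq> (0 :: complex poly)" by (auto simp: prod_list_zero_iff)
    then have "proots ([:- a, 1:] * (\<Prod>a\<leftarrow>as. [:- a, 1:])) = proots [:- a, 1:] + proots (\<Prod>a\<leftarrow>as. [:- a, 1:])"
      by (intro proots_mult) auto
    then show ?case using Cons by simp
  qed simp
  then have "proots (char_poly A) = mset (map (\<lambda>t. complex_of_real (r t)) [0..<D])" by (simp only: cp)
  then have "vn_entropy A = - (\<Sum>t\<leftarrow>[0..<D]. r t * log 2 (r t))"
    by (simp add: vn_entropy_def comp_def multiset.map_comp flip: mset_map sum_mset_sum_list)
  then show ?thesis by (simp add: sum_list_distinct_conv_sum_set atLeast0LessThan)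
qed

lemma sum_matrix_outer_eigen:
  assumes "finite S" "orthonormal_on D u S" "s \<in> S"
  shows "sum_matrix D (\<lambda>s. complex_of_real (c s) \<cdot>\<^sub>m outer (u s)) S *\<^sub>v u s = complex_of_real (c s) \<cdot>\<^sub>v u s"
    (is "?A *\<^sub>v _ = _")
proof (rule eq_vecI)
  have u: "u t \<in> carrier_vec D" if "t \<in> S" for t using that assms(2) by (auto simp: orthonormal_on_def)
  have A: "?A \<in> carrier_mat D D" by (simp add: sum_matrix_def)
  then show "dim_vec (?A *\<^sub>v u s) = dim_vec (complex_of_real (c s) \<cdot>\<^sub>v u s)"
    using carrier_vecD[OF u[OF assms(3)]] by simp
  fix i assume "i < dim_vec (complex_of_real (c s) \<cdot>\<^sub>v u s)"
  then have i: "i < D" using carrier_vecD[OF u[OF assms(3)]] by simp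
  have "(?A *\<^sub>v u s) $ i = (?A *\<^sub>v u s) \<bullet>c ket D i"
    using i A u[OF assms(3)] by (intro cprod_ket(1)[symmetric]) auto
  also have "\<dots> = (\<Sum>t\<in>S. complex_of_real (c t) * (u s \<bullet>c u t) * (u t \<bullet>c ket D i))"
    by (rule sum_matrix_outer_cprod[OF assms(1) u u[OF assms(3)] ket_carrier])
  also have "\<dots> = (\<Sum>t\<in>S. if t = s then complex_of_real (c s) * u s $ i else 0)"
    using assms(2,3) i u by (intro sum.cong) (auto simp: orthonormal_on_def cprod_ket)
  finally show "(?A *\<^sub>v u s) $ i = (complex_of_real (c s) \<cdot>\<^sub>v u s) $ i"
    using assms(1,3) i carrier_vecD[OF u[OF assms(3)]] by simp
qed

lemma sum_matrix_outer_hermitian: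
  fixes c :: "'a \<Rightarrow> real"
  assumes "finite S" and u: "\<And>s. s \<in> S \<Longrightarrow> u s \<in> carrier_vec D"
    and v: "v \<in> carrier_vec D" and w: "w \<in> carrier_vec D"
  shows "(sum_matrix D (\<lambda>s. complex_of_real (c s) \<cdot>\<^sub>m outer (u s)) S *\<^sub>v v) \<bullet>c w
    = v \<bullet>c (sum_matrix D (\<lambda>s. complex_of_real (c s) \<cdot>\<^sub>m outer (u s)) S *\<^sub>v w)" (is "(?A *\<^sub>v v) \<bullet>c w = _")
proof -
  have "?A \<in> carrier_mat D D" by (simp add: sum_matrix_def)
  then have Aw: "?A *\<^sub>v w \<in> carrier_vec D" using w by (rule mult_mat_vec_carrier)
  have "v \<bullet>c (?A *\<^sub>v w) = cnj ((?A *\<^sub>v w) \<bullet>c v)" by (rule cprod_cnj[OF Aw v, symmetric])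
  also have "\<dots> = (\<Sum>s\<in>S. complex_of_real (c s) * cnj (w \<bullet>c u s) * cnj (u s \<bullet>c v))"
    by (simp only: sum_matrix_outer_cprod[OF assms(1) u w v] cnj_sum complex_cnj_mult complex_cnj_complex_of_real)
  also have "\<dots> = (\<Sum>s\<in>S. complex_of_real (c s) * (v \<bullet>c u s) * (u s \<bullet>c w))"
    by (intro sum.cong refl) (simp only: cprod_cnj[OF w u] cprod_cnj[OF u v] mult_ac)
  also have "\<dots> = (?A *\<^sub>v v) \<bullet>c w" by (rule sum_matrix_outer_cprod[OF assms(1) u v w, symmetric])
  finally show ?thesis by (rule sym)
qed

text \<open>Positivity and unit trace of the output states appear here as the statement that each
  \<open>q x\<close> is a probability distribution, the form in which they are used.\<close>

locale cq_channel =
  fixes k d :: nat and p :: "nat \<Rightarrow> real" and \<rho> :: "nat \<Rightarrow> complex mat"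
    and e :: "nat \<Rightarrow> nat \<Rightarrow> complex vec" and q :: "nat \<Rightarrow> nat \<Rightarrow> real"
  assumes d_pos: "0 < d"
    and p_nonneg: "x < k \<Longrightarrow> 0 \<le> p x" and p_sum: "(\<Sum>x<k. p x) = 1"
    and e_on: "x < k \<Longrightarrow> orthonormal_on d (e x) {0..<d}"
    and rho: "x < k \<Longrightarrow> \<rho> x = sum_matrix d (\<lambda>s. complex_of_real (q x s) \<cdot>\<^sub>m outer (e x s)) {0..<d}"
    and q_nonneg: "x < k \<Longrightarrow> s < d \<Longrightarrow> 0 \<le> q x s"
    and q_sum: "x < k \<Longrightarrow> (\<Sum>s<d. q x s) = 1"
begin

definition pairs :: "(nat \<times> nat) set" where
  "pairs = {0..<k} \<times> {0..<d}"

text \<open>The law of the enlarged classical letter: drawing z from \<open>joint\<close> and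
  emitting the pure state \<open>eigvec z\<close> reproduces one use of the channel on a random
  input.\<close>

definition joint :: "nat \<times> nat \<Rightarrow> real" where
  "joint z = p (fst z) * q (fst z) (snd z)"

definition eigvec :: "nat \<times> nat \<Rightarrow> complex vec" where
  "eigvec z = e (fst z) (snd z)"

definition avg_state :: "complex mat" where
  "avg_state = sum_matrix d (\<lambda>z. complex_of_real (joint z) \<cdot>\<^sub>m outer (eigvec z)) pairs"

text \<open>H(B|X), the p-average of the entropies of the states \<rho> x, written through their
  eigenvalues.\<close>

definition cond_entropy :: real where
  "cond_entropy = - (\<Sum>x<k. \<Sum>s<d. p x * q x s * log 2 (q x s))"

lemma e_carrier: "x < k \<Longrightarrow> s < d \<Longrightarrow> e x s \<in> carrier_vec d"
  using e_on by (auto simp: orthonormal_on_def)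

lemma eigvec_carrier: "z \<in> pairs \<Longrightarrow> eigvec z \<in> carrier_vec d"
  by (auto simp: pairs_def eigvec_def e_carrier)

lemma finite_pairs: "finite pairs"
  by (simp add: pairs_def)

lemma joint_nonneg: "z \<in> pairs \<Longrightarrow> 0 \<le> joint z"
  by (auto simp: pairs_def joint_def p_nonneg q_nonneg)

lemma sum_pairs: "(\<Sum>z\<in>pairs. F z) = (\<Sum>x<k. \<Sum>s<d. F (x, s))"
  by (simp add: pairs_def sum.cartesian_product atLeast0LessThan)

lemma joint_sum: "sum joint pairs = 1"
  by (simp add: sum_pairs joint_def q_sum p_sum flip: sum_distrib_left)

lemma q_le_1: "x < k \<Longrightarrow> s < d \<Longrightarrow> q x s \<le> 1"
  using member_le_sum[of s "{..<d}" "q x"] q_nonneg q_sum by auto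

lemma cond_entropy_nonneg: "0 \<le> cond_entropy"
proof -
  have "p x * q x s * log 2 (q x s) \<le> 0" if "x < k" "s < d" for x s
  proof (cases "q x s = 0")
    case False
    then have "0 < q x s" using q_nonneg[OF that] by simp
    then have "log 2 (q x s) \<le> 0" using q_le_1[OF that] by simp
    then show ?thesis using p_nonneg[OF that(1)] q_nonneg[OF that] by (simp add: mult_nonneg_nonpos)
  qed simp
  then have "(\<Sum>x<k. \<Sum>s<d. p x * q x s * log 2 (q x s)) \<le> 0" by (intro sum_nonpos) auto
  then show ?thesis by (simp add: cond_entropy_def)
qed

lemma rho_carrier: "x < k \<Longrightarrow> \<rho> x \<in> carrier_mat d d"
  by (simp add: rho sum_matrix_def)

lemma rho_eigen: "x < k \<Longrightarrow> s < d \<Longrightarrow> \<rho> x *\<^sub>v e x s = complex_of_real (q x s) \<cdot>\<^sub>v e x s"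
  using sum_matrix_outer_eigen[OF _ e_on, of x s] by (simp add: rho)

lemma rho_trace: "x < k \<Longrightarrow> (\<Sum>b<d. \<rho> x $$ (b, b)) = 1"
proof -
  assume x: "x < k"
  have "(\<Sum>b<d. \<rho> x $$ (b, b)) = (\<Sum>b<d. \<Sum>s<d. complex_of_real (q x s) * (e x s $ b * cnj (e x s $ b)))"
    using x e_carrier[OF x] by (simp add: rho sum_matrix_def atLeast0LessThan smult_outer_index[of _ d])
  also have "\<dots> = (\<Sum>s<d. complex_of_real (q x s) * (e x s \<bullet>c e x s))"
    using e_carrier[OF x] by (subst sum.swap) (auto simp: cprod_sum[of _ d] sum_distrib_left intro!: sum.cong)
  also have "\<dots> = (\<Sum>s<d. complex_of_real (q x s))"
    using e_on[OF x] by (intro sum.cong) (auto simp: orthonormal_on_def)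
  also have "\<dots> = 1" using q_sum[OF x] by (simp flip: of_real_sum)
  finally show ?thesis .
qed

section \<open>Entropies of the classical-quantum state\<close>

lemma cq_state_carrier: "cq_state k d p \<rho> \<in> carrier_mat (k * d) (k * d)"
  by (simp add: cq_state_def sum_matrix_def)

lemma cq_state_index:
  assumes "i < k * d" "j < k * d"
  shows "cq_state k d p \<rho> $$ (i, j)
    = (if i div d = j div d then complex_of_real (p (i div d)) * \<rho> (i div d) $$ (i mod d, j mod d) else 0)"
proof -
  have ij: "i div d < k" "j div d < k" using assms by (auto simp: less_mult_imp_div_less)
  have rd: "dim_row (\<rho> x) = d \<and> dim_col (\<rho> x) = d" if "x < k" for x using rho_carrier[OF that] by auto
  have od: "dim_row (outer (ket k x)) = k" "dim_col (outer (ket k x)) = k" for x by (simp_all add: outer_def ket_def)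
  have "cq_state k d p \<rho> $$ (i, j) = (\<Sum>x<k. complex_of_real (p x) *
      (outer (ket k x) $$ (i div d, j div d) * \<rho> x $$ (i mod d, j mod d)))"
    unfolding cq_state_def sum_matrix_def
    using assms rd by (auto simp: tensor_mat_def atLeast0LessThan od intro!: sum.cong)
  also have "\<dots> = (\<Sum>x<k. if x = i div d then
      (if i div d = j div d then complex_of_real (p x) * \<rho> x $$ (i mod d, j mod d) else 0) else 0)"
    using ij by (intro sum.cong) (auto simp: outer_def ket_def)
  finally show ?thesis using ij by simp
qed

lemma block_index: "a < k \<Longrightarrow> b < d \<Longrightarrow> a * d + b < k * d"
proof -
  assume "a < k" "b < d"
  then have "a * d + b < (a + 1) * d" by simp
  also have "\<dots> \<le> k * d" using \<open>a < k\<close> by (intro mult_right_mono) auto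
  finally show ?thesis .
qed

lemma ptrace_A_cq_state: "ptrace_A k d (cq_state k d p \<rho>) = avg_state"
proof (rule eq_matI)
  fix b b' assume "b < dim_row avg_state" "b' < dim_col avg_state"
  then have b: "b < d" "b' < d" by (auto simp: avg_state_def sum_matrix_def)
  have "ptrace_A k d (cq_state k d p \<rho>) $$ (b, b') = (\<Sum>a<k. complex_of_real (p a) * \<rho> a $$ (b, b'))"
    using b by (auto simp: ptrace_A_def cq_state_index block_index intro!: sum.cong)
  also have "\<dots> = (\<Sum>a<k. \<Sum>s<d. complex_of_real (joint (a, s)) * (e a s $ b * cnj (e a s $ b')))"
    using b e_carrier
    by (intro sum.cong) (auto simp: rho sum_matrix_def smult_outer_index[of _ d] atLeast0LessThan
        sum_distrib_left joint_def mult.assoc intro!: sum.cong)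
  also have "\<dots> = avg_state $$ (b, b')"
    using b e_carrier
    by (auto simp: avg_state_def sum_matrix_def sum_pairs eigvec_def smult_outer_index[of _ d] intro!: sum.cong)
  finally show "ptrace_A k d (cq_state k d p \<rho>) $$ (b, b') = avg_state $$ (b, b')" .
qed (simp_all add: ptrace_A_def avg_state_def sum_matrix_def)

lemma ptrace_B_entropy: "vn_entropy (ptrace_B k d (cq_state k d p \<rho>)) = - (\<Sum>x<k. p x * log 2 (p x))"
proof (rule vn_entropy_eigenbasis[OF _ orthonormal_on_ket])
  show "ptrace_B k d (cq_state k d p \<rho>) \<in> carrier_mat k k" by (simp add: ptrace_B_def)
  have entry: "ptrace_B k d (cq_state k d p \<rho>) $$ (a, a') = (if a = a' then complex_of_real (p a) else 0)"
    if "a < k" "a' < k" for a a'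
  proof -
    have "ptrace_B k d (cq_state k d p \<rho>) $$ (a, a')
        = (\<Sum>b<d. if a = a' then complex_of_real (p a) * \<rho> a $$ (b, b) else 0)"
      using that by (auto simp: ptrace_B_def cq_state_index block_index intro!: sum.cong)
    then show ?thesis using rho_trace[OF that(1)] by (auto simp flip: sum_distrib_left)
  qed
  fix t assume t: "t < k"
  show "ptrace_B k d (cq_state k d p \<rho>) *\<^sub>v ket k t = complex_of_real (p t) \<cdot>\<^sub>v ket k t" (is "?A *\<^sub>v _ = _")
  proof (rule eq_vecI)
    fix i assume "i < dim_vec (complex_of_real (p t) \<cdot>\<^sub>v ket k t)"
    then have i: "i < k" by (simp add: ket_def)
    have "(?A *\<^sub>v ket k t) $ i = (\<Sum>j<k. ?A $$ (i, j) * ket k t $ j)"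
      using i by (auto simp: scalar_prod_def atLeast0LessThan ptrace_B_def ket_def)
    also have "\<dots> = (\<Sum>j<k. if j = t then (if i = t then complex_of_real (p t) else 0) else 0)"
      using i by (intro sum.cong) (auto simp: entry ket_def)
    finally show "(?A *\<^sub>v ket k t) $ i = (complex_of_real (p t) \<cdot>\<^sub>v ket k t) $ i"
      using i t by (simp add: ket_def)
  qed (simp add: ptrace_B_def ket_def)
qed

text \<open>The vectors |x> tensor \<open>e x s\<close> form an eigenbasis with eigenvalues
  \<open>p x * q x s\<close>; index t stands for the pair x = t div d, s = t mod d.\<close>

lemma cq_state_entropy: "vn_entropy (cq_state k d p \<rho>) = - (\<Sum>x<k. \<Sum>s<d. p x * q x s * log 2 (p x * q x s))"
proof -
  let ?F = "\<lambda>t. tensor_vec (ket k (t div d)) (e (t div d) (t mod d))"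
  let ?r = "\<lambda>t. p (t div d) * q (t div d) (t mod d)"
  have dm: "t div d < k" "t mod d < d" if "t < k * d" for t
    using that d_pos by (auto simp: less_mult_imp_div_less)
  have on: "orthonormal_on (k * d) ?F {0..<k * d}"
    unfolding orthonormal_on_def
  proof (intro conjI ballI)
    fix t assume "t \<in> {0..<k * d}"
    then have t: "t div d < k" "t mod d < d" using dm by auto
    show "?F t \<in> carrier_vec (k * d)" using t by (intro tensor_vec_carrier ket_carrier e_carrier)
    fix t' assume "t' \<in> {0..<k * d}"
    then have t': "t' div d < k" "t' mod d < d" using dm by auto
    have "?F t \<bullet>c ?F t' = (ket k (t div d) \<bullet>c ket k (t' div d)) * (e (t div d) (t mod d) \<bullet>c e (t' div d) (t' mod d))"
      using t t' by (intro tensor_vec_cprod[of _ k _ _ d] ket_carrier e_carrier)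
    also have "ket k (t div d) \<bullet>c ket k (t' div d) = (if t div d = t' div d then 1 else 0)"
      using orthonormal_on_ket[of k] t t' by (auto simp: orthonormal_on_def)
    also have "\<dots> * (e (t div d) (t mod d) \<bullet>c e (t' div d) (t' mod d))
        = (if t div d = t' div d \<and> t mod d = t' mod d then 1 else 0)"
      using e_on[OF t(1)] t t' by (auto simp: orthonormal_on_def)
    also have "t div d = t' div d \<and> t mod d = t' mod d \<longleftrightarrow> t = t'" by (metis div_mult_mod_eq)
    finally show "?F t \<bullet>c ?F t' = (if t = t' then 1 else 0)" .
  qed
  have eig: "cq_state k d p \<rho> *\<^sub>v ?F t = complex_of_real (?r t) \<cdot>\<^sub>v ?F t" if tk: "t < k * d" for t
  proof (rule eq_vecI)
    note t = dm[OF tk]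
    define x where "x = t div d"
    define s where "s = t mod d"
    have xs: "x < k" "s < d" using t by (auto simp: x_def s_def)
    note es = carrier_vecD[OF e_carrier[OF xs]]
    have dimF: "dim_vec (?F t) = k * d"
      using carrier_vecD[OF e_carrier[OF t]] by (simp add: tensor_vec_def ket_def)
    have Fi: "?F t $ j = (if j div d = x then e x s $ (j mod d) else 0)" if "j < k * d" for j
      using that es dm[OF that] by (simp add: tensor_vec_def ket_def x_def s_def)
    show "dim_vec (cq_state k d p \<rho> *\<^sub>v ?F t) = dim_vec (complex_of_real (?r t) \<cdot>\<^sub>v ?F t)"
      using dimF cq_state_carrier by simp
    fix i assume "i < dim_vec (complex_of_real (?r t) \<cdot>\<^sub>v ?F t)"
    then have i: "i < k * d" using dimF by simp
    note id = dm[OF i]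
    let ?h = "\<lambda>a b. (if i div d = a \<and> a = x then complex_of_real (p x) * \<rho> x $$ (i mod d, b) * e x s $ b else 0)"
    have "(cq_state k d p \<rho> *\<^sub>v ?F t) $ i = (\<Sum>j<k * d. cq_state k d p \<rho> $$ (i, j) * ?F t $ j)"
      using i dimF cq_state_carrier by (auto simp: scalar_prod_def atLeast0LessThan)
    also have "\<dots> = (\<Sum>j<k * d. ?h (j div d) (j mod d))"
      using i by (intro sum.cong) (auto simp: cq_state_index Fi)
    also have "\<dots> = (\<Sum>a<k. \<Sum>b<d. ?h a b)" by (rule sum_div_mod)
    also have "\<dots> = (\<Sum>a<k. if a = i div d then (if i div d = x then complex_of_real (p x) *
        (\<Sum>b<d. \<rho> x $$ (i mod d, b) * e x s $ b) else 0) else 0)"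
      by (intro sum.cong refl) (auto simp: sum_distrib_left mult.assoc)
    also have "\<dots> = (if i div d = x then complex_of_real (p x) * (\<rho> x *\<^sub>v e x s) $ (i mod d) else 0)"
      using id es rho_carrier[OF xs(1)] by (simp add: scalar_prod_def atLeast0LessThan)
    also have "\<dots> = complex_of_real (?r t) * ?F t $ i"
      using id es i by (simp add: rho_eigen[OF xs] Fi) (simp add: x_def s_def)
    finally show "(cq_state k d p \<rho> *\<^sub>v ?F t) $ i = (complex_of_real (?r t) \<cdot>\<^sub>v ?F t) $ i"
      using i dimF by simp
  qed
  have "vn_entropy (cq_state k d p \<rho>) = - (\<Sum>t<k * d. ?r t * log 2 (?r t))"
    by (rule vn_entropy_eigenbasis[OF cq_state_carrier on eig])
  also have "(\<Sum>t<k * d. ?r t * log 2 (?r t)) = (\<Sum>x<k. \<Sum>s<d. p x * q x s * log 2 (p x * q x s))"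
    by (rule sum_div_mod)
  finally show ?thesis .
qed

text \<open>The chain rule H(XB) = H(X) + H(B|X): the logarithm of the product splits when both
  factors are positive, and all other terms are 0. H(X) then cancels in the mutual
  information.\<close>

lemma mutual_info_cq_state:
  "mutual_info k d (cq_state k d p \<rho>) = vn_entropy avg_state - cond_entropy"
proof -
  have "p x * q x s * log 2 (p x * q x s) = q x s * (p x * log 2 (p x)) + p x * q x s * log 2 (q x s)"
    if "x < k" "s < d" for x s
  proof (cases "p x = 0 \<or> q x s = 0")
    case False
    then have "p x > 0" "q x s > 0" using p_nonneg q_nonneg that by (auto simp: less_le)
    then show ?thesis by (simp add: log_mult algebra_simps)
  qed auto
  then have "(\<Sum>x<k. \<Sum>s<d. p x * q x s * log 2 (p x * q x s))
      = (\<Sum>x<k. (\<Sum>s<d. q x s) * (p x * log 2 (p x))) + (\<Sum>x<k. \<Sum>s<d. p x * q x s * log 2 (q x s))"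
    by (simp add: sum.distrib sum_distrib_right)
  then have "(\<Sum>x<k. \<Sum>s<d. p x * q x s * log 2 (p x * q x s))
      = (\<Sum>x<k. p x * log 2 (p x)) - cond_entropy"
    by (simp add: q_sum cond_entropy_def)
  then show ?thesis
    by (simp add: mutual_info_def ptrace_A_cq_state ptrace_B_entropy cq_state_entropy)
qed

text \<open>The eigenvalues are quadratic forms of a mixture with nonnegative weights, hence
  nonnegative; they sum to 1 by Parseval for each unit vector \<open>eigvec z\<close>. The last
  clause gives the matrix entries of the average state in the form that the tensor-power argument
  takes as input.\<close>

lemma avg_state_eigenbasis:
  obtains f r where "orthonormal_on d f {0..<d}"
    and "\<And>t. t < d \<Longrightarrow> 0 \<le> r t" and "(\<Sum>t<d. r t) = 1"
    and "vn_entropy avg_state = - (\<Sum>t<d. r t * log 2 (r t))"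
    and "\<And>t t'. t < d \<Longrightarrow> t' < d \<Longrightarrow>
      (\<Sum>z\<in>pairs. complex_of_real (joint z) * (eigvec z \<bullet>c f t) * (f t' \<bullet>c eigvec z))
        = (if t = t' then complex_of_real (r t) else 0)"
proof -
  have A: "avg_state \<in> carrier_mat d d" by (simp add: avg_state_def sum_matrix_def)
  have "\<exists>f r. orthonormal_on d f {0..<d} \<and> (\<forall>t<d. avg_state *\<^sub>v f t = complex_of_real (r t) \<cdot>\<^sub>v f t)"
    by (rule hermitian_eigenbasis[OF A], unfold avg_state_def)
      (rule sum_matrix_outer_hermitian[where u = eigvec, OF finite_pairs eigvec_carrier])
  then obtain f and r :: "nat \<Rightarrow> real" where on: "orthonormal_on d f {0..<d}"
    and eig: "\<And>t. t < d \<Longrightarrow> avg_state *\<^sub>v f t = complex_of_real (r t) \<cdot>\<^sub>v f t" by blast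
  have f: "f t \<in> carrier_vec d" if "t < d" for t using on that by (auto simp: orthonormal_on_def)
  have diag: "(\<Sum>z\<in>pairs. complex_of_real (joint z) * (eigvec z \<bullet>c f t) * (f t' \<bullet>c eigvec z))
        = (if t = t' then complex_of_real (r t) else 0)" if t: "t < d" "t' < d" for t t'
  proof -
    have "(\<Sum>z\<in>pairs. complex_of_real (joint z) * (eigvec z \<bullet>c f t) * (f t' \<bullet>c eigvec z))
        = (avg_state *\<^sub>v f t') \<bullet>c f t"
      unfolding avg_state_def
        sum_matrix_outer_cprod[where u = eigvec and c = joint, OF finite_pairs eigvec_carrier f[OF t(2)] f[OF t(1)], simplified]
      by (simp only: mult_ac)
    also have "\<dots> = complex_of_real (r t') * (f t' \<bullet>c f t)"
      using cprod_smult(1)[OF f[OF t(2)] f[OF t(1)]] by (simp add: eig[OF t(2)])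
    finally show ?thesis using on t by (auto simp: orthonormal_on_def)
  qed
  have r_eq: "r t = (\<Sum>z\<in>pairs. joint z * (cmod (eigvec z \<bullet>c f t))\<^sup>2)" if t: "t < d" for t
  proof -
    have "complex_of_real (r t) = (\<Sum>z\<in>pairs. complex_of_real (joint z) * (eigvec z \<bullet>c f t) * (f t \<bullet>c eigvec z))"
      using diag[OF t t] by simp
    also have "\<dots> = (\<Sum>z\<in>pairs. complex_of_real (joint z * (cmod (eigvec z \<bullet>c f t))\<^sup>2))"
    proof (rule sum.cong)
      fix z assume "z \<in> pairs"
      then have "f t \<bullet>c eigvec z = cnj (eigvec z \<bullet>c f t)"
        using cprod_cnj[OF eigvec_carrier f[OF t]] by simp
      then show "complex_of_real (joint z) * (eigvec z \<bullet>c f t) * (f t \<bullet>c eigvec z)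
        = complex_of_real (joint z * (cmod (eigvec z \<bullet>c f t))\<^sup>2)"
        by (simp only: of_real_mult complex_norm_square mult.assoc)
    qed simp
    finally have "complex_of_real (r t) = complex_of_real (\<Sum>z\<in>pairs. joint z * (cmod (eigvec z \<bullet>c f t))\<^sup>2)"
      by (simp only: of_real_sum)
    then show ?thesis by (simp only: of_real_eq_iff)
  qed
  have "(\<Sum>t<d. r t) = (\<Sum>t<d. \<Sum>z\<in>pairs. joint z * (cmod (eigvec z \<bullet>c f t))\<^sup>2)" using r_eq by simp
  also have "\<dots> = (\<Sum>z\<in>pairs. joint z * (\<Sum>t<d. (cmod (eigvec z \<bullet>c f t))\<^sup>2))"
    by (subst sum.swap) (simp add: sum_distrib_left)
  also have "\<dots> = (\<Sum>z\<in>pairs. joint z)"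
  proof (rule sum.cong)
    fix z assume z: "z \<in> pairs"
    have "(\<Sum>t<d. (cmod (eigvec z \<bullet>c f t))\<^sup>2) = nrm2 (eigvec z)"
      unfolding atLeast0LessThan[symmetric] by (rule parseval[OF _ on _ eigvec_carrier[OF z]]) simp_all
    also have "\<dots> = 1" using z e_on[of "fst z"] by (auto simp: pairs_def eigvec_def nrm2_def orthonormal_on_def)
    finally show "joint z * (\<Sum>t<d. (cmod (eigvec z \<bullet>c f t))\<^sup>2) = joint z" by simp
  qed simp
  finally have "(\<Sum>t<d. r t) = 1" using joint_sum by simp
  moreover have "0 \<le> r t" if "t < d" for t
    unfolding r_eq[OF that] by (intro sum_nonneg mult_nonneg_nonneg joint_nonneg) auto
  ultimately show thesis
    by (intro that[of f r] on vn_entropy_eigenbasis[OF A on eig] diag)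
qed

end

section \<open>Random codes with sequential decoding\<close>

text \<open>Let t be the squared distance of v and w = P0 v. Passing from v to w costs c + (1 + 1/c)
  t, as the final squared norm for v is at most 1. The norm defect of w costs t. In the union bound
  for w, the complements of the wrong tests lose the overlaps with those tests, and the correct test
  loses at most twice its loss on v plus 2 t. With the factor 4 the coefficient of t becomes (1 +
  1/c) + 1 + 8.\<close>

lemma sequential_decoding_error:
  assumes Ps: "\<forall>P\<in>set Ps. projection D P" "m < length Ps" and P0: "projection D P0"
    and v: "v \<in> carrier_vec D" "nrm2 v = 1" and c: "0 < c"
  shows "1 - nrm2 (seq_apply (map (\<lambda>P. 1\<^sub>m D - P) (take m Ps) @ [Ps ! m]) v)
    \<le> c + (10 + 1 / c) * nrm2 (v - P0 *\<^sub>v v) + 4 * (\<Sum>i<m. nrm2 (Ps ! i *\<^sub>v (P0 *\<^sub>v v)))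
      + 8 * nrm2 (v - Ps ! m *\<^sub>v v)"
proof -
  let ?Qs = "map (\<lambda>P. 1\<^sub>m D - P) (take m Ps) @ [Ps ! m]"
  define w where "w = P0 *\<^sub>v v"
  define t where "t = nrm2 (v - w)"
  define x where "x = nrm2 (seq_apply ?Qs v)"
  define y where "y = nrm2 (seq_apply ?Qs w)"
  have w: "w \<in> carrier_vec D" unfolding w_def by (rule projection_vec_carrier[OF P0 v(1)])
  have Pm: "projection D (Ps ! m)" using Ps by simp
  have Qs: "\<forall>Q\<in>set ?Qs. projection D Q"
    using Ps by (auto intro: projection_compl dest: in_set_takeD)
  note Av = seq_apply_carrier[OF Qs v(1)] and Aw = seq_apply_carrier[OF Qs w]
  have "nrm2 (seq_apply ?Qs v - seq_apply ?Qs w) \<le> t"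
    unfolding t_def seq_apply_minus[OF Qs v(1) w, symmetric]
    by (rule nrm2_seq_apply_le[OF Qs minus_carrier_vec[OF v(1) w]])
  then have "(1 + 1 / c) * nrm2 (seq_apply ?Qs v - seq_apply ?Qs w) \<le> (1 + 1 / c) * t"
    using c by (intro mult_left_mono) auto
  moreover have "y \<le> (1 + c) * x + (1 + 1 / c) * nrm2 (seq_apply ?Qs v - seq_apply ?Qs w)"
    unfolding x_def y_def by (rule nrm2_le_perturb[OF Aw Av c])
  moreover have "x \<le> 1" using nrm2_seq_apply_le[OF Qs v(1)] v(2) by (simp add: x_def)
  then have "c * x \<le> c" using c by simp
  ultimately have h1: "y \<le> x + c + (1 + 1 / c) * t" by (simp add: distrib_right)
  have h2: "nrm2 w - y \<le> 4 * (\<Sum>Q\<leftarrow>?Qs. nrm2 (w - Q *\<^sub>v w))"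
    unfolding y_def by (rule projection_union_bound[OF Qs w])
  have compl: "w - (1\<^sub>m D - P) *\<^sub>v w = P *\<^sub>v w" if "projection D P" for P
  proof -
    have "P *\<^sub>v w \<in> carrier_vec D" by (rule projection_vec_carrier[OF that w])
    then show ?thesis
      unfolding mult_one_minus_vec[OF projection_carrier[OF that] w]
      using w projection_carrier[OF that] by (intro eq_vecI) auto
  qed
  have "(\<Sum>Q\<leftarrow>map (\<lambda>P. 1\<^sub>m D - P) (take m Ps). nrm2 (w - Q *\<^sub>v w))
      = (\<Sum>P\<leftarrow>take m Ps. nrm2 (P *\<^sub>v w))"
    unfolding map_map comp_def
    using Ps(1) by (intro arg_cong[of _ _ sum_list] map_cong refl) (auto simp: compl dest: in_set_takeD)
  also have "\<dots> = (\<Sum>i<m. nrm2 (Ps ! i *\<^sub>v w))"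
    using Ps(2) by (simp add: sum_list_sum_nth atLeast0LessThan)
  finally have h3: "(\<Sum>Q\<leftarrow>?Qs. nrm2 (w - Q *\<^sub>v w)) = (\<Sum>i<m. nrm2 (Ps ! i *\<^sub>v w)) + nrm2 (w - Ps ! m *\<^sub>v w)"
    by simp
  have h4: "nrm2 (w - Ps ! m *\<^sub>v w) \<le> 2 * nrm2 (v - Ps ! m *\<^sub>v v) + 2 * t"
  proof -
    let ?Q = "1\<^sub>m D - Ps ! m"
    note Q = projection_compl[OF Pm] and PC = projection_carrier[OF Pm]
    have "nrm2 (?Q *\<^sub>v v - ?Q *\<^sub>v w) \<le> t"
      unfolding t_def mult_minus_distrib_mat_vec[OF projection_carrier[OF Q] v(1) w, symmetric]
      by (rule nrm2_projection_le[OF Q minus_carrier_vec[OF v(1) w]])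
    then show ?thesis
      using nrm2_le_perturb[OF projection_vec_carrier[OF Q w] projection_vec_carrier[OF Q v(1)], of 1]
      unfolding mult_one_minus_vec[OF PC v(1)] mult_one_minus_vec[OF PC w] by simp
  qed
  have h5: "nrm2 w = 1 - t" using nrm2_compl[OF P0 v(1)] v(2) by (simp add: w_def t_def)
  have "(10 + 1 / c) * t = 9 * t + (1 + 1 / c) * t" by (simp add: algebra_simps)
  with h1 h2 h4 h5 show ?thesis
    unfolding h3 unfolding x_def[symmetric] w_def[symmetric] t_def[symmetric] by argo
qed

lemma orthonormal_on_subset: "orthonormal_on D u S \<Longrightarrow> T \<subseteq> S \<Longrightarrow> orthonormal_on D u T"
  unfolding orthonormal_on_def by blast

context cq_channel
begin

section \<open>Channel outputs driven by sequences of pairs\<close>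

definition state_vec :: "(nat \<times> nat) list \<Rightarrow> complex vec" where
  "state_vec zs = tensor_vec_list (map eigvec zs)"

lemma state_vec_zip: "state_vec (zip xs ss) = tensor_vec_list (map2 e xs ss)"
proof -
  have "eigvec = (\<lambda>(x, s). e x s)" by (auto simp: eigvec_def)
  then show ?thesis by (simp add: state_vec_def)
qed

lemma word_orthonormal:
  assumes "xs \<in> seqs n {0..<k}"
  shows "orthonormal_on (d ^ n) (\<lambda>ss. tensor_vec_list (map2 e xs ss)) (seqs n {0..<d})"
proof -
  have len: "length xs = n" using assms by (simp add: seqs_def)
  have "orthonormal_on d (e x) {0..<d}" if "x \<in> set xs" for x
    using that assms by (intro e_on) (auto simp: seqs_def)
  from orthonormal_on_tensor[of xs d e "{0..<d}", OF this] show ?thesis unfolding len .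
qed

lemma pair_seqE:
  assumes "zs \<in> seqs n pairs"
  obtains xs ss where "xs \<in> seqs n {0..<k}" "ss \<in> seqs n {0..<d}" "zs = zip xs ss"
proof (rule that)
  show "zs = zip (map fst zs) (map snd zs)" by (simp add: zip_map_fst_snd)
  show "map fst zs \<in> seqs n {0..<k}" "map snd zs \<in> seqs n {0..<d}"
    using assms by (fastforce simp: seqs_def pairs_def)+
qed

lemma state_vec_unit:
  assumes "zs \<in> seqs n pairs"
  shows "state_vec zs \<in> carrier_vec (d ^ n)" "nrm2 (state_vec zs) = 1"
proof -
  obtain xs ss where zs: "xs \<in> seqs n {0..<k}" "ss \<in> seqs n {0..<d}" "zs = zip xs ss"
    by (rule pair_seqE[OF assms])
  then show "state_vec zs \<in> carrier_vec (d ^ n)" "nrm2 (state_vec zs) = 1"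
    using word_orthonormal[OF zs(1)] by (auto simp: orthonormal_on_def state_vec_zip nrm2_def)
qed

lemma joint_prod_zip:
  assumes "length xs = length ss"
  shows "prod_list (map joint (zip xs ss)) = prod_list (map p xs) * prod_list (map2 q xs ss)"
  using assms by (induction xs ss rule: list_induct2) (auto simp: joint_def)

text \<open>Conditioning on the codeword: the index sequence is drawn from the eigenvalue
  distributions of the letters sent.\<close>

lemma iid_joint:
  "iid n pairs joint F = (\<Sum>xs\<in>seqs n {0..<k}. prod_list (map p xs)
    * (\<Sum>ss\<in>seqs n {0..<d}. prod_list (map2 q xs ss) * F (zip xs ss)))"
  unfolding iid_def pairs_def sum_seqs_zip sum_distrib_left
  by (intro sum.cong refl) (auto simp: joint_prod_zip seqs_def mult.assoc)

lemma cond_prob_sum: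
  assumes "xs \<in> seqs n {0..<k}"
  shows "(\<Sum>ss\<in>seqs n {0..<d}. prod_list (map2 q xs ss)) = 1"
proof -
  have "(\<Sum>ss\<in>seqs (length xs) {0..<d}. prod_list (map2 q xs ss)) = 1" if "set xs \<subseteq> {0..<k}" for xs
    using that
  proof (induction xs)
    case (Cons x xs)
    then show ?case
      by (simp add: sum_seqs_Suc atLeast0LessThan q_sum flip: sum_distrib_left)
  qed (simp add: seqs_0)
  then show ?thesis using assms by (auto simp: seqs_def)
qed

lemma cond_prob_nonneg:
  assumes "xs \<in> seqs n {0..<k}" "ss \<in> seqs n {0..<d}"
  shows "0 \<le> prod_list (map2 q xs ss)"
  by (rule prod_list_seqs_nonneg[OF _ zip_mem_seqs[OF assms]]) (auto simp: q_nonneg)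

lemma word_prob_nonneg: "xs \<in> seqs n {0..<k} \<Longrightarrow> 0 \<le> prod_list (map p xs)"
  by (rule prod_list_seqs_nonneg[of "{0..<k}"]) (auto simp: p_nonneg)

lemma word_prob_sum: "(\<Sum>xs\<in>seqs n {0..<k}. prod_list (map p xs)) = 1"
  using iid_const[of "{0..<k}" p n 1] p_sum by (simp add: iid_def atLeast0LessThan)

lemma cond_typ_proj_span:
  assumes "xs \<in> seqs n {0..<k}"
  shows "cond_typ_proj k d e q \<delta> xs = span_proj (d ^ n) (\<lambda>ss. tensor_vec_list (map2 e xs ss))
    {ss \<in> seqs n {0..<d}. cond_typical k d q \<delta> xs ss}"
  using assms by (simp add: cond_typ_proj_def span_proj_def seqs_def)

lemma cond_typ_orthonormal:
  assumes "xs \<in> seqs n {0..<k}"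
  shows "orthonormal_on (d ^ n) (\<lambda>ss. tensor_vec_list (map2 e xs ss))
    {ss \<in> seqs n {0..<d}. cond_typical k d q \<delta> xs ss}"
  by (rule orthonormal_on_subset[OF word_orthonormal[OF assms]]) auto

lemma dec_proj_projection:
  assumes "xs \<in> seqs n {0..<k}"
  shows "projection (d ^ n) (dec_proj k d p e q \<delta> xs)"
proof -
  have "length xs = n" using assms by (simp add: seqs_def)
  moreover have "projection (d ^ n) (cond_typ_proj k d e q \<delta> xs)"
    unfolding cond_typ_proj_span[OF assms]
    by (rule span_proj_projection[OF _ cond_typ_orthonormal[OF assms]]) (simp add: finite_seqs)
  ultimately show ?thesis by (simp add: dec_proj_def projection_zero)
qed

text \<open>The vector bound averaged over the eigenvectors emitted by the sent word;
  \<open>E\<close> is the conditional expectation given that word. The correct projector is written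
  with \<open>map fst zs\<close>, which is the sent word, so that the last term becomes a function
  of the pair sequence alone and can be averaged over random codewords.\<close>

lemma code_error_message_bound:
  fixes \<delta> :: real
  assumes cb: "cb \<in> seqs M (seqs n {0..<k})" and m: "m < M"
    and P0: "projection (d ^ n) P0" and c: "0 < c"
  defines "Ps \<equiv> map (dec_proj k d p e q \<delta>) cb"
    and "E \<equiv> \<lambda>xs F. \<Sum>ss\<in>seqs n {0..<d}. prod_list (map2 q xs ss) * (F (zip xs ss) :: real)"
  shows "1 - seq_output_prob (d ^ n) Ps (tensor_mat_list (map \<rho> (cb ! m))) m
    \<le> c + (10 + 1 / c) * E (cb ! m) (\<lambda>zs. nrm2 (state_vec zs - P0 *\<^sub>v state_vec zs))
      + 4 * (\<Sum>i<m. E (cb ! m) (\<lambda>zs. nrm2 (dec_proj k d p e q \<delta> (cb ! i) *\<^sub>v (P0 *\<^sub>v state_vec zs))))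
      + 8 * E (cb ! m) (\<lambda>zs. nrm2 (state_vec zs - dec_proj k d p e q \<delta> (map fst zs) *\<^sub>v state_vec zs))"
    (is "_ \<le> ?R")
proof -
  let ?D = "d ^ n"
  define xs where "xs = cb ! m"
  let ?u = "\<lambda>ss. tensor_vec_list (map2 e xs ss)"
  let ?S = "seqs n {0..<d}"
  let ?A = "map (\<lambda>P. 1\<^sub>m ?D - P) (take m Ps) @ [Ps ! m]"
  have len: "length cb = M" and words: "\<And>i. i < M \<Longrightarrow> cb ! i \<in> seqs n {0..<k}"
    using cb by (auto simp: seqs_def[of M])
  have xs: "xs \<in> seqs n {0..<k}" unfolding xs_def by (rule words[OF m])
  have Ps: "\<forall>P\<in>set Ps. projection ?D P" "m < length Ps"
    using words len m by (auto simp: Ps_def in_set_conv_nth intro!: dec_proj_projection[of _ n])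
  have Pi: "Ps ! i = dec_proj k d p e q \<delta> (cb ! i)" if "i \<le> m" for i using that m len by (simp add: Ps_def)
  have u: "?u ss \<in> carrier_vec ?D" if "ss \<in> ?S" for ss
    using word_orthonormal[OF xs] that by (auto simp: orthonormal_on_def)
  have lx: "length xs = n" using xs by (simp add: seqs_def)
  have \<sigma>: "tensor_mat_list (map \<rho> xs) = sum_matrix ?D
      (\<lambda>ss. complex_of_real (prod_list (map2 q xs ss)) \<cdot>\<^sub>m outer (?u ss)) ?S"
    unfolding lx[symmetric]
  proof (rule tensor_mat_list_spectral)
    show "e x s \<in> carrier_vec d" if "x \<in> set xs" "s \<in> {0..<d}" for x s
      using that xs by (auto simp: seqs_def intro!: e_carrier)
    show "\<rho> x = sum_matrix d (\<lambda>s. complex_of_real (q x s) \<cdot>\<^sub>m outer (e x s)) {0..<d}" if "x \<in> set xs" for x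
      using that xs by (auto simp: seqs_def intro!: rho)
  qed simp
  have "seq_output_prob ?D Ps (tensor_mat_list (map \<rho> xs)) m
      = (\<Sum>ss\<in>?S. prod_list (map2 q xs ss) * nrm2 (seq_apply ?A (?u ss)))"
    unfolding \<sigma> by (rule seq_output_prob_spectral[OF Ps finite_seqs u]) simp_all
  then have "1 - seq_output_prob ?D Ps (tensor_mat_list (map \<rho> xs)) m
      = E xs (\<lambda>zs. 1 - nrm2 (seq_apply ?A (state_vec zs)))"
    unfolding E_def by (simp add: right_diff_distrib sum_subtractf cond_prob_sum[OF xs] state_vec_zip)
  also have "\<dots> \<le> E xs (\<lambda>zs. c + (10 + 1 / c) * nrm2 (state_vec zs - P0 *\<^sub>v state_vec zs)
      + 4 * (\<Sum>i<m. nrm2 (dec_proj k d p e q \<delta> (cb ! i) *\<^sub>v (P0 *\<^sub>v state_vec zs)))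
      + 8 * nrm2 (state_vec zs - dec_proj k d p e q \<delta> (map fst zs) *\<^sub>v state_vec zs))"
    unfolding E_def
  proof (rule sum_mono, rule mult_left_mono)
    fix ss assume ss: "ss \<in> ?S"
    let ?v = "state_vec (zip xs ss)"
    have zs: "zip xs ss \<in> seqs n pairs" using zip_mem_seqs[OF xs ss] by (simp add: pairs_def)
    have fst: "map fst (zip xs ss) = xs" using xs ss by (simp add: seqs_def)
    have "(\<Sum>i<m. nrm2 (Ps ! i *\<^sub>v (P0 *\<^sub>v ?v))) = (\<Sum>i<m. nrm2 (dec_proj k d p e q \<delta> (cb ! i) *\<^sub>v (P0 *\<^sub>v ?v)))"
      by (intro sum.cong) (auto simp: Pi)
    then show "1 - nrm2 (seq_apply ?A ?v) \<le> c + (10 + 1 / c) * nrm2 (?v - P0 *\<^sub>v ?v)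
      + 4 * (\<Sum>i<m. nrm2 (dec_proj k d p e q \<delta> (cb ! i) *\<^sub>v (P0 *\<^sub>v ?v)))
      + 8 * nrm2 (?v - dec_proj k d p e q \<delta> (map fst (zip xs ss)) *\<^sub>v ?v)"
      using sequential_decoding_error[OF Ps P0 state_vec_unit[OF zs] c]
      unfolding fst Pi[OF order_refl] xs_def[symmetric] by simp
    show "0 \<le> prod_list (map2 q xs ss)" by (rule cond_prob_nonneg[OF xs ss])
  qed
  also have "\<dots> = ?R"
  proof -
    have Eadd: "E xs (\<lambda>zs. F zs + G zs) = E xs F + E xs G" for F G
      by (simp add: E_def distrib_left sum.distrib)
    have Emul: "E xs (\<lambda>zs. b * F zs) = b * E xs F" for b F
      by (simp add: E_def sum_distrib_left mult_ac)
    have Econst: "E xs (\<lambda>_. b) = b" for b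
      by (simp add: E_def cond_prob_sum[OF xs] flip: sum_distrib_right)
    have Esum: "E xs (\<lambda>zs. \<Sum>i<m. F i zs) = (\<Sum>i<m. E xs (F i))" for F
      unfolding E_def sum_distrib_left by (rule sum.swap)
    show ?thesis unfolding Eadd Emul Econst Esum xs_def[symmetric] ..
  qed
  finally show ?thesis unfolding xs_def .
qed

text \<open>Terms about the sent word see only its i.i.d. law. For an earlier message, the wrong
  codeword ys is independent of the sent one, so the sent word may be averaged with ys held fixed;
  the bound G is uniform in ys and survives the average over ys. At most M earlier messages
  occur.\<close>

lemma expected_error_bound:
  assumes P0: "projection (d ^ n) P0" and c: "0 < c"
    and G: "0 \<le> G" "\<And>ys. ys \<in> seqs n {0..<k} \<Longrightarrow>
      iid n pairs joint (\<lambda>zs. nrm2 (dec_proj k d p e q \<delta> ys *\<^sub>v (P0 *\<^sub>v state_vec zs))) \<le> G"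
  shows "expected_error k d p \<rho> e q \<delta> n M
    \<le> c + (10 + 1 / c) * iid n pairs joint (\<lambda>zs. nrm2 (state_vec zs - P0 *\<^sub>v state_vec zs))
      + 4 * (real M * G)
      + 8 * iid n pairs joint (\<lambda>zs. nrm2 (state_vec zs - dec_proj k d p e q \<delta> (map fst zs) *\<^sub>v state_vec zs))"
    (is "_ \<le> c + ?\<kappa> * ?a + 4 * (real M * G) + 8 * ?b")
proof -
  let ?A = "seqs n {0..<k}"
  let ?W = "\<lambda>xs. prod_list (map p xs)"
  define E where "E xs F = (\<Sum>ss\<in>seqs n {0..<d}. prod_list (map2 q xs ss) * (F (zip xs ss) :: real))" for xs F
  define \<alpha> where "\<alpha> xs = E xs (\<lambda>zs. nrm2 (state_vec zs - P0 *\<^sub>v state_vec zs))" for xs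
  define \<beta> where "\<beta> xs = E xs (\<lambda>zs. nrm2 (state_vec zs - dec_proj k d p e q \<delta> (map fst zs) *\<^sub>v state_vec zs))" for xs
  define \<gamma> where "\<gamma> ys xs = E xs (\<lambda>zs. nrm2 (dec_proj k d p e q \<delta> ys *\<^sub>v (P0 *\<^sub>v state_vec zs)))" for ys xs
  define Y where "Y m cb = c + ?\<kappa> * \<alpha> (cb ! m) + 4 * (\<Sum>i<m. \<gamma> (cb ! i) (cb ! m)) + 8 * \<beta> (cb ! m)" for m cb
  have fin: "finite ?A" by (simp add: finite_seqs)
  note W = fin word_prob_sum
  have iE: "(\<Sum>xs\<in>?A. ?W xs * E xs F) = iid n pairs joint F" for F by (simp add: iid_joint E_def)
  have g: "(\<Sum>xs\<in>?A. ?W xs * \<gamma> ys xs) \<le> G" if "ys \<in> ?A" for ys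
    using G(2)[OF that] by (simp add: \<gamma>_def iE)
  have a: "(\<Sum>xs\<in>?A. ?W xs * \<alpha> xs) = ?a" and b: "(\<Sum>xs\<in>?A. ?W xs * \<beta> xs) = ?b"
    by (simp_all add: \<alpha>_def \<beta>_def iE)
  have gg: "(\<Sum>ys\<in>?A. ?W ys * (\<Sum>xs\<in>?A. ?W xs * \<gamma> ys xs)) \<le> G"
  proof -
    have "(\<Sum>ys\<in>?A. ?W ys * (\<Sum>xs\<in>?A. ?W xs * \<gamma> ys xs)) \<le> (\<Sum>ys\<in>?A. ?W ys * G)"
      by (intro sum_mono mult_left_mono g word_prob_nonneg)
    then show ?thesis by (simp add: word_prob_sum flip: sum_distrib_right)
  qed
  define X where "X = c + ?\<kappa> * ?a + 4 * (real M * G) + 8 * ?b"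
  have nn: "0 \<le> iid n pairs joint (\<lambda>zs. nrm2 (F zs))" for F
    using iid_mono[of pairs joint n "\<lambda>_. 0" "\<lambda>zs. nrm2 (F zs)"] joint_nonneg
    by (simp add: nrm2_nonneg iid_def)
  have X0: "0 \<le> X" unfolding X_def
    using c G(1) nn[of "\<lambda>zs. state_vec zs - P0 *\<^sub>v state_vec zs"]
      nn[of "\<lambda>zs. state_vec zs - dec_proj k d p e q \<delta> (map fst zs) *\<^sub>v state_vec zs"]
    by (intro add_nonneg_nonneg mult_nonneg_nonneg) auto
  have Ym: "iid M ?A ?W (Y m) \<le> X" if m: "m < M" for m
  proof -
    have "iid M ?A ?W (Y m) = c + ?\<kappa> * ?a
        + 4 * (\<Sum>i<m. (\<Sum>ys\<in>?A. ?W ys * (\<Sum>xs\<in>?A. ?W xs * \<gamma> ys xs))) + 8 * ?b"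
      unfolding Y_def iid_add iid_cmult iid_sum iid_const[OF W]
        iid_nth[OF W m] a b
      using m by (simp add: iid_nth2[OF W _ m])
    also have "\<dots> \<le> c + ?\<kappa> * ?a + 4 * (\<Sum>i<m. G) + 8 * ?b"
      using gg by (intro add_mono mult_left_mono sum_mono order_refl) auto
    also have "(\<Sum>i<m. G) \<le> real M * G" using m G(1) by (simp add: mult_right_mono)
    finally show ?thesis by (simp add: X_def)
  qed
  have "expected_error k d p \<rho> e q \<delta> n M = iid M ?A ?W (avg_error k d p \<rho> e q \<delta> n)"
    by (simp add: expected_error_def iid_def)
  also have "\<dots> \<le> iid M ?A ?W (\<lambda>cb. (1 / real M) * (\<Sum>m<M. Y m cb))"
  proof (rule iid_mono)
    fix cb assume cb: "cb \<in> seqs M ?A"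
    have len: "length cb = M" using cb by (simp add: seqs_def)
    have "(\<Sum>m<M. 1 - seq_output_prob (d ^ n) (map (dec_proj k d p e q \<delta>) cb) (tensor_mat_list (map \<rho> (cb ! m))) m)
        \<le> (\<Sum>m<M. Y m cb)"
      unfolding Y_def \<alpha>_def \<beta>_def \<gamma>_def E_def
      by (intro sum_mono code_error_message_bound[OF cb _ P0 c]) simp
    then show "avg_error k d p \<rho> e q \<delta> n cb \<le> (1 / real M) * (\<Sum>m<M. Y m cb)"
      by (simp add: avg_error_def Let_def len divide_right_mono)
  qed (rule word_prob_nonneg)
  also have "\<dots> = (1 / real M) * (\<Sum>m<M. iid M ?A ?W (Y m))"
    by (simp only: iid_cmult iid_sum)
  also have "\<dots> \<le> (1 / real M) * (\<Sum>m<M. X)"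
    using Ym by (intro mult_left_mono sum_mono) auto
  \<comment> \<open>For M = 0, as at negative rates, the average over messages is 0 by
    \<open>1 / 0 = 0\<close>, and the claim is that X is nonnegative.\<close>
  also have "\<dots> \<le> X" using X0 by simp
  finally show ?thesis by (simp add: X_def)
qed

end

context cq_channel
begin

section \<open>Acceptance and rank of the decoder projectors\<close>

lemma count_list_fst:
  assumes "zs \<in> seqs n pairs"
  shows "count_list (map fst zs) x = (\<Sum>s<d. count_list zs (x, s))"
proof -
  have "set zs \<subseteq> pairs \<Longrightarrow> count_list (map fst zs) x = (\<Sum>s<d. count_list zs (x, s))" for zs
  proof (induction zs)
    case (Cons z zs)
    obtain a b where z: "z = (a, b)" "b < d" using Cons.prems by (auto simp: pairs_def)
    have "(\<Sum>s<d. count_list (z # zs) (x, s)) = (\<Sum>s<d. (if s = b then (if a = x then 1 else 0) else 0) + count_list zs (x, s))"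
      by (intro sum.cong) (auto simp: z)
    also have "\<dots> = (if a = x then 1 else 0) + (\<Sum>s<d. count_list zs (x, s))"
      using z by (simp add: sum.distrib)
    finally show ?case using Cons z by simp
  qed simp
  then show ?thesis using assms by (simp add: seqs_def)
qed

text \<open>Joint tolerance \<delta>/4 passes to the letter counts by summing over s. The
  conditional deviation collects \<delta>/4 from the pair count and \<delta>/4 from the letter
  count, relative to n p(x) q; since the letter count is at least n p(x) / 2, measuring relative to
  it at most doubles \<delta>/2.\<close>

lemma joint_typical_imp:
  assumes zs: "zs \<in> seqs n pairs" and n: "0 < n" and \<delta>: "0 < \<delta>" "\<delta> \<le> 1"
    and tp: "rel_typical pairs joint (\<delta> / 4) zs"
  shows "map fst zs \<in> typical_set k p \<delta> n" "cond_typical k d q \<delta> (map fst zs) (map snd zs)"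
proof -
  define N where "N x s = real (count_list zs (x, s))" for x s
  define L where "L x = real (count_list (map fst zs) x)" for x
  have len: "length zs = n" using zs by (simp add: seqs_def)
  have N: "\<bar>N x s - p x * q x s * n\<bar> \<le> \<delta> / 4 * (p x * q x s) * n" if "x < k" "s < d" for x s
    using tp that by (auto simp: rel_typical_def pairs_def joint_def N_def len)
  have L: "L x = (\<Sum>s<d. N x s)" for x unfolding L_def N_def count_list_fst[OF zs] by simp
  have Lb: "\<bar>L x - p x * n\<bar> \<le> \<delta> / 4 * p x * n" if x: "x < k" for x
  proof -
    have "L x - p x * n = (\<Sum>s<d. N x s - q x s * (p x * n))"
      by (simp add: L sum_subtractf q_sum[OF x] flip: sum_distrib_right)
    also have "\<bar>\<dots>\<bar> \<le> (\<Sum>s<d. \<bar>N x s - q x s * (p x * n)\<bar>)" by (rule sum_abs)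
    also have "\<dots> \<le> (\<Sum>s<d. q x s * (\<delta> / 4 * p x * n))"
      using N[OF x] by (intro sum_mono) (auto simp: mult_ac)
    also have "\<dots> = \<delta> / 4 * p x * n" unfolding sum_distrib_right[symmetric] q_sum[OF x] by simp
    finally show ?thesis .
  qed
  show "map fst zs \<in> typical_set k p \<delta> n"
    unfolding typical_set_def
  proof (intro CollectI conjI allI impI)
    show "map fst zs \<in> seqs n {0..<k}" using zs by (fastforce simp: seqs_def pairs_def)
    fix x assume x: "x < k"
    have "\<bar>L x - p x * n\<bar> \<le> \<delta> * p x * n"
    proof -
      have "\<delta> / 4 * p x * n \<le> \<delta> * p x * n"
        using \<delta> p_nonneg[OF x] by (intro mult_right_mono) auto
      then show ?thesis using Lb[OF x] by linarith
    qed
    moreover have "\<bar>L x - p x * n\<bar> = \<bar>L x / n - p x\<bar> * n"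
      using n by (simp add: abs_mult[of _ "real n", simplified, symmetric] left_diff_distrib)
    ultimately have "\<bar>L x / n - p x\<bar> * n \<le> \<delta> * p x * n" by simp
    then show "\<bar>real (count_list (map fst zs) x) / real n - p x\<bar> \<le> \<delta> * p x"
      using n by (simp add: L_def)
  qed
  show "cond_typical k d q \<delta> (map fst zs) (map snd zs)"
    unfolding cond_typical_def
  proof (intro allI impI)
    fix x s assume x: "x < k" and s: "s < d"
    have qn: "0 \<le> q x s" and pn: "0 \<le> p x" by (rule q_nonneg[OF x s], rule p_nonneg[OF x])
    have "N x s - q x s * L x = (N x s - p x * q x s * n) - q x s * (L x - p x * n)"
      by (simp add: algebra_simps)
    also have "\<bar>\<dots>\<bar> \<le> \<bar>N x s - p x * q x s * n\<bar> + \<bar>q x s * (L x - p x * n)\<bar>" by (rule abs_triangle_ineq4)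
    also have "\<dots> \<le> \<delta> / 4 * (p x * q x s) * n + q x s * (\<delta> / 4 * p x * n)"
      unfolding abs_mult abs_of_nonneg[OF qn] by (intro add_mono N[OF x s] mult_left_mono[OF Lb[OF x] qn])
    also have "\<dots> = \<delta> * q x s * (p x * n * (1 / 2))" by (simp add: algebra_simps)
    also have "\<dots> \<le> \<delta> * q x s * L x"
    proof (rule mult_left_mono)
      have "\<delta> / 4 * (p x * n) \<le> 1 / 2 * (p x * n)" using \<delta> pn by (intro mult_right_mono) auto
      moreover have "\<bar>L x - p x * n\<bar> \<le> \<delta> / 4 * (p x * n)" using Lb[OF x] by (simp only: mult.assoc)
      ultimately show "p x * n * (1 / 2) \<le> L x" by linarith
      show "0 \<le> \<delta> * q x s" using \<delta> qn by simp
    qed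
    finally show "\<bar>real (count_list (zip (map fst zs) (map snd zs)) (x, s)) - q x s * real (count_list (map fst zs) x)\<bar>
       \<le> \<delta> * q x s * real (count_list (map fst zs) x)"
      by (simp add: N_def L_def zip_map_fst_snd)
  qed
qed

text \<open>For jointly typical \<open>zs\<close> the emitted eigenvector is one of the vectors
  spanning the projector of its own word, so nothing is lost; otherwise the loss is at most 1. The
  mean loss is thus bounded by a classical probability.\<close>

lemma dec_proj_miss_bound:
  assumes n: "0 < n" and \<delta>: "0 < \<delta>" "\<delta> \<le> 1"
  shows "iid n pairs joint (\<lambda>zs. nrm2 (state_vec zs - dec_proj k d p e q \<delta> (map fst zs) *\<^sub>v state_vec zs))
    \<le> (\<Sum>z\<in>pairs. 1 / ((\<delta> / 4)\<^sup>2 * joint z)) / real n"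
proof -
  have "iid n pairs joint (\<lambda>zs. nrm2 (state_vec zs - dec_proj k d p e q \<delta> (map fst zs) *\<^sub>v state_vec zs))
    \<le> iid n pairs joint (\<lambda>zs. if rel_typical pairs joint (\<delta> / 4) zs then 0 else 1)"
  proof (rule iid_mono[OF joint_nonneg])
    fix zs assume zs: "zs \<in> seqs n pairs"
    define xs where "xs = map fst zs"
    define ss where "ss = map snd zs"
    have zip: "zs = zip xs ss" by (simp add: xs_def ss_def zip_map_fst_snd)
    have xs: "xs \<in> seqs n {0..<k}" and ss: "ss \<in> seqs n {0..<d}"
      using zs by (fastforce simp: seqs_def pairs_def xs_def ss_def)+
    note sv = state_vec_unit[OF zs]
    let ?P = "dec_proj k d p e q \<delta> xs"
    have eq: "nrm2 (state_vec zs - ?P *\<^sub>v state_vec zs) = 1 - nrm2 (?P *\<^sub>v state_vec zs)"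
      using nrm2_compl[OF dec_proj_projection[OF xs] sv(1)] sv(2) by simp
    show "nrm2 (state_vec zs - dec_proj k d p e q \<delta> (map fst zs) *\<^sub>v state_vec zs)
      \<le> (if rel_typical pairs joint (\<delta> / 4) zs then 0 else 1)"
    proof (cases "rel_typical pairs joint (\<delta> / 4) zs")
      case True
      note tp = joint_typical_imp[OF zs n \<delta> True, folded xs_def ss_def]
      let ?T = "{ss \<in> seqs n {0..<d}. cond_typical k d q \<delta> xs ss}"
      let ?u = "\<lambda>ss. tensor_vec_list (map2 e xs ss)"
      have fin: "finite ?T" by (simp add: finite_seqs)
      have "?P = span_proj (d ^ n) ?u ?T"
        using tp(1) xs cond_typ_proj_span[OF xs] by (simp add: dec_proj_def seqs_def)
      then have "nrm2 (?P *\<^sub>v state_vec zs) = (\<Sum>tt\<in>?T. (cmod (state_vec zs \<bullet>c ?u tt))\<^sup>2)"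
        using nrm2_span_proj[OF fin cond_typ_orthonormal[OF xs] sv(1)] by simp
      moreover have "(cmod (state_vec zs \<bullet>c ?u ss))\<^sup>2 \<le> (\<Sum>tt\<in>?T. (cmod (state_vec zs \<bullet>c ?u tt))\<^sup>2)"
        using tp(2) ss fin by (intro member_le_sum) auto
      moreover have "state_vec zs \<bullet>c ?u ss = 1"
        using word_orthonormal[OF xs] ss by (auto simp: orthonormal_on_def zip state_vec_zip)
      ultimately show ?thesis using True eq by (simp add: xs_def)
    next
      case False
      then show ?thesis using eq nrm2_nonneg[of "?P *\<^sub>v state_vec zs"] by (simp add: xs_def)
    qed
  qed
  also have "\<dots> \<le> (\<Sum>z\<in>pairs. 1 / ((\<delta> / 4)\<^sup>2 * joint z)) / real n"
    by (rule atypical_prob[OF finite_pairs joint_sum joint_nonneg]) (use assms in auto)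
  finally show ?thesis .
qed

text \<open>Every conditionally typical index sequence has conditional probability at least 2 to the
  power -n (1 + \<delta>)^2 H(B|X), and these probabilities sum to at most 1. One factor 1 +
  \<delta> comes from the counts of pairs, the other from the counts of letters in ys.\<close>

lemma card_cond_typical_le:
  assumes ys: "ys \<in> typical_set k p \<delta> n" and n: "0 < n" and \<delta>: "0 \<le> \<delta>"
  shows "real (card {ss \<in> seqs n {0..<d}. cond_typical k d q \<delta> ys ss}) \<le> 2 powr (real n * (1 + \<delta>)\<^sup>2 * cond_entropy)"
proof -
  let ?T = "{ss \<in> seqs n {0..<d}. cond_typical k d q \<delta> ys ss}"
  have yseq: "ys \<in> seqs n {0..<k}" using ys by (simp add: typical_set_def)
  define b where "b = 2 powr (- (real n * (1 + \<delta>)\<^sup>2 * cond_entropy))"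
  have "b \<le> prod_list (map2 q ys ss)" if ss: "ss \<in> ?T" for ss
  proof -
    let ?u = "\<lambda>z. (1 + \<delta>)\<^sup>2 * real n * joint z"
    have "2 powr (\<Sum>z\<in>pairs. ?u z * log 2 (q (fst z) (snd z))) \<le> prod_list (map (\<lambda>z. q (fst z) (snd z)) (zip ys ss))"
    proof (rule prod_list_ge_powr[OF finite_pairs])
      show "zip ys ss \<in> seqs n pairs" using zip_mem_seqs[OF yseq] ss by (auto simp: pairs_def)
      fix z assume "z \<in> pairs"
      then obtain x s where z: "z = (x, s)" "x < k" "s < d" by (auto simp: pairs_def)
      show "0 \<le> q (fst z) (snd z) \<and> q (fst z) (snd z) \<le> 1" using z q_nonneg q_le_1 by simp
      have "\<bar>real (count_list (zip ys ss) (x, s)) - q x s * real (count_list ys x)\<bar>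
          \<le> \<delta> * q x s * real (count_list ys x)"
        using ss z by (simp add: cond_typical_def)
      then have c1: "real (count_list (zip ys ss) (x, s)) \<le> (1 + \<delta>) * q x s * real (count_list ys x)"
        by (simp add: algebra_simps)
      have "\<bar>real (count_list ys x) / real n - p x\<bar> \<le> \<delta> * p x" using ys z by (simp add: typical_set_def)
      then have "real (count_list ys x) / real n \<le> (1 + \<delta>) * p x" by (simp add: algebra_simps)
      then have "real (count_list ys x) \<le> (1 + \<delta>) * p x * real n" using n by (simp add: field_simps)
      then have "(1 + \<delta>) * q x s * real (count_list ys x) \<le> (1 + \<delta>) * q x s * ((1 + \<delta>) * p x * real n)"
        using \<delta> q_nonneg[OF z(2,3)] by (intro mult_left_mono) auto
      also have "\<dots> = ?u z" by (simp add: z joint_def power2_eq_square)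
      finally show "real (count_list (zip ys ss) z) \<le> ?u z" using c1 z by simp
      \<comment> \<open>Relative tolerance at work: the bound \<open>c1\<close> on the count is 0
        when the eigenvalue is 0.\<close>
      show "count_list (zip ys ss) z = 0" if "q (fst z) (snd z) = 0"
        using c1 that z by simp
    qed
    moreover have "(\<Sum>z\<in>pairs. ?u z * log 2 (q (fst z) (snd z))) = - (real n * (1 + \<delta>)\<^sup>2 * cond_entropy)"
      by (simp add: sum_pairs cond_entropy_def joint_def sum_distrib_left mult_ac)
    moreover have "(\<lambda>z. q (fst z) (snd z)) = (\<lambda>(x, s). q x s)" by auto
    ultimately show ?thesis by (simp add: b_def)
  qed
  then have "real (card ?T) * b \<le> (\<Sum>ss\<in>?T. prod_list (map2 q ys ss))"
    using sum_mono[of ?T "\<lambda>_. b" "\<lambda>ss. prod_list (map2 q ys ss)"] by simp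
  also have "\<dots> \<le> (\<Sum>ss\<in>seqs n {0..<d}. prod_list (map2 q ys ss))"
    by (intro sum_mono2) (auto simp: finite_seqs intro: cond_prob_nonneg[OF yseq])
  also have "\<dots> = 1" by (rule cond_prob_sum[OF yseq])
  finally have "real (card ?T) * b \<le> 1" .
  then show ?thesis unfolding b_def by (simp add: powr_minus field_simps)
qed

end

section \<open>The average state and its typical projector\<close>

locale cq_channel_eigenbasis = cq_channel +
  fixes f :: "nat \<Rightarrow> complex vec" and r :: "nat \<Rightarrow> real"
  assumes f_on: "orthonormal_on d f {0..<d}"
    and r_nonneg: "t < d \<Longrightarrow> 0 \<le> r t" and r_sum: "(\<Sum>t<d. r t) = 1"
    and avg_entropy: "vn_entropy avg_state = - (\<Sum>t<d. r t * log 2 (r t))"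
    and avg_diag: "t < d \<Longrightarrow> t' < d \<Longrightarrow>
      (\<Sum>z\<in>pairs. complex_of_real (joint z) * (eigvec z \<bullet>c f t) * (f t' \<bullet>c eigvec z))
        = (if t = t' then complex_of_real (r t) else 0)"
begin

definition basis_vec :: "nat list \<Rightarrow> complex vec" where
  "basis_vec ts = tensor_vec_list (map f ts)"

definition avg_typical :: "real \<Rightarrow> nat \<Rightarrow> nat list set" where
  "avg_typical \<delta> n = {ts \<in> seqs n {0..<d}. rel_typical {0..<d} r \<delta> ts}"

definition avg_proj :: "real \<Rightarrow> nat \<Rightarrow> complex mat" where
  "avg_proj \<delta> n = span_proj (d ^ n) basis_vec (avg_typical \<delta> n)"

lemma r_le_1: "t < d \<Longrightarrow> r t \<le> 1"
  using member_le_sum[of t "{..<d}" r] r_nonneg r_sum by auto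

lemma avg_entropy_nonneg: "0 \<le> vn_entropy avg_state"
proof -
  have "r t * log 2 (r t) \<le> 0" if "t < d" for t
  proof (cases "r t = 0")
    case False
    then have "0 < r t" using r_nonneg[OF that] by simp
    then show ?thesis using r_le_1[OF that] by (intro mult_nonneg_nonpos) auto
  qed simp
  then have "(\<Sum>t<d. r t * log 2 (r t)) \<le> 0" by (intro sum_nonpos) auto
  then show ?thesis by (simp add: avg_entropy)
qed

lemma finite_avg_typical: "finite (avg_typical \<delta> n)"
  by (simp add: avg_typical_def finite_seqs)

lemma basis_vec_orthonormal: "orthonormal_on (d ^ n) basis_vec (seqs n {0..<d})"
  using orthonormal_on_tensor_power[OF f_on] by (simp add: basis_vec_def[abs_def])

lemma basis_vec_carrier: "ts \<in> seqs n {0..<d} \<Longrightarrow> basis_vec ts \<in> carrier_vec (d ^ n)"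
  using basis_vec_orthonormal by (auto simp: orthonormal_on_def)

lemma avg_typical_orthonormal: "orthonormal_on (d ^ n) basis_vec (avg_typical \<delta> n)"
  by (rule orthonormal_on_subset[OF basis_vec_orthonormal]) (auto simp: avg_typical_def)

lemma avg_proj_projection: "projection (d ^ n) (avg_proj \<delta> n)"
  unfolding avg_proj_def by (rule span_proj_projection[OF finite_avg_typical avg_typical_orthonormal])

lemma state_second_moment:
  assumes "ts \<in> seqs n {0..<d}" "ts' \<in> seqs n {0..<d}"
  shows "(\<Sum>zs\<in>seqs n pairs. complex_of_real (prod_list (map joint zs))
      * (state_vec zs \<bullet>c basis_vec ts) * (basis_vec ts' \<bullet>c state_vec zs))
    = (if ts = ts' then complex_of_real (prod_list (map r ts)) else 0)"
proof -
  have "f t \<in> carrier_vec d" if "t \<in> {0..<d}" for t using f_on that by (auto simp: orthonormal_on_def)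
  then show ?thesis
    unfolding state_vec_def basis_vec_def
    by (intro tensor_second_moment[OF finite_pairs eigvec_carrier _ _ assms]) (auto simp: avg_diag)
qed

text \<open>A diagonal entry of the tensor power of the average state: measuring a random output in
  the product eigenbasis gives i.i.d. indices with law r.\<close>

lemma iid_state_overlap:
  assumes "ts \<in> seqs n {0..<d}"
  shows "iid n pairs joint (\<lambda>zs. (cmod (state_vec zs \<bullet>c basis_vec ts))\<^sup>2) = prod_list (map r ts)"
proof -
  have "complex_of_real (iid n pairs joint (\<lambda>zs. (cmod (state_vec zs \<bullet>c basis_vec ts))\<^sup>2))
    = (\<Sum>zs\<in>seqs n pairs. complex_of_real (prod_list (map joint zs))
      * (state_vec zs \<bullet>c basis_vec ts) * (basis_vec ts \<bullet>c state_vec zs))"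
    unfolding iid_def of_real_sum
  proof (rule sum.cong)
    fix zs assume "zs \<in> seqs n pairs"
    then have "basis_vec ts \<bullet>c state_vec zs = cnj (state_vec zs \<bullet>c basis_vec ts)"
      using cprod_cnj[OF state_vec_unit(1) basis_vec_carrier[OF assms]] by simp
    then show "complex_of_real (prod_list (map joint zs) * (cmod (state_vec zs \<bullet>c basis_vec ts))\<^sup>2)
      = complex_of_real (prod_list (map joint zs)) * (state_vec zs \<bullet>c basis_vec ts) * (basis_vec ts \<bullet>c state_vec zs)"
      by (simp only: of_real_mult complex_norm_square mult.assoc)
  qed simp
  also have "\<dots> = complex_of_real (prod_list (map r ts))" using state_second_moment[OF assms assms] by simp
  finally show ?thesis by (simp only: of_real_eq_iff)
qed

text \<open>Since those measured indices are i.i.d. with law r, the mean loss equals the probability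
  that such a sequence is atypical, and the classical bound applies.\<close>

lemma avg_proj_miss_bound:
  assumes "0 < n" "0 < \<delta>"
  shows "iid n pairs joint (\<lambda>zs. nrm2 (state_vec zs - avg_proj \<delta> n *\<^sub>v state_vec zs))
    \<le> (\<Sum>t\<in>{0..<d}. 1 / (\<delta>\<^sup>2 * r t)) / real n"
proof -
  let ?T = "avg_typical \<delta> n"
  have rs: "sum r {0..<d} = 1" using r_sum by (simp add: atLeast0LessThan)
  have "iid n pairs joint (\<lambda>zs. nrm2 (state_vec zs - avg_proj \<delta> n *\<^sub>v state_vec zs))
    = iid n pairs joint (\<lambda>zs. 1 + (-1) * (\<Sum>ts\<in>?T. (cmod (state_vec zs \<bullet>c basis_vec ts))\<^sup>2))"
  proof (rule iid_cong)
    fix zs assume zs: "zs \<in> seqs n pairs"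
    note sv = state_vec_unit[OF zs]
    show "nrm2 (state_vec zs - avg_proj \<delta> n *\<^sub>v state_vec zs)
      = 1 + (-1) * (\<Sum>ts\<in>?T. (cmod (state_vec zs \<bullet>c basis_vec ts))\<^sup>2)"
      using nrm2_compl[OF avg_proj_projection sv(1), of \<delta>] sv(2)
        nrm2_span_proj[OF finite_avg_typical avg_typical_orthonormal sv(1), of \<delta>]
      by (simp add: avg_proj_def)
  qed
  also have "\<dots> = 1 - (\<Sum>ts\<in>?T. prod_list (map r ts))"
    unfolding iid_add iid_cmult iid_sum iid_const[OF finite_pairs joint_sum]
    using iid_state_overlap[of _ n] by (simp add: avg_typical_def)
  also have "1 = (\<Sum>ts\<in>seqs n {0..<d}. prod_list (map r ts))"
    using iid_const[OF _ rs, of n 1] by (simp add: iid_def)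
  also have "\<dots> - (\<Sum>ts\<in>?T. prod_list (map r ts)) = (\<Sum>ts\<in>seqs n {0..<d} - ?T. prod_list (map r ts))"
    by (rule sum_diff[symmetric]) (auto simp: finite_seqs avg_typical_def)
  also have "\<dots> = iid n {0..<d} r (\<lambda>ts. if rel_typical {0..<d} r \<delta> ts then 0 else 1)"
    unfolding iid_def by (rule sum.mono_neutral_cong_left) (auto simp: finite_seqs avg_typical_def)
  also have "\<dots> \<le> (\<Sum>t\<in>{0..<d}. 1 / (\<delta>\<^sup>2 * r t)) / real n"
    by (rule atypical_prob[OF _ rs]) (use assms r_nonneg in auto)
  finally show ?thesis .
qed

lemma avg_typical_prob_le:
  assumes "ts \<in> avg_typical \<delta> n"
  shows "prod_list (map r ts) \<le> 2 powr (- (real n * (1 - \<delta>) * vn_entropy avg_state))"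
proof -
  have ts: "ts \<in> seqs n {0..<d}" "length ts = n" and tp: "rel_typical {0..<d} r \<delta> ts"
    using assms by (auto simp: avg_typical_def seqs_def)
  have "prod_list (map r ts) \<le> 2 powr (\<Sum>t\<in>{0..<d}. ((1 - \<delta>) * real n * r t) * log 2 (r t))"
  proof (rule prod_list_le_powr[OF _ ts(1)])
    fix t assume t: "t \<in> {0..<d}"
    show "0 \<le> r t \<and> r t \<le> 1" using t r_nonneg r_le_1 by simp
    have "\<bar>real (count_list ts t) - r t * real n\<bar> \<le> \<delta> * r t * real n"
      using tp t ts(2) by (auto simp: rel_typical_def)
    then show "(1 - \<delta>) * real n * r t \<le> real (count_list ts t)" by (simp add: algebra_simps)
  qed simp
  also have "(\<Sum>t\<in>{0..<d}. ((1 - \<delta>) * real n * r t) * log 2 (r t)) = - (real n * (1 - \<delta>) * vn_entropy avg_state)"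
    by (simp add: avg_entropy sum_distrib_left atLeast0LessThan mult_ac)
  finally show ?thesis .
qed

text \<open>The mean is the quadratic form at u of the average tensor power cut down to its typical
  subspace. Expanding both overlaps in the product eigenbasis, the second moment removes the
  off-diagonal terms; the remaining eigenvalues are at most l, and Bessel's inequality bounds the
  rest by |u|^2.\<close>

lemma avg_proj_overlap_bound:
  assumes u: "u \<in> carrier_vec (d ^ n)" and l: "\<And>ts. ts \<in> avg_typical \<delta> n \<Longrightarrow> prod_list (map r ts) \<le> l" "0 \<le> l"
  shows "iid n pairs joint (\<lambda>zs. (cmod ((avg_proj \<delta> n *\<^sub>v state_vec zs) \<bullet>c u))\<^sup>2) \<le> l * nrm2 u"
proof -
  let ?T = "avg_typical \<delta> n"
  have bc: "basis_vec ts \<in> carrier_vec (d ^ n)" if "ts \<in> ?T" for ts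
    using that by (auto simp: avg_typical_def intro: basis_vec_carrier)
  have "complex_of_real (iid n pairs joint (\<lambda>zs. (cmod ((avg_proj \<delta> n *\<^sub>v state_vec zs) \<bullet>c u))\<^sup>2))
    = (\<Sum>zs\<in>seqs n pairs. \<Sum>ts\<in>?T. \<Sum>ts'\<in>?T.
        (complex_of_real (prod_list (map joint zs)) * (state_vec zs \<bullet>c basis_vec ts) * (basis_vec ts' \<bullet>c state_vec zs))
        * ((basis_vec ts \<bullet>c u) * (u \<bullet>c basis_vec ts')))"
    unfolding iid_def of_real_sum
  proof (rule sum.cong)
    fix zs assume zs: "zs \<in> seqs n pairs"
    note sv = state_vec_unit(1)[OF zs]
    let ?x = "(avg_proj \<delta> n *\<^sub>v state_vec zs) \<bullet>c u"
    have x: "?x = (\<Sum>ts\<in>?T. (state_vec zs \<bullet>c basis_vec ts) * (basis_vec ts \<bullet>c u))"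
      unfolding avg_proj_def by (rule span_proj_cprod[OF finite_avg_typical avg_typical_orthonormal sv u])
    have cx: "cnj ?x = (\<Sum>ts\<in>?T. (basis_vec ts \<bullet>c state_vec zs) * (u \<bullet>c basis_vec ts))"
      unfolding x cnj_sum complex_cnj_mult
      by (intro sum.cong refl) (simp only: cprod_cnj[OF sv bc] cprod_cnj[OF bc u])
    have "complex_of_real (prod_list (map joint zs) * (cmod ?x)\<^sup>2)
      = complex_of_real (prod_list (map joint zs)) * (?x * cnj ?x)"
      by (simp only: of_real_mult complex_norm_square)
    also have "\<dots> = (\<Sum>ts\<in>?T. \<Sum>ts'\<in>?T.
        (complex_of_real (prod_list (map joint zs)) * (state_vec zs \<bullet>c basis_vec ts) * (basis_vec ts' \<bullet>c state_vec zs))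
        * ((basis_vec ts \<bullet>c u) * (u \<bullet>c basis_vec ts')))"
      unfolding cx unfolding x unfolding sum_product unfolding sum_distrib_left by (intro sum.cong refl) (simp only: mult_ac)
    finally show "complex_of_real (prod_list (map joint zs) * (cmod ?x)\<^sup>2) = \<dots>" .
  qed simp
  also have "\<dots> = (\<Sum>ts\<in>?T. \<Sum>ts'\<in>?T. (\<Sum>zs\<in>seqs n pairs.
        complex_of_real (prod_list (map joint zs)) * (state_vec zs \<bullet>c basis_vec ts) * (basis_vec ts' \<bullet>c state_vec zs))
        * ((basis_vec ts \<bullet>c u) * (u \<bullet>c basis_vec ts')))"
    unfolding sum_distrib_right by (subst sum.swap) (intro sum.cong refl, rule sum.swap)
  also have "\<dots> = (\<Sum>ts\<in>?T. \<Sum>ts'\<in>?T. if ts' = ts then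
        complex_of_real (prod_list (map r ts)) * ((basis_vec ts \<bullet>c u) * (u \<bullet>c basis_vec ts)) else 0)"
    by (intro sum.cong refl, subst state_second_moment) (auto simp: avg_typical_def)
  also have "\<dots> = (\<Sum>ts\<in>?T. complex_of_real (prod_list (map r ts)) * ((basis_vec ts \<bullet>c u) * (u \<bullet>c basis_vec ts)))"
    by (intro sum.cong refl) (simp add: finite_avg_typical)
  also have "\<dots> = complex_of_real (\<Sum>ts\<in>?T. prod_list (map r ts) * (cmod (u \<bullet>c basis_vec ts))\<^sup>2)"
    unfolding of_real_sum
  proof (rule sum.cong)
    fix ts assume "ts \<in> ?T"
    then have "basis_vec ts \<bullet>c u = cnj (u \<bullet>c basis_vec ts)" using cprod_cnj[OF u bc] by simp
    then show "complex_of_real (prod_list (map r ts)) * ((basis_vec ts \<bullet>c u) * (u \<bullet>c basis_vec ts))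
      = complex_of_real (prod_list (map r ts) * (cmod (u \<bullet>c basis_vec ts))\<^sup>2)"
      by (simp only: of_real_mult complex_norm_square mult.commute)
  qed simp
  finally have "iid n pairs joint (\<lambda>zs. (cmod ((avg_proj \<delta> n *\<^sub>v state_vec zs) \<bullet>c u))\<^sup>2)
    = (\<Sum>ts\<in>?T. prod_list (map r ts) * (cmod (u \<bullet>c basis_vec ts))\<^sup>2)" by (simp only: of_real_eq_iff)
  also have "\<dots> \<le> (\<Sum>ts\<in>?T. l * (cmod (u \<bullet>c basis_vec ts))\<^sup>2)"
    by (intro sum_mono mult_right_mono l) auto
  also have "\<dots> = l * (\<Sum>ts\<in>?T. (cmod (u \<bullet>c basis_vec ts))\<^sup>2)" by (simp add: sum_distrib_left)
  also have "\<dots> \<le> l * nrm2 u"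
    by (intro mult_left_mono bessel[OF finite_avg_typical avg_typical_orthonormal u] l(2))
  finally show ?thesis .
qed

text \<open>Rank times eigenvalue: the overlap bound is summed over the unit vectors spanning the
  projector of ys. An atypical ys has projector 0, so the bound is uniform in ys.\<close>

lemma dec_proj_overlap_bound:
  assumes ys: "ys \<in> seqs n {0..<k}" and n: "0 < n" and \<delta>: "0 < \<delta>"
  shows "iid n pairs joint (\<lambda>zs. nrm2 (dec_proj k d p e q \<delta> ys *\<^sub>v (avg_proj \<delta> n *\<^sub>v state_vec zs)))
    \<le> 2 powr (real n * (1 + \<delta>)\<^sup>2 * cond_entropy) * 2 powr (- (real n * (1 - \<delta>) * vn_entropy avg_state))"
    (is "_ \<le> ?K * ?l")
proof (cases "ys \<in> typical_set k p \<delta> n")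
  case True
  let ?T = "{ss \<in> seqs n {0..<d}. cond_typical k d q \<delta> ys ss}"
  let ?u = "\<lambda>ss. tensor_vec_list (map2 e ys ss)"
  have fin: "finite ?T" by (simp add: finite_seqs)
  have P: "dec_proj k d p e q \<delta> ys = span_proj (d ^ n) ?u ?T"
    using True ys cond_typ_proj_span[OF ys] by (simp add: dec_proj_def seqs_def)
  have "iid n pairs joint (\<lambda>zs. nrm2 (dec_proj k d p e q \<delta> ys *\<^sub>v (avg_proj \<delta> n *\<^sub>v state_vec zs)))
    = iid n pairs joint (\<lambda>zs. \<Sum>ss\<in>?T. (cmod ((avg_proj \<delta> n *\<^sub>v state_vec zs) \<bullet>c ?u ss))\<^sup>2)"
    unfolding P
    by (intro iid_cong nrm2_span_proj[OF fin cond_typ_orthonormal[OF ys]]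
        projection_vec_carrier[OF avg_proj_projection] state_vec_unit)
  also have "\<dots> \<le> (\<Sum>ss\<in>?T. ?l)"
    unfolding iid_sum
  proof (rule sum_mono)
    fix ss assume "ss \<in> ?T"
    then have u: "?u ss \<in> carrier_vec (d ^ n)" "nrm2 (?u ss) = 1"
      using cond_typ_orthonormal[OF ys, of \<delta>] by (auto simp: orthonormal_on_def nrm2_def)
    show "iid n pairs joint (\<lambda>zs. (cmod ((avg_proj \<delta> n *\<^sub>v state_vec zs) \<bullet>c ?u ss))\<^sup>2) \<le> ?l"
      using avg_proj_overlap_bound[OF u(1) avg_typical_prob_le, of \<delta>] u(2) by simp
  qed
  also have "\<dots> = real (card ?T) * ?l" by simp
  also have "\<dots> \<le> ?K * ?l"
    using card_cond_typical_le[OF True n] \<delta> by (intro mult_right_mono) auto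
  finally show ?thesis .
next
  case False
  have "nrm2 (dec_proj k d p e q \<delta> ys *\<^sub>v (avg_proj \<delta> n *\<^sub>v state_vec zs)) = 0" if "zs \<in> seqs n pairs" for zs
  proof -
    have w: "avg_proj \<delta> n *\<^sub>v state_vec zs \<in> carrier_vec (d ^ n)"
      by (intro projection_vec_carrier[OF avg_proj_projection] state_vec_unit that)
    have "dec_proj k d p e q \<delta> ys = 0\<^sub>m (d ^ n) (d ^ n)" using False ys by (simp add: dec_proj_def seqs_def)
    moreover have "0\<^sub>m (d ^ n) (d ^ n) *\<^sub>v (avg_proj \<delta> n *\<^sub>v state_vec zs) = 0\<^sub>v (d ^ n)"
      by (rule zero_mat_mult_vec[OF w])
    ultimately show ?thesis by (simp add: nrm2_def)
  qed
  then have "iid n pairs joint (\<lambda>zs. nrm2 (dec_proj k d p e q \<delta> ys *\<^sub>v (avg_proj \<delta> n *\<^sub>v state_vec zs))) = 0"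
    by (simp add: iid_def)
  then show ?thesis by simp
qed

theorem random_code_error:
  assumes R: "R < vn_entropy avg_state - cond_entropy" and \<eta>: "0 < \<eta>"
  shows "\<exists>\<delta> n. 0 < \<delta> \<and> \<delta> < 1 / 64 \<and> 0 < n \<and>
    expected_error k d p \<rho> e q \<delta> n (nat \<lfloor>2 powr (real n * R)\<rfloor>) \<le> \<eta>"
proof -
  define S where "S = vn_entropy avg_state"
  define H where "H = cond_entropy"
  \<comment> \<open>Half the gap between capacity term and rate: one half pays for the typicality
    tolerance, the other remains as the decay exponent.\<close>
  define g where "g = (S - H - R) / 2"
  have g2: "2 * g = S - H - R" by (simp add: g_def)
  have g: "0 < g" using R by (simp add: g_def S_def H_def)
  have S: "0 \<le> S" and H: "0 \<le> H" by (simp_all add: S_def H_def avg_entropy_nonneg cond_entropy_nonneg)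
  \<comment> \<open>The tolerance costs \<delta> S + (2 \<delta> + \<delta>^2) H in the exponent, at
    most \<delta> (S + 3 H) because \<delta> is at most 1. The added 1 keeps the denominator
    positive, and 1/128 keeps \<delta> strictly below 1/64.\<close>
  define \<delta> where "\<delta> = min (1 / 128) (g / (S + 3 * H + 1))"
  have pos: "0 < S + 3 * H + 1" using S H by simp
  have \<delta>: "0 < \<delta>" "\<delta> < 1 / 64" "\<delta> \<le> 1" using g pos by (auto simp: \<delta>_def)
  have "\<delta> * (S + 3 * H) \<le> g"
  proof -
    have "\<delta> * (S + 3 * H) \<le> \<delta> * (S + 3 * H + 1)" using \<delta> by (intro mult_left_mono) auto
    also have "\<dots> \<le> g / (S + 3 * H + 1) * (S + 3 * H + 1)"
      using pos by (intro mult_right_mono) (auto simp: \<delta>_def)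
    finally show ?thesis using pos by simp
  qed
  moreover have "\<delta>\<^sup>2 * H \<le> \<delta> * H"
    using \<delta> H by (intro mult_right_mono) (auto simp: power2_eq_square mult_left_le)
  moreover have "R + (1 + \<delta>)\<^sup>2 * H - (1 - \<delta>) * S = - 2 * g + \<delta> * (S + 3 * H) + (\<delta>\<^sup>2 * H - \<delta> * H)"
    using g2 by (simp add: power2_eq_square algebra_simps)
  ultimately have expo: "R + (1 + \<delta>)\<^sup>2 * H - (1 - \<delta>) * S \<le> - g" by linarith
  \<comment> \<open>Half of the allowed error is spent on the perturbation constant. It is fixed
    now, so the coefficient 10 + 1/c does not depend on n, and the other half covers all terms that
    vanish with n.\<close>
  define c where "c = \<eta> / 2"
  have c: "0 < c" using \<eta> by (simp add: c_def)
  define C1 where "C1 = (10 + 1 / c) * (\<Sum>t\<in>{0..<d}. 1 / (\<delta>\<^sup>2 * r t))"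
  define C2 where "C2 = 8 * (\<Sum>z\<in>pairs. 1 / ((\<delta> / 4)\<^sup>2 * joint z))"
  have bound: "expected_error k d p \<rho> e q \<delta> n (nat \<lfloor>2 powr (real n * R)\<rfloor>)
      \<le> c + C1 / n + 4 * (2 powr (- g)) ^ n + C2 / n" if n: "0 < n" for n
  proof -
    let ?M = "nat \<lfloor>2 powr (real n * R)\<rfloor>"
    let ?G = "2 powr (real n * (1 + \<delta>)\<^sup>2 * H) * 2 powr (- (real n * (1 - \<delta>) * S))"
    have M: "real ?M \<le> 2 powr (real n * R)" by simp
    have "real ?M * ?G \<le> 2 powr (real n * R) * ?G" using M by (intro mult_right_mono) auto
    also have "\<dots> = 2 powr (real n * (R + (1 + \<delta>)\<^sup>2 * H - (1 - \<delta>) * S))"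
      by (simp add: algebra_simps flip: powr_add)
    also have "\<dots> \<le> 2 powr (real n * (- g))"
      using expo by (intro powr_mono mult_left_mono) auto
    also have "\<dots> = (2 powr (- g)) ^ n"
      by (simp add: powr_realpow[symmetric] powr_powr mult.commute)
    finally have MG: "real ?M * ?G \<le> (2 powr (- g)) ^ n" .
    have "expected_error k d p \<rho> e q \<delta> n ?M
      \<le> c + (10 + 1 / c) * iid n pairs joint (\<lambda>zs. nrm2 (state_vec zs - avg_proj \<delta> n *\<^sub>v state_vec zs))
        + 4 * (real ?M * ?G)
        + 8 * iid n pairs joint (\<lambda>zs. nrm2 (state_vec zs - dec_proj k d p e q \<delta> (map fst zs) *\<^sub>v state_vec zs))"
      by (rule expected_error_bound[OF avg_proj_projection c])
         (simp_all add: S_def H_def dec_proj_overlap_bound[OF _ n \<delta>(1)])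
    also have "\<dots> \<le> c + (10 + 1 / c) * ((\<Sum>t\<in>{0..<d}. 1 / (\<delta>\<^sup>2 * r t)) / real n)
        + 4 * (2 powr (- g)) ^ n + 8 * ((\<Sum>z\<in>pairs. 1 / ((\<delta> / 4)\<^sup>2 * joint z)) / real n)"
      by (intro add_mono mult_left_mono order_refl avg_proj_miss_bound dec_proj_miss_bound MG n \<delta>)
         (use c in auto)
    finally show ?thesis by (simp add: C1_def C2_def)
  qed
  have "2 powr (- g) < 1" using g by (simp add: powr_less_one)
  then have "(\<lambda>n. (2 powr (- g)) ^ n) \<longlonglongrightarrow> 0" by (intro LIMSEQ_realpow_zero) auto
  then have "(\<lambda>n. c + C1 / real n + 4 * (2 powr (- g)) ^ n + C2 / real n) \<longlonglongrightarrow> c + 0 + 4 * 0 + 0"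
    by (intro tendsto_add tendsto_mult tendsto_const lim_const_over_n)
  then have "\<forall>\<^sub>F n in sequentially. c + C1 / real n + 4 * (2 powr (- g)) ^ n + C2 / real n < \<eta>"
    by (rule order_tendstoD(2)) (use \<eta> in \<open>simp add: c_def\<close>)
  then have "\<forall>\<^sub>F n in sequentially. c + C1 / real n + 4 * (2 powr (- g)) ^ n + C2 / real n < \<eta> \<and> 0 < n"
    using eventually_gt_at_top[of "0 :: nat"] by (rule eventually_conj)
  then obtain n where n: "c + C1 / real n + 4 * (2 powr (- g)) ^ n + C2 / real n < \<eta>" "0 < n"
    using eventually_happens'[OF sequentially_bot] by blast
  then have "expected_error k d p \<rho> e q \<delta> n (nat \<lfloor>2 powr (real n * R)\<rfloor>) \<le> \<eta>"
    using bound[OF n(2)] by linarith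
  with \<delta> n(2) show ?thesis by blast
qed

end

theorem theorem1:
  fixes k d :: nat and p :: "nat \<Rightarrow> real" and \<rho> :: "nat \<Rightarrow> complex mat"
    and e :: "nat \<Rightarrow> nat \<Rightarrow> complex vec" and q :: "nat \<Rightarrow> nat \<Rightarrow> real"
    and R \<eta> :: real
  assumes d_pos: "d > 0"
    and p_nonneg: "\<forall>x<k. p x \<ge> 0" and p_sum: "(\<Sum>x<k. p x) = 1"
    and rho_carrier: "\<forall>x<k. \<rho> x \<in> carrier_mat d d"
    and rho_herm: "\<forall>x<k. mat_adjoint (\<rho> x) = \<rho> x"
    and rho_pos: "\<forall>x<k. \<forall>v \<in> carrier_vec d. Re ((\<rho> x *\<^sub>v v) \<bullet>c v) \<ge> 0"
    and rho_tr: "\<forall>x<k. mtrace (\<rho> x) = 1"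
    and e_carrier: "\<forall>x<k. \<forall>s<d. e x s \<in> carrier_vec d"
    and e_orthonormal: "\<forall>x<k. \<forall>s<d. \<forall>t<d. e x s \<bullet>c e x t = (if s = t then 1 else 0)"
    and eig_decomp: "\<forall>x<k. \<rho> x = sum_matrix d (\<lambda>s. complex_of_real (q x s) \<cdot>\<^sub>m outer (e x s)) {0..<d}"
    and rate: "R < mutual_info k d (cq_state k d p \<rho>)"
    and eta: "\<eta> > 0"
  shows "\<exists>\<delta> n. 0 < \<delta> \<and> \<delta> < 1/64 \<and> 0 < n \<and>
           expected_error k d p \<rho> e q \<delta> n (nat \<lfloor>2 powr (real n * R)\<rfloor>) \<le> \<eta>"
proof -
  have on: "orthonormal_on d (e x) {0..<d}" if "x < k" for x
    using e_carrier e_orthonormal that unfolding orthonormal_on_def by simp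
  have rho: "\<rho> x = sum_matrix d (\<lambda>s. complex_of_real (q x s) \<cdot>\<^sub>m outer (e x s)) {0..<d}" if "x < k" for x
    using eig_decomp that by blast
  \<comment> \<open>The number \<open>q x s\<close> is the quadratic form of the state at its unit
    eigenvector \<open>e x s\<close>, so positivity of the state applies.\<close>
  have q_nonneg: "0 \<le> q x s" if x: "x < k" and s: "s < d" for x s
  proof -
    have es: "e x s \<in> carrier_vec d" using e_carrier x s by blast
    have "\<rho> x *\<^sub>v e x s = complex_of_real (q x s) \<cdot>\<^sub>v e x s"
      using sum_matrix_outer_eigen[OF _ on[OF x], of s "q x"] s rho[OF x] by simp
    then have "(\<rho> x *\<^sub>v e x s) \<bullet>c e x s = complex_of_real (q x s) * (e x s \<bullet>c e x s)"
      using cprod_smult(1)[OF es es] by simp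
    moreover have "e x s \<bullet>c e x s = 1" using e_orthonormal x s by simp
    ultimately have "Re ((\<rho> x *\<^sub>v e x s) \<bullet>c e x s) = q x s" by simp
    then show ?thesis using rho_pos x es by (metis (no_types))
  qed
  \<comment> \<open>Each rank-one term has trace equal to the squared norm 1 of its eigenvector, so
    the trace of the state is the sum of the weights.\<close>
  have q_sum: "(\<Sum>s<d. q x s) = 1" if x: "x < k" for x
  proof -
    have "complex_of_real (\<Sum>s<d. q x s) = (\<Sum>s<d. complex_of_real (q x s) * (e x s \<bullet>c e x s))"
      using e_orthonormal x by simp
    also have "\<dots> = (\<Sum>b<d. \<Sum>s<d. complex_of_real (q x s) * (e x s $ b * cnj (e x s $ b)))"
      using e_carrier x
      by (subst sum.swap) (auto simp: cprod_sum[of _ d] sum_distrib_left intro!: sum.cong)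
    also have "\<dots> = mtrace (\<rho> x)"
      using e_carrier x
      by (simp add: mtrace_def rho[OF x]) (simp add: sum_matrix_def atLeast0LessThan smult_outer_index[of _ d])
    finally show ?thesis using rho_tr x by (metis of_real_1 of_real_eq_iff)
  qed
  interpret cq_channel k d p \<rho> e q
    using d_pos p_nonneg p_sum on rho q_nonneg q_sum by unfold_locales auto
  obtain f r where "orthonormal_on d f {0..<d}" "\<And>t. t < d \<Longrightarrow> 0 \<le> r t" "(\<Sum>t<d. r t) = 1"
    "vn_entropy avg_state = - (\<Sum>t<d. r t * log 2 (r t))"
    "\<And>t t'. t < d \<Longrightarrow> t' < d \<Longrightarrow>
      (\<Sum>z\<in>pairs. complex_of_real (joint z) * (eigvec z \<bullet>c f t) * (f t' \<bullet>c eigvec z))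
        = (if t = t' then complex_of_real (r t) else 0)"
    by (rule avg_state_eigenbasis) blast
  then interpret cq_channel_eigenbasis k d p \<rho> e q f r
    by unfold_locales
  show ?thesis using random_code_error[OF _ eta] rate mutual_info_cq_state by simp
qed

end
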